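(* Let $\mu$ be a nontrivial probability measure on $\partial\mathbb{D}$ and let $\{\alpha_n\}_{n=0}^\infty$ be its Verblunsky coefficients. Then the following are equivalent: (i) $\sum_{n=0}^\infty n|\alpha_n|^2<\infty$; (ii) the singular part of $\mu$ with respect to $\frac{d\theta}{2\pi}$ is zero, and $d\mu=e^{L}\frac{d\theta}{2\pi}$ for a real-valued $L\in L^1(\frac{d\theta}{2\pi})$ with $\sum_{k=1}^\infty k|\hat L_k|^2<\infty$.
   Context: $\partial\mathbb{D}$ is the unit circle in $\mathbb{C}$. A measure on $\partial\mathbb{D}$ is nontrivial if its support is not a finite set. For a nontrivial (finite positive) measure $\mu$, the monic orthogonal polynomial $\Phi_n(z)=z^n+\text{lower order}$ is determined by $\int \overline{e^{ij\theta}}\,\Phi_n(e^{i\theta})\,d\mu(\theta)=0$ for $j=0,\dots,n-1$. The reversed polynomial is $\Phi_n^*(z)=z^n\,\overline{\Phi_n(1/\bar z)}$. The Verblunsky coefficients are the numbers $\alpha_n\in\mathbb{D}$ with $\Phi_{n+1}(z)=z\Phi_n(z)-\bar\alpha_n\Phi_n^*(z)$; equivalently $\alpha_n=-\overline{\Phi_{n+1}(0)}$. Fourier coefficients: $\hat L_k=\int_0^{2\pi} e^{-ik\theta}L(\theta)\,\frac{d\theta}{2\pi}$. *)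

theory Defs
  imports "HOL-Probability.Probability" "HOL-Computational_Algebra.Polynomial"
begin

abbreviation circle_borel :: "complex measure" where
  "circle_borel \<equiv> restrict_space borel (sphere 0 1)"

(* d theta / (2 pi), transported to the unit circle by theta |-> e^(i theta). *)
definition circle_measure :: "complex measure" where
  "circle_measure = distr (uniform_measure lborel {0..<2 * pi}) circle_borel cis"

definition measure_support :: "'a::topological_space measure \<Rightarrow> 'a set" where
  "measure_support M =
     {x \<in> space M. \<forall>U. open U \<longrightarrow> x \<in> U \<longrightarrow> emeasure M (U \<inter> space M) > 0}"

definition nontrivial_measure :: "'a::topological_space measure \<Rightarrow> bool" where
  "nontrivial_measure M \<longleftrightarrow> infinite (measure_support M)"

(* Unique when M is nontrivial. *)
definition monic_opuc :: "complex measure \<Rightarrow> nat \<Rightarrow> complex poly" where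
  "monic_opuc M n = (THE p. degree p = n \<and> lead_coeff p = 1 \<and>
     (\<forall>j<n. (\<integral>z. cnj (z ^ j) * poly p z \<partial>M) = 0))"

(* The polynomial z^n * cnj (p (1 / cnj z)). It is given by its coefficients because
   evaluating that formula at z = 0 would involve the HOL convention 1 / 0 = 0;
   poly_reversed_poly below identifies the two. *)
definition reversed_poly :: "nat \<Rightarrow> complex poly \<Rightarrow> complex poly" where
  "reversed_poly n p = (\<Sum>k\<le>n. monom (cnj (coeff p (n - k))) k)"

lemma poly_reversed_poly:
  assumes "degree p \<le> n" and "z \<noteq> 0"
  shows "poly (reversed_poly n p) z = z ^ n * cnj (poly p (1 / cnj z))"
proof -
  have "poly p (1 / cnj z) = (\<Sum>k\<le>n. coeff p k * (1 / cnj z) ^ k)"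
    unfolding poly_altdef using assms(1)
    by (intro sum.mono_neutral_left) (auto simp: coeff_eq_0)
  then have "z ^ n * cnj (poly p (1 / cnj z)) = (\<Sum>k\<le>n. cnj (coeff p k) * z ^ (n - k))"
    using assms(2) by (auto simp: sum_distrib_left power_diff power_divide intro!: sum.cong)
  also have "\<dots> = (\<Sum>k\<le>n. cnj (coeff p (n - k)) * z ^ k)"
    by (rule sum.reindex_bij_witness[of _ "\<lambda>k. n - k" "\<lambda>k. n - k"]) auto
  finally show ?thesis
    by (simp add: reversed_poly_def poly_sum poly_monom)
qed

definition verblunsky :: "complex measure \<Rightarrow> nat \<Rightarrow> complex" where
  "verblunsky M n = (THE a. cmod a < 1 \<and>
     monic_opuc M (Suc n) =
       monom 1 1 * monic_opuc M n - smult (cnj a) (reversed_poly n (monic_opuc M n)))"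

definition mutually_singular :: "'a measure \<Rightarrow> 'a measure \<Rightarrow> bool" where
  "mutually_singular M N \<longleftrightarrow>
     (\<exists>A \<in> sets M \<inter> sets N. emeasure M A = 0 \<and> emeasure N (space N - A) = 0)"

(* The singular summand in the Lebesgue decomposition M = w N + S of M with respect to N;
   it is unique for sigma-finite M and N on the same sigma-algebra. *)
definition singular_part :: "'a measure \<Rightarrow> 'a measure \<Rightarrow> 'a measure" where
  "singular_part N M = (THE S. sets S = sets N \<and> mutually_singular S N \<and>
     (\<exists>w \<in> borel_measurable N. \<forall>A \<in> sets N.
        emeasure M A = emeasure (density N w) A + emeasure S A))"

definition circle_fourier_coeff :: "(complex \<Rightarrow> real) \<Rightarrow> int \<Rightarrow> complex" where
  "circle_fourier_coeff L k =
     (LBINT \<theta>:{0..2 * pi}. cis (- (of_int k * \<theta>)) * complex_of_real (L (cis \<theta>))) / (2 * pi)"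

end

theory Submission
  imports Defs "HOL-Complex_Analysis.Complex_Analysis"
    "HOL-Computational_Algebra.Fundamental_Theorem_Algebra"
begin

text \<open>Write \<open>\<Phi>\<^sub>n = \<Prod>\<^sub>i (z - z\<^sub>i)\<close>. The Szego recursion gives
  \<open>\<Prod>\<^sub>i \<Phi>*\<^sub>n(z\<^sub>i) = \<Prod>\<^bsub>j<n\<^esub> (1 - |\<alpha>\<^sub>j|\<^sup>2)\<^bsup>j+1\<^esup>\<close>, and the left-hand side is
  \<open>\<Prod>\<^bsub>i,j\<^esub> (1 - z\<^sub>i cnj z\<^sub>j) = exp (- \<Sum>\<^sub>l l |a\<^sub>l|\<^sup>2)\<close> where \<open>- log \<Phi>*\<^sub>n = \<Sum>\<^sub>l a\<^sub>l z\<^sup>l\<close>. This is the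
  equivalence for the Bernstein-Szego weights \<open>|\<Phi>\<^sub>n|\<^bsup>-2\<^esup>\<close>, as an identity. Everything else is a limit,
  made possible by the Lebedev-Milin inequality
  \<open>\<integral> |exp (\<Sum>\<^sub>l a\<^sub>l z\<^sup>l)|\<^sup>2 \<le> exp (\<Sum>\<^sub>l l |a\<^sub>l|\<^sup>2)\<close>: a bound on the energy \<open>\<Sum>\<^sub>l l |a\<^sub>l|\<^sup>2\<close> bounds
  the weights in \<open>L\<^sup>2\<close>, so almost everywhere convergence of the logarithms implies convergence of the
  moments and excludes a singular part in the limit. From (i), the normalized weights
  \<open>|\<Phi>\<^sub>n|\<^bsup>-2\<^esup>\<close> have the same first moments as \<open>\<mu>\<close> and bounded energies, and a subsequence of their
  logarithms converges. From (ii), the logarithm \<open>L\<close> is approximated by trigonometric polynomials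
  \<open>2 Re p\<close>, and \<open>exp (2 Re p)\<close> by the Bernstein-Szego weights \<open>|1 - p/m|\<^bsup>-2m\<^esup>\<close>.\<close>

subsection \<open>The Szego recursion\<close>

text \<open>The identity is exact for Bernstein-Szego weights; for a general measure only
  inequalities pass to the limit, and they suffice: the terms of both energies are nonnegative, so a
  bound on partial sums gives summability. A partial sum involves finitely many Verblunsky
  coefficients, which are continuous functions of finitely many moments, or finitely many Fourier
  coefficients of the logarithm. The obstacle is that almost everywhere convergence of logarithms
  says nothing about the measures, whose mass may concentrate on small sets; an L2 bound on the
  weights is a form of uniform integrability that rules this out. A weight is |exp f|^2 with f
  analytic, so its square is |exp (2 f)|^2, and Lebedev-Milin is applied to 2 f. Multiplying a
  measure by a constant does not change its Verblunsky coefficients. Hence f is normalized to vanish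
  at 0, and the mass is accounted for separately by the product of the factors 1 - |\<alpha>_j|^2.
  The identity carries j + 1 and - ln (1 - |\<alpha>_j|^2) in place of j and |\<alpha>_j|^2; the two
  series converge together.\<close>

lemma coeff_reversed_poly:
  "coeff (reversed_poly n p) k = (if k \<le> n then cnj (coeff p (n - k)) else 0)"
  unfolding reversed_poly_def by (simp add: coeff_sum)

lemma poly_reversed_poly_circle:
  assumes "degree p \<le> n" "cmod z = 1"
  shows "poly (reversed_poly n p) z = z ^ n * cnj (poly p z)"
proof -
  have "z \<noteq> 0" using assms by auto
  moreover have "1 / cnj z = z"
    using assms(2) by (simp add: divide_simps complex_norm_square[symmetric] \<open>z \<noteq> 0\<close>)
  ultimately show ?thesis using poly_reversed_poly[OF assms(1), of z] by simp
qed

text \<open>Started from arbitrary numbers, without a measure, so that the algebra below applies to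
  any sequence; \<open>monic_opuc_szego\<close> later identifies it with the orthogonal
  polynomials.\<close>

fun szego :: "(nat \<Rightarrow> complex) \<Rightarrow> nat \<Rightarrow> complex poly" where
  "szego a 0 = 1"
| "szego a (Suc n) = pCons 0 (szego a n) - smult (cnj (a n)) (reversed_poly n (szego a n))"

abbreviation szego_rev :: "(nat \<Rightarrow> complex) \<Rightarrow> nat \<Rightarrow> complex poly" where
  "szego_rev a n \<equiv> reversed_poly n (szego a n)"

lemma degree_monic_iff:
  "degree p = n \<and> lead_coeff p = (1::complex) \<longleftrightarrow> coeff p n = 1 \<and> (\<forall>k>n. coeff p k = 0)"
proof
  assume *: "coeff p n = 1 \<and> (\<forall>k>n. coeff p k = 0)"
  then have "degree p \<le> n" by (simp add: degree_le)
  moreover have "n \<le> degree p" using * by (intro le_degree) auto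
  ultimately show "degree p = n \<and> lead_coeff p = 1" using * by auto
qed (auto simp: coeff_eq_0)

lemma monic_recursion:
  assumes "degree p = n \<and> lead_coeff p = (1::complex)"
  shows "degree (pCons 0 p - smult b (reversed_poly n p)) = Suc n \<and>
    lead_coeff (pCons 0 p - smult b (reversed_poly n p)) = 1"
  using assms unfolding degree_monic_iff
  by (auto simp: coeff_reversed_poly coeff_pCons split: nat.splits)

lemma monic_szego: "degree (szego a n) = n \<and> lead_coeff (szego a n) = 1"
proof (induction n)
  case 0 then show ?case by simp
next
  case (Suc n)
  show ?case unfolding szego.simps by (rule monic_recursion[OF Suc])
qed

lemma degree_szego [simp]: "degree (szego a n) = n"
  using monic_szego by blast

lemma coeff_szego [simp]: "coeff (szego a n) n = 1"
  using monic_szego[of a n] by simp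

text \<open>Reversal in degree n + 1 is conjugate linear; it turns \<open>pCons 0 p\<close> into the
  reversal of p in degree n, and that reversal into \<open>pCons 0 p\<close>.\<close>

lemma szego_rev_Suc:
  "szego_rev a (Suc n) = szego_rev a n - smult (a n) (pCons 0 (szego a n))"
proof (rule poly_eqI)
  fix k
  show "coeff (szego_rev a (Suc n)) k = coeff (szego_rev a n - smult (a n) (pCons 0 (szego a n))) k"
  proof (cases k)
    case 0
    then show ?thesis by (simp add: coeff_reversed_poly)
  next
    case (Suc j)
    show ?thesis
    proof (cases "j \<le> n")
      case True
      then obtain i where n: "n = j + i" using le_Suc_ex by blast
      show ?thesis unfolding Suc n
        by (cases i) (simp_all add: coeff_reversed_poly)
    next
      case False
      then show ?thesis unfolding Suc by (simp add: coeff_reversed_poly coeff_eq_0)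
    qed
  qed
qed

lemma poly_szego_Suc:
  "poly (szego a (Suc n)) z = z * poly (szego a n) z - cnj (a n) * poly (szego_rev a n) z"
  by simp

lemma poly_szego_rev_Suc:
  "poly (szego_rev a (Suc n)) z = poly (szego_rev a n) z - a n * (z * poly (szego a n) z)"
  unfolding szego_rev_Suc by simp

text \<open>The induction rests on the identity
  \<open>|\<Phi>*\<^bsub>n+1\<^esub>|\<^sup>2 - |\<Phi>\<^bsub>n+1\<^esub>|\<^sup>2 = (1 - |a\<^sub>n|\<^sup>2) (|\<Phi>*\<^sub>n|\<^sup>2 - |z \<Phi>\<^sub>n|\<^sup>2)\<close>.\<close>
lemma szego_disc:
  assumes "\<And>j. j < n \<Longrightarrow> cmod (a j) < 1" "cmod z \<le> 1"
  shows "cmod (poly (szego a n) z) \<le> cmod (poly (szego_rev a n) z) \<and> poly (szego_rev a n) z \<noteq> 0"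
  using assms(1)
proof (induction n)
  case 0
  then show ?case by (simp add: reversed_poly_def)
next
  case (Suc n)
  define u v b where "u = poly (szego_rev a n) z" and "v = z * poly (szego a n) z" and "b = a n"
  have IH: "cmod (poly (szego a n) z) \<le> cmod u" "u \<noteq> 0"
    using Suc unfolding u_def by auto
  have b: "cmod b < 1" using Suc(2) unfolding b_def by auto
  have vu: "cmod v \<le> cmod u"
    unfolding v_def norm_mult using mult_mono[OF assms(2) IH(1)] by simp
  have "of_real ((cmod (u - b * v))\<^sup>2 - (cmod (v - cnj b * u))\<^sup>2) = (of_real ((1 - (cmod b)\<^sup>2) * ((cmod u)\<^sup>2 - (cmod v)\<^sup>2)) :: complex)"
    unfolding of_real_diff of_real_mult of_real_1 complex_norm_square
    by (simp add: algebra_simps)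
  then have "(cmod (u - b * v))\<^sup>2 - (cmod (v - cnj b * u))\<^sup>2 = (1 - (cmod b)\<^sup>2) * ((cmod u)\<^sup>2 - (cmod v)\<^sup>2)"
    unfolding of_real_eq_iff .
  moreover have "\<dots> \<ge> 0"
    using b vu by (intro mult_nonneg_nonneg) (auto simp: power_le_one)
  ultimately have "cmod (v - cnj b * u) \<le> cmod (u - b * v)"
    by (intro power2_le_imp_le[OF _ norm_ge_zero]) linarith
  moreover have "u - b * v \<noteq> 0"
  proof
    assume "u - b * v = 0"
    then have "cmod u = cmod b * cmod v" by (simp add: norm_mult)
    also have "\<dots> \<le> cmod b * cmod u" using vu by (simp add: mult_left_mono)
    also have "\<dots> < cmod u" using b IH(2) by simp
    finally show False by simp
  qed
  ultimately show ?case
    unfolding poly_szego_rev_Suc poly_szego_Suc u_def v_def b_def by simp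
qed

text \<open>A root z outside the open disc reflects to the root \<open>1 / cnj z\<close> of the
  reversed polynomial in the closed disc, which \<open>szego_disc\<close> excludes.\<close>

lemma szego_root_in_disc:
  assumes "\<And>j. j < n \<Longrightarrow> cmod (a j) < 1" "poly (szego a n) z = 0"
  shows "cmod z < 1"
proof (rule ccontr)
  assume "\<not> cmod z < 1"
  then have z: "cmod z \<ge> 1" by simp
  then have nz: "1 / cnj z \<noteq> 0" by auto
  have "poly (szego_rev a n) (1 / cnj z) = 0"
    using poly_reversed_poly[of "szego a n" n, OF _ nz] assms(2) by simp
  moreover have "cmod (1 / cnj z) \<le> 1" using z by (simp add: norm_divide divide_le_eq_1)
  ultimately show False using szego_disc[OF assms(1), where z = "1 / cnj z"] by auto
qed

section \<open>Products over the roots, the resultant, and power sums\<close>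

lemma poly_prod_mset_linear:
  "poly (\<Prod>x\<in>#Z. [:- f x, g x:]) w = (\<Prod>x\<in>#Z. g x * w - f x :: complex)"
  by (induction Z) (auto simp: algebra_simps)

lemma cnj_prod_mset: "cnj (\<Prod>x\<in>#Z. f x) = (\<Prod>x\<in>#Z. cnj (f x))"
  by (induction Z) auto

lemma poly_monic_eq:
  assumes "lead_coeff p = (1::complex)"
  shows "poly p w = (\<Prod>x\<in>#proots p. w - x)"
  by (subst complex_poly_decompose_multiset[of p, symmetric])
     (simp only: assms smult_1_left, use poly_prod_mset_linear[of "\<lambda>x. x" "\<lambda>x. 1" "proots p" w] in simp)

text \<open>Reversal acts on each linear factor. A root at 0 contributes the factor 1, so the degree
  may drop while the product still runs over all n roots.\<close>

lemma poly_reversed_monic: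
  assumes "degree p = n" "lead_coeff p = 1"
  shows "poly (reversed_poly n p) w = (\<Prod>y\<in>#proots p. 1 - cnj y * w)"
proof (cases "w = 0")
  case True
  have "poly (reversed_poly n p) 0 = 1"
    using assms by (simp add: poly_0_coeff_0 coeff_reversed_poly)
  with True show ?thesis by simp
next
  case False
  have "w ^ n = (\<Prod>y\<in>#proots p. w)"
    using assms by (simp add: size_proots_complex)
  then have "poly (reversed_poly n p) w = (\<Prod>y\<in>#proots p. w) * (\<Prod>y\<in>#proots p. 1 / w - cnj y)"
    using poly_reversed_poly[of p n w] False assms by (simp add: poly_monic_eq cnj_prod_mset)
  also have "\<dots> = (\<Prod>y\<in>#proots p. w * (1 / w - cnj y))"
    by (simp add: prod_mset.distrib)
  also have "\<dots> = (\<Prod>y\<in>#proots p. 1 - cnj y * w)"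
    using False by (simp add: algebra_simps)
  finally show ?thesis .
qed

text \<open>At the roots of \<open>\<Phi>\<^bsub>n+1\<^esub>\<close> the recursion gives \<open>\<Phi>*\<^bsub>n+1\<^esub> = (1 - |a\<^sub>n|\<^sup>2) \<Phi>*\<^sub>n\<close>, and at the
  roots of \<open>\<Phi>\<^sub>n\<close> it gives \<open>\<Phi>*\<^bsub>n+1\<^esub> = \<Phi>*\<^sub>n\<close>; the symmetry of the double product connects the two.\<close>
lemma resultant_szego:
  "(\<Prod>x\<in>#proots (szego a n). \<Prod>y\<in>#proots (szego a n). 1 - x * cnj y) =
     of_real (\<Prod>j<n. (1 - (cmod (a j))\<^sup>2) ^ Suc j)"
proof (induction n)
  case 0
  then show ?case by simp
next
  case (Suc n)
  define W where "W = proots (szego a (Suc n))"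
  define Z where "Z = proots (szego a n)"
  have rZ: "poly (szego_rev a n) w = (\<Prod>y\<in>#Z. 1 - cnj y * w)" for w
    unfolding Z_def by (rule poly_reversed_monic) (use monic_szego in auto)
  have rW: "poly (szego_rev a (Suc n)) w = (\<Prod>y\<in>#W. 1 - cnj y * w)" for w
    unfolding W_def by (rule poly_reversed_monic) (use monic_szego in blast)+
  have ne: "szego a k \<noteq> 0" for k
    using coeff_szego[of a k] by (metis coeff_0 zero_neq_one)
  have sW: "size W = Suc n" unfolding W_def size_proots_complex degree_szego ..
  have atW: "poly (szego_rev a (Suc n)) x = of_real (1 - (cmod (a n))\<^sup>2) * poly (szego_rev a n) x"
    if "x \<in># W" for x
  proof -
    have "poly (szego a (Suc n)) x = 0"
      using that set_count_proots[OF ne[of "Suc n"]] unfolding W_def by blast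
    then have eq: "x * poly (szego a n) x = cnj (a n) * poly (szego_rev a n) x"
      unfolding poly_szego_Suc by simp
    show ?thesis unfolding poly_szego_rev_Suc eq of_real_diff complex_norm_square
      by (simp add: algebra_simps)
  qed
  have atZ: "poly (szego_rev a (Suc n)) x = poly (szego_rev a n) x" if "x \<in># Z" for x
  proof -
    have "poly (szego a n) x = 0"
      using that set_count_proots[OF ne[of n]] unfolding Z_def by blast
    then show ?thesis unfolding poly_szego_rev_Suc by simp
  qed
  have dZ: "(\<Prod>x\<in>#Z. poly (szego_rev a n) x) = of_real (\<Prod>j<n. (1 - (cmod (a j))\<^sup>2) ^ Suc j)"
    using Suc unfolding Z_def[symmetric] rZ by (simp add: mult.commute)
  have "(\<Prod>x\<in>#W. \<Prod>y\<in>#W. 1 - x * cnj y) = (\<Prod>x\<in>#W. poly (szego_rev a (Suc n)) x)"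
    unfolding rW by (simp add: mult.commute)
  also have "\<dots> = (\<Prod>x\<in>#W. of_real (1 - (cmod (a n))\<^sup>2) * poly (szego_rev a n) x)"
    using atW by (intro arg_cong[of _ _ prod_mset] image_mset_cong) auto
  \<comment> \<open>The factor comes out once per root of \<Phi>_(n+1); this is the origin of the
    exponent n + 1.\<close>
  also have "\<dots> = of_real (1 - (cmod (a n))\<^sup>2) ^ Suc n * (\<Prod>x\<in>#W. \<Prod>y\<in>#Z. 1 - cnj y * x)"
    unfolding rZ by (simp add: prod_mset.distrib sW)
  also have "(\<Prod>x\<in>#W. \<Prod>y\<in>#Z. 1 - cnj y * x) = (\<Prod>y\<in>#Z. \<Prod>x\<in>#W. 1 - cnj y * x)"
    by (rule prod_mset.swap)
  also have "\<dots> = (\<Prod>y\<in>#Z. cnj (poly (szego_rev a (Suc n)) y))"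
    unfolding rW cnj_prod_mset by (simp add: mult.commute)
  also have "\<dots> = (\<Prod>y\<in>#Z. cnj (poly (szego_rev a n) y))"
    using atZ by (intro arg_cong[of _ _ prod_mset] image_mset_cong) auto
  also have "\<dots> = of_real (\<Prod>j<n. (1 - (cmod (a j))\<^sup>2) ^ Suc j)"
    unfolding cnj_prod_mset[symmetric] dZ by simp
  finally show ?case unfolding W_def[symmetric] by (simp add: mult.commute)
qed

text \<open>The coefficients of \<open>- log (\<Prod>x. 1 - cnj x * z)\<close>; the constant coefficient is 0 since \<open>x / 0 = 0\<close>.\<close>
definition power_sum_coeff :: "complex multiset \<Rightarrow> nat \<Rightarrow> complex" where
  "power_sum_coeff Z l = (\<Sum>x\<in>#Z. cnj x ^ l) / of_nat l"

lemma sums_sum_mset: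
  fixes f :: "'a \<Rightarrow> nat \<Rightarrow> 'b::real_normed_vector"
  assumes "\<And>x. x \<in># Z \<Longrightarrow> f x sums g x"
  shows "(\<lambda>n. \<Sum>x\<in>#Z. f x n) sums (\<Sum>x\<in>#Z. g x)"
  using assms by (induction Z) (auto intro: sums_add)

lemma exp_sum_mset: "exp (\<Sum>x\<in>#Z. f x) = (\<Prod>x\<in>#Z. exp (f x :: complex))"
  by (induction Z) (auto simp: exp_add)

lemma sums_ln_one_minus:
  assumes "cmod z < 1" shows "(\<lambda>n. z ^ n / of_nat n) sums - Ln (1 - z)"
  using sums_minus[OF Ln_series'[of "-z"]] assms by simp

lemma norm_power_sum_coeff_le:
  assumes "\<And>x. x \<in># Z \<Longrightarrow> cmod x \<le> r"
  shows "cmod (of_nat l * power_sum_coeff Z l) \<le> real (size Z) * r ^ l"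
proof (cases "l = 0")
  case False
  have "cmod (\<Sum>x\<in>#Z. cnj x ^ l) \<le> (\<Sum>x\<in>#Z. r ^ l)" using assms
  proof (induction Z)
    case (add x Z)
    have "cmod (\<Sum>x\<in>#add_mset x Z. cnj x ^ l) \<le> cmod (cnj x ^ l) + cmod (\<Sum>x\<in>#Z. cnj x ^ l)"
      by (simp add: norm_triangle_ineq)
    also have "\<dots> \<le> r ^ l + (\<Sum>x\<in>#Z. r ^ l)"
      using add by (intro add_mono) (auto simp: norm_power intro!: power_mono)
    finally show ?case by simp
  qed simp
  with False show ?thesis by (simp add: power_sum_coeff_def)
qed simp

lemma max_norm_mset:
  assumes "\<And>x. x \<in># Z \<Longrightarrow> cmod x < 1"
  obtains r where "0 \<le> r" "r < 1" "\<And>x. x \<in># Z \<Longrightarrow> cmod x \<le> r"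
proof
  \<comment> \<open>Inserting 0 covers the empty multiset and makes the radius nonnegative.\<close>
  let ?r = "Max (insert 0 (cmod ` set_mset Z))"
  show "0 \<le> ?r" by (intro Max_ge) auto
  show "?r < 1" using assms by (subst Max_less_iff) auto
  show "cmod x \<le> ?r" if "x \<in># Z" for x using that by (intro Max_ge) auto
qed

lemma summable_norm_power_sum_coeff:
  assumes "\<And>x. x \<in># Z \<Longrightarrow> cmod x < 1"
  shows "summable (\<lambda>l. cmod (of_nat l * power_sum_coeff Z l))"
    and "summable (\<lambda>l. cmod (power_sum_coeff Z l))"
proof -
  obtain r where r: "0 \<le> r" "r < 1" "\<And>x. x \<in># Z \<Longrightarrow> cmod x \<le> r"
    using max_norm_mset[OF assms] by blast
  show *: "summable (\<lambda>l. cmod (of_nat l * power_sum_coeff Z l))"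
  proof (rule summable_comparison_test)
    show "summable (\<lambda>l. real (size Z) * r ^ l)"
      using r by (intro summable_mult summable_geometric) auto
    show "\<exists>N. \<forall>n\<ge>N. norm (cmod (of_nat n * power_sum_coeff Z n)) \<le> real (size Z) * r ^ n"
      using norm_power_sum_coeff_le[OF r(3)] by auto
  qed
  show "summable (\<lambda>l. cmod (power_sum_coeff Z l))"
  proof (rule summable_comparison_test[OF _ *], intro exI allI impI)
    fix l :: nat assume "1 \<le> l"
    have "1 * cmod (power_sum_coeff Z l) \<le> real l * cmod (power_sum_coeff Z l)"
      using \<open>1 \<le> l\<close> by (intro mult_right_mono) auto
    then show "norm (cmod (power_sum_coeff Z l)) \<le> cmod (of_nat l * power_sum_coeff Z l)"
      by (simp add: norm_mult)
  qed
qed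

text \<open>Principal logarithms are taken factor by factor, each \<open>1 - cnj x * z\<close> lying
  within distance less than 1 of 1. Only the exponential of their sum is used, so branches do not
  matter.\<close>

lemma exp_power_sum_series:
  assumes "\<And>x. x \<in># Z \<Longrightarrow> cmod x < 1" "cmod z \<le> 1"
  shows "exp (- (\<Sum>l. power_sum_coeff Z l * z ^ l)) = (\<Prod>x\<in>#Z. 1 - cnj x * z)"
proof -
  have lt: "cmod (cnj x * z) < 1" if "x \<in># Z" for x
    using assms(1)[OF that] assms(2) mult_mono[of "cmod x" "cmod x" "cmod z" 1]
    by (simp add: norm_mult)
  have "(\<lambda>l. \<Sum>x\<in>#Z. (cnj x * z) ^ l / of_nat l) sums (\<Sum>x\<in>#Z. - Ln (1 - cnj x * z))"
    using lt by (intro sums_sum_mset sums_ln_one_minus)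
  moreover have "(\<Sum>x\<in>#Z. (cnj x * z) ^ l / of_nat l) = power_sum_coeff Z l * z ^ l" for l
    unfolding power_sum_coeff_def power_mult_distrib
    by (induction Z) (auto simp: algebra_simps add_divide_distrib)
  ultimately have "(\<Sum>l. power_sum_coeff Z l * z ^ l) = (\<Sum>x\<in>#Z. - Ln (1 - cnj x * z))"
    by (simp add: sums_iff)
  also have "- \<dots> = (\<Sum>x\<in>#Z. Ln (1 - cnj x * z))"
    by (induction Z) auto
  also have "exp \<dots> = (\<Prod>x\<in>#Z. exp (Ln (1 - cnj x * z)))"
    by (rule exp_sum_mset)
  also have "\<dots> = (\<Prod>x\<in>#Z. 1 - cnj x * z)"
    using lt by (intro arg_cong[of _ _ prod_mset] image_mset_cong exp_Ln) fastforce
  finally show ?thesis .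
qed

text \<open>When the series of - Ln (1 - x cnj y) is summed over all pairs of roots, its l-th term
  factors into a power sum times the conjugate power sum, divided by l; this is l |a_l|^2.\<close>

lemma energy_power_sums:
  assumes Z: "\<And>x. x \<in># Z \<Longrightarrow> cmod x < 1"
    and P: "(\<Prod>x\<in>#Z. \<Prod>y\<in>#Z. 1 - x * cnj y) = of_real P" "P > 0"
  shows "(\<lambda>l. real l * (cmod (power_sum_coeff Z l))\<^sup>2) sums (- ln P)"
proof -
  let ?T = "\<Sum>x\<in>#Z. \<Sum>y\<in>#Z. - Ln (1 - x * cnj y)"
  have lt: "cmod (x * cnj y) < 1" if "x \<in># Z" "y \<in># Z" for x y
    using Z that mult_strict_mono'[of "cmod x" 1 "cmod y" 1] by (simp add: norm_mult)
  have "(\<lambda>l. \<Sum>x\<in>#Z. \<Sum>y\<in>#Z. (x * cnj y) ^ l / of_nat l) sums ?T"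
    using lt by (intro sums_sum_mset sums_ln_one_minus)
  moreover have "(\<Sum>x\<in>#Z. \<Sum>y\<in>#Z. (x * cnj y) ^ l / of_nat l) = of_real (real l * (cmod (power_sum_coeff Z l))\<^sup>2)" for l
  proof -
    have c: "cnj (\<Sum>x\<in>#Z. cnj x ^ l) = (\<Sum>x\<in>#Z. x ^ l)"
      by (induction Z) auto
    have "(\<Sum>x\<in>#Z. \<Sum>y\<in>#Z. (x * cnj y) ^ l / of_nat l) = (\<Sum>x\<in>#Z. x ^ l * (\<Sum>y\<in>#Z. cnj y ^ l) / of_nat l)"
      by (simp add: power_mult_distrib sum_mset_distrib_left sum_mset_distrib_right divide_inverse mult.assoc)
    also have "\<dots> = (\<Sum>x\<in>#Z. x ^ l) * (\<Sum>y\<in>#Z. cnj y ^ l) / of_nat l"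
      by (simp add: divide_inverse mult.assoc sum_mset_distrib_right)
    also have "\<dots> = of_real (real l * (cmod (power_sum_coeff Z l))\<^sup>2)"
      unfolding of_real_mult complex_norm_square power_sum_coeff_def complex_cnj_divide c
      by (cases "l = 0") auto
    finally show ?thesis .
  qed
  \<comment> \<open>The terms are real, hence so is the sum of the logarithms; its exponential then
    determines it, with no ambiguity by multiples of 2 pi i.\<close>
  ultimately have s: "(\<lambda>l. complex_of_real (real l * (cmod (power_sum_coeff Z l))\<^sup>2)) sums ?T"
    by simp
  then have "summable (\<lambda>l. complex_of_real (real l * (cmod (power_sum_coeff Z l))\<^sup>2))"
    by (rule sums_summable)
  then have "summable (\<lambda>l. real l * (cmod (power_sum_coeff Z l))\<^sup>2)"
    using summable_Re by fastforce
  then obtain t where t: "(\<lambda>l. real l * (cmod (power_sum_coeff Z l))\<^sup>2) sums t"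
    by (auto simp: summable_def)
  then have T: "?T = of_real t"
    using s sums_of_real[OF t, where 'a = complex] sums_unique2 by blast
  have "of_real (exp (- t)) = exp (- ?T)" unfolding T by (simp flip: exp_of_real)
  also have "- ?T = (\<Sum>x\<in>#Z. - (\<Sum>y\<in>#Z. - Ln (1 - x * cnj y)))"
  proof -
    have "- (\<Sum>x\<in>#A. f x) = (\<Sum>x\<in>#A. - f x)" for A and f :: "complex \<Rightarrow> complex"
      by (induction A) auto
    then show ?thesis .
  qed
  also have "\<dots> = (\<Sum>x\<in>#Z. \<Sum>y\<in>#Z. Ln (1 - x * cnj y))"
  proof -
    have "- (\<Sum>x\<in>#A. - f x) = (\<Sum>x\<in>#A. f x)" for A and f :: "complex \<Rightarrow> complex"
      by (induction A) auto
    then show ?thesis by simp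
  qed
  also have "exp \<dots> = (\<Prod>x\<in>#Z. \<Prod>y\<in>#Z. exp (Ln (1 - x * cnj y)))"
    unfolding exp_sum_mset ..
  also have "\<dots> = (\<Prod>x\<in>#Z. \<Prod>y\<in>#Z. 1 - x * cnj y)"
    using lt by (intro arg_cong[of _ _ prod_mset] image_mset_cong exp_Ln) fastforce
  finally have "exp (- t) = P" unfolding P(1) of_real_eq_iff .
  then have "t = - ln P" by (metis ln_exp add.inverse_inverse)
  then show ?thesis using t by simp
qed

text \<open>Both energies of one Bernstein-Szego weight: the left side belongs to the logarithm of
  |\<Phi>_n|^(-2), the right side to its coefficients. The factor j + 1 is the exponent in the
  resultant.\<close>

lemma energy_szego:
  assumes a: "\<And>j. j < n \<Longrightarrow> cmod (a j) < 1"
  shows "(\<lambda>l. real l * (cmod (power_sum_coeff (proots (szego a n)) l))\<^sup>2) sums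
    (\<Sum>j<n. - real (Suc j) * ln (1 - (cmod (a j))\<^sup>2))"
proof -
  have p: "0 < 1 - (cmod (a j))\<^sup>2" if "j < n" for j
    using a[OF that] by (simp add: power_less_one_iff)
  then have p': "(cmod (a j))\<^sup>2 \<noteq> 1" if "j < n" for j
    using that by force
  have ne: "szego a n \<noteq> 0" using coeff_szego[of a n] by (metis coeff_0 zero_neq_one)
  have "(\<lambda>l. real l * (cmod (power_sum_coeff (proots (szego a n)) l))\<^sup>2) sums
      (- ln (\<Prod>j<n. (1 - (cmod (a j))\<^sup>2) ^ Suc j))"
  proof (rule energy_power_sums[OF _ resultant_szego])
    show "cmod x < 1" if "x \<in># proots (szego a n)" for x
      using that szego_root_in_disc[OF a] ne by auto
    show "(\<Prod>j<n. (1 - (cmod (a j))\<^sup>2) ^ Suc j) > 0"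
      using p by (intro prod_pos) (metis lessThan_iff zero_less_power)
  qed
  also have "- ln (\<Prod>j<n. (1 - (cmod (a j))\<^sup>2) ^ Suc j) = - (\<Sum>j<n. ln ((1 - (cmod (a j))\<^sup>2) ^ Suc j))"
    using p p' by (subst ln_prod) (auto simp del: power_Suc)
  also have "\<dots> = (\<Sum>j<n. - real (Suc j) * ln (1 - (cmod (a j))\<^sup>2))"
    using p unfolding sum_negf[symmetric]
    by (intro sum.cong refl, subst ln_realpow) (auto simp: algebra_simps simp del: power_Suc)
  finally show ?thesis .
qed

subsection \<open>The normalized arc length measure\<close>

lemma space_circle_measure [simp]: "space circle_measure = sphere 0 1"
  by (simp add: circle_measure_def)

lemma sets_circle_measure [simp, measurable_cong]: "sets circle_measure = sets circle_borel"
  by (simp add: circle_measure_def)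

lemma measurable_cis: "cis \<in> measurable (uniform_measure lborel {0..<2 * pi}) circle_borel"
proof (rule measurable_restrict_space2)
  have "cis \<in> borel_measurable borel"
    by (intro borel_measurable_continuous_onI continuous_intros)
  then show "cis \<in> borel_measurable (uniform_measure lborel {0..<2 * pi})"
    by simp
qed auto

lemma prob_space_circle_measure: "prob_space circle_measure"
  unfolding circle_measure_def
  by (intro prob_space.prob_space_distr prob_space_uniform_measure measurable_cis) auto

interpretation circle: prob_space circle_measure
  by (rule prob_space_circle_measure)

lemma prob_circle [simp]: "circle.prob (sphere 0 1) = 1"
  using circle.prob_space by simp

lemma integral_circle_measure:
  fixes f :: "complex \<Rightarrow> complex"
  assumes "f \<in> borel_measurable circle_borel"
  shows "(\<integral>z. f z \<partial>circle_measure) = (LBINT \<theta>:{0..2 * pi}. f (cis \<theta>)) / (2 * pi)"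
proof -
  have m: "(\<lambda>x. f (cis x)) \<in> borel_measurable lborel"
    using measurable_compose[OF measurable_cis assms] by simp
  have u: "uniform_measure lborel {0..<2 * pi} =
      density lborel (\<lambda>x. ennreal (indicator {0..<2 * pi} x / (2 * pi)))"
    unfolding uniform_measure_def
    by (intro arg_cong[of _ _ "density lborel"] ext) (auto simp: indicator_def divide_ennreal ennreal_1[symmetric] simp del: ennreal_1)
  have "(\<integral>z. f z \<partial>circle_measure) = (\<integral>x. f (cis x) \<partial>uniform_measure lborel {0..<2 * pi})"
    unfolding circle_measure_def by (rule integral_distr[OF measurable_cis assms])
  also have "\<dots> = (\<integral>x. (indicator {0..<2 * pi} x / (2 * pi)) *\<^sub>R f (cis x) \<partial>lborel)"
    unfolding u using m by (intro integral_density) auto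
  also have "\<dots> = (\<integral>x. (1 / (2 * pi)) *\<^sub>R (indicator {0..2 * pi} x *\<^sub>R f (cis x)) \<partial>lborel)"
  proof (rule integral_cong_AE)
    \<comment> \<open>The half-open interval counts the point 1 of the circle once; the closed
      interval of the Fourier integrals differs from it by a null set.\<close>
    have "AE x in lborel. x \<noteq> 2 * pi" by (rule AE_lborel_singleton)
    then show "AE x in lborel. (indicator {0..<2 * pi} x / (2 * pi)) *\<^sub>R f (cis x)
        = (1 / (2 * pi)) *\<^sub>R (indicator {0..2 * pi} x *\<^sub>R f (cis x))"
      by eventually_elim (auto simp: indicator_def)
  qed (use m in measurable)
  also have "\<dots> = (LBINT \<theta>:{0..2 * pi}. f (cis \<theta>)) / (2 * pi)"
    unfolding set_lebesgue_integral_def by (simp add: scaleR_conv_of_real)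
  finally show ?thesis .
qed

lemma integral_circle_power: "(\<integral>z. z ^ Suc k \<partial>circle_measure) = 0"
proof -
  have "(LBINT \<theta>:{0..2 * pi}. cis \<theta> ^ Suc k) = (\<integral>x. indicator {0..2 * pi} x *\<^sub>R cis (Suc k * x) \<partial>lborel)"
    unfolding set_lebesgue_integral_def by (simp only: Complex.DeMoivre)
  also have "\<dots> = cis (Suc k * (2 * pi)) / (\<i> * Suc k) - cis (Suc k * (0::real)) / (\<i> * Suc k)"
  proof (rule integral_FTC_atLeastAtMost)
    fix x :: real
    have "((\<lambda>w. exp (\<i> * Suc k * w) / (\<i> * Suc k)) has_field_derivative exp (\<i> * Suc k * of_real x))
        (at (of_real x))"
      by (rule derivative_eq_intros refl | simp del: of_nat_Suc)+
    from has_vector_derivative_real_field[OF this]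
    show "((\<lambda>x. cis (Suc k * x) / (\<i> * Suc k)) has_vector_derivative cis (Suc k * x))
        (at x within {0..2*pi})"
      by (simp add: cis_conv_exp mult.assoc)
  qed (auto intro!: continuous_intros)
  also have "cis (Suc k * (2 * pi)) = 1"
    using cis_multiple_2pi[of "of_nat (Suc k)"] by (simp add: mult_ac)
  finally have "(LBINT \<theta>:{0..2 * pi}. cis \<theta> ^ Suc k) = 0" by simp
  moreover have "(\<lambda>z::complex. z ^ Suc k) \<in> borel_measurable circle_borel"
    by (intro borel_measurable_continuous_on_restrict continuous_intros)
  ultimately show ?thesis by (subst integral_circle_measure) auto
qed

lemma integral_circle_cnj_power: "(\<integral>z. cnj z ^ Suc k \<partial>circle_measure) = 0"
proof -
  have "(\<integral>z. cnj (z ^ Suc k) \<partial>circle_measure) = cnj (\<integral>z. z ^ Suc k \<partial>circle_measure)"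
    by (rule Bochner_Integration.integral_cnj)
  then show ?thesis unfolding integral_circle_power by (simp only: complex_cnj_power complex_cnj_zero)
qed

lemma circle_fourier_coeff_eq:
  assumes "L \<in> borel_measurable circle_measure"
  shows "circle_fourier_coeff L (int k) = (\<integral>z. cnj z ^ k * of_real (L z) \<partial>circle_measure)"
proof -
  have "(\<lambda>z. cnj z ^ k) \<in> borel_measurable circle_borel"
    by (intro borel_measurable_continuous_on_restrict continuous_intros)
  moreover have "L \<in> borel_measurable circle_borel"
    using assms by (simp cong: measurable_cong_sets)
  ultimately have "(\<lambda>z. cnj z ^ k * of_real (L z)) \<in> borel_measurable circle_borel"
    by measurable
  then show ?thesis
    unfolding circle_fourier_coeff_def
    by (subst integral_circle_measure) (simp_all add: cis_cnj Complex.DeMoivre)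
qed

lemma integrable_continuous_circle:
  fixes f :: "complex \<Rightarrow> 'b::{banach, second_countable_topology}"
  assumes "finite_measure M" "sets M = sets circle_borel" "continuous_on (sphere 0 1) f"
  shows "integrable M f"
proof -
  interpret finite_measure M by fact
  have sp: "space M = sphere 0 1"
    using sets_eq_imp_space_eq[OF assms(2)] by simp
  have "compact (f ` sphere 0 1)" by (intro compact_continuous_image assms(3) compact_sphere)
  then obtain B where "\<And>z. z \<in> sphere 0 1 \<Longrightarrow> norm (f z) \<le> B"
    using compact_imp_bounded bounded_iff by (metis imageI)
  then show ?thesis
    using borel_measurable_continuous_on_restrict[OF assms(3)]
    by (intro integrable_const_bound[where B = B] AE_I2)
       (auto simp: sp measurable_cong_sets[OF assms(2) refl])
qed

lemmas integrable_circle [intro] =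
  integrable_continuous_circle[OF circle.finite_measure_axioms sets_circle_measure]

lemma cnj_eq_inverse_circle: "cmod z = 1 \<Longrightarrow> z * cnj z = 1"
  by (simp add: complex_norm_square[symmetric])

text \<open>Both cases are z^(i - j) with an integer exponent; subtraction of natural numbers forces
  the split.\<close>

lemma power_cnj_power:
  assumes "cmod z = 1"
  shows "z ^ i * cnj z ^ j = (if j \<le> i then z ^ (i - j) else cnj z ^ (j - i))"
proof (cases "j \<le> i")
  case True
  then have "z ^ i * cnj z ^ j = z ^ (i - j) * (z * cnj z) ^ j"
    by (simp add: power_mult_distrib power_add[symmetric])
  with True show ?thesis using cnj_eq_inverse_circle[OF assms] by simp
next
  case False
  then have "z ^ i * cnj z ^ j = cnj z ^ (j - i) * (z * cnj z) ^ i"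
    by (simp add: power_mult_distrib power_add[symmetric])
  with False show ?thesis using cnj_eq_inverse_circle[OF assms] by simp
qed

lemma orthonormal_circle:
  "(\<integral>z. z ^ i * cnj z ^ j \<partial>circle_measure) = (if i = j then 1 else 0)"
proof -
  have "(\<integral>z. z ^ i * cnj z ^ j \<partial>circle_measure) =
      (\<integral>z. (if j \<le> i then z ^ (i - j) else cnj (z ^ (j - i))) \<partial>circle_measure)"
    by (intro Bochner_Integration.integral_cong refl, subst power_cnj_power) auto
  also have "\<dots> = (if i = j then 1 else 0)"
  proof (cases i j rule: linorder_cases)
    case less
    then obtain d where "j = i + Suc d" using less_imp_Suc_add by auto
    then show ?thesis using integral_circle_cnj_power[of d] by (simp del: power_Suc)
  next
    case greater
    then obtain d where "i = j + Suc d" using less_imp_Suc_add by auto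
    then show ?thesis using integral_circle_power[of d] by (simp del: power_Suc)
  qed (simp add: circle.prob_space)
  finally show ?thesis .
qed

lemma orthonormal_circle':
  "(\<integral>z. cnj z ^ j * z ^ i \<partial>circle_measure) = (if i = j then 1 else 0)"
  using orthonormal_circle by (subst mult.commute)

subsection \<open>Absolutely convergent power series on the circle\<close>

text \<open>Used with absolutely summable coefficients, so that the series is continuous up to the
  circle and may be integrated term by term. Limits whose coefficients are merely square summable
  appear below as functions \<open>h\<close> instead.\<close>

definition pser :: "(nat \<Rightarrow> complex) \<Rightarrow> complex \<Rightarrow> complex" where
  "pser c z = (\<Sum>k. c k * z ^ k)"

lemma summable_pser:
  assumes "summable (\<lambda>k. cmod (c k))" "cmod z \<le> 1"
  shows "summable (\<lambda>k. cmod (c k * z ^ k))" "summable (\<lambda>k. c k * z ^ k)"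
proof -
  show "summable (\<lambda>k. cmod (c k * z ^ k))"
  proof (rule summable_comparison_test[OF _ assms(1)], intro exI allI impI)
    fix n :: nat
    have "cmod z ^ n \<le> 1" using assms(2) by (simp add: power_le_one)
    then show "norm (cmod (c n * z ^ n)) \<le> cmod (c n)"
      by (simp add: norm_mult norm_power mult_left_le)
  qed
  then show "summable (\<lambda>k. c k * z ^ k)" by (rule summable_norm_cancel)
qed

lemma uniform_limit_pser:
  assumes "summable (\<lambda>k. cmod (c k))"
  shows "uniform_limit (cball 0 1) (\<lambda>n z. \<Sum>k<n. c k * z ^ k) (pser c) sequentially"
  unfolding pser_def
proof (rule Weierstrass_m_test[OF _ assms])
  fix n :: nat and z :: complex assume "z \<in> cball 0 1"
  then have "cmod z ^ n \<le> 1" by (simp add: power_le_one)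
  then show "cmod (c n * z ^ n) \<le> cmod (c n)"
    by (simp add: norm_mult norm_power mult_left_le)
qed

lemma continuous_on_pser:
  assumes "summable (\<lambda>k. cmod (c k))"
  shows "continuous_on (cball 0 1) (pser c)"
  by (rule uniform_limit_theorem[OF _ uniform_limit_pser[OF assms]])
     (auto intro!: always_eventually continuous_intros)

lemma continuous_on_pser_circle:
  assumes "summable (\<lambda>k. cmod (c k))"
  shows "continuous_on (sphere 0 1) (pser c)"
  using continuous_on_pser[OF assms] by (rule continuous_on_subset) auto

text \<open>The multiplier g is free: powers of \<open>cnj z\<close> extract the coefficients,
  positive powers of z show that negative frequencies are absent, and the conjugate of the series
  itself gives Parseval.\<close>

lemma sums_integral_pser:
  assumes c: "summable (\<lambda>k. cmod (c k))" and g: "continuous_on (sphere 0 1) g"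
  shows "(\<lambda>k. c k * (\<integral>z. g z * z ^ k \<partial>circle_measure)) sums (\<integral>z. g z * pser c z \<partial>circle_measure)"
proof -
  have "compact (g ` sphere 0 1)" by (intro compact_continuous_image g compact_sphere)
  then obtain B where B: "\<And>z. z \<in> sphere 0 1 \<Longrightarrow> cmod (g z) \<le> B"
    using compact_imp_bounded bounded_iff by (metis imageI)
  have int: "integrable circle_measure (\<lambda>z. g z * (c k * z ^ k))" for k
    by (intro integrable_circle continuous_intros g)
  have le: "cmod (g z * (c k * z ^ k)) \<le> B * cmod (c k)" if "z \<in> sphere 0 1" for z k
    using B[OF that] that by (auto simp: norm_mult norm_power intro!: mult_right_mono)
  have "(\<lambda>k. \<integral>z. g z * (c k * z ^ k) \<partial>circle_measure) sums (\<integral>z. (\<Sum>k. g z * (c k * z ^ k)) \<partial>circle_measure)"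
  proof (rule sums_integral)
    show "AE z in circle_measure. summable (\<lambda>k. norm (g z * (c k * z ^ k)))"
    proof (rule AE_I2)
      fix z assume "z \<in> space circle_measure"
      then show "summable (\<lambda>k. norm (g z * (c k * z ^ k)))"
        using le by (intro summable_comparison_test[OF _ summable_mult[OF c, of B]] exI[of _ 0] allI impI) simp
    qed
    show "summable (\<lambda>k. \<integral>z. norm (g z * (c k * z ^ k)) \<partial>circle_measure)"
    proof (rule summable_comparison_test[OF _ summable_mult[OF c, of B]], intro exI allI impI)
      fix k :: nat
      have "(\<integral>z. norm (g z * (c k * z ^ k)) \<partial>circle_measure) \<le> (\<integral>z. B * cmod (c k) \<partial>circle_measure)"
        using le int by (intro integral_mono integrable_norm) auto
      then show "norm (\<integral>z. norm (g z * (c k * z ^ k)) \<partial>circle_measure) \<le> B * cmod (c k)"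
        by (simp add: circle.prob_space)
    qed
  qed (rule int)
  also have "(\<integral>z. (\<Sum>k. g z * (c k * z ^ k)) \<partial>circle_measure) = (\<integral>z. g z * pser c z \<partial>circle_measure)"
    unfolding pser_def using summable_pser(2)[OF c]
    by (intro Bochner_Integration.integral_cong refl suminf_mult) auto
  also have "(\<lambda>k. \<integral>z. g z * (c k * z ^ k) \<partial>circle_measure) = (\<lambda>k. c k * (\<integral>z. g z * z ^ k \<partial>circle_measure))"
  proof
    fix k
    have "(\<integral>z. g z * (c k * z ^ k) \<partial>circle_measure) = (\<integral>z. c k * (g z * z ^ k) \<partial>circle_measure)"
      by (simp add: mult_ac)
    then show "(\<integral>z. g z * (c k * z ^ k) \<partial>circle_measure) = c k * (\<integral>z. g z * z ^ k \<partial>circle_measure)"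
      by simp
  qed
  finally show ?thesis .
qed

lemma pser_coeff:
  assumes "summable (\<lambda>k. cmod (c k))"
  shows "(\<integral>z. cnj z ^ j * pser c z \<partial>circle_measure) = c j"
proof -
  have "(\<lambda>k. c k * (\<integral>z. cnj z ^ j * z ^ k \<partial>circle_measure)) sums (\<integral>z. cnj z ^ j * pser c z \<partial>circle_measure)"
    by (intro sums_integral_pser assms continuous_intros)
  moreover have "(\<lambda>k. c k * (\<integral>z. cnj z ^ j * z ^ k \<partial>circle_measure)) = (\<lambda>k. if k = j then c k else 0)"
    unfolding orthonormal_circle' by (rule ext) simp
  ultimately have "(\<lambda>k. if k = j then c k else 0) sums (\<integral>z. cnj z ^ j * pser c z \<partial>circle_measure)"
    by simp
  from sums_unique2[OF this sums_single] show ?thesis .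
qed

lemma pser_neg_coeff:
  assumes "summable (\<lambda>k. cmod (c k))"
  shows "(\<integral>z. z ^ Suc j * pser c z \<partial>circle_measure) = 0"
proof -
  have "(\<lambda>k. c k * (\<integral>z. z ^ Suc j * z ^ k \<partial>circle_measure)) sums (\<integral>z. z ^ Suc j * pser c z \<partial>circle_measure)"
    by (intro sums_integral_pser assms continuous_intros)
  moreover have "(\<integral>z. z ^ Suc j * z ^ k \<partial>circle_measure) = 0" for k
    using integral_circle_power[of "j + k"] by (simp only: power_add[symmetric] add_Suc)
  ultimately have "(\<lambda>k. 0) sums (\<integral>z. z ^ Suc j * pser c z \<partial>circle_measure)"
    by simp
  from sums_unique2[OF this sums_zero] show ?thesis .
qed

lemma pser_parseval:
  assumes c: "summable (\<lambda>k. cmod (c k))"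
  shows "(\<lambda>k. (cmod (c k))\<^sup>2) sums (\<integral>z. (cmod (pser c z))\<^sup>2 \<partial>circle_measure)"
proof -
  have cont: "continuous_on (sphere 0 1) (pser c)" by (rule continuous_on_pser_circle[OF c])
  have "(\<lambda>k. c k * (\<integral>z. cnj (pser c z) * z ^ k \<partial>circle_measure)) sums
      (\<integral>z. cnj (pser c z) * pser c z \<partial>circle_measure)"
    by (intro sums_integral_pser c continuous_intros cont)
  moreover have "(\<integral>z. cnj (pser c z) * z ^ k \<partial>circle_measure) = cnj (c k)" for k
  proof -
    have "(\<integral>z. cnj (pser c z) * z ^ k \<partial>circle_measure) = (\<integral>z. cnj (cnj z ^ k * pser c z) \<partial>circle_measure)"
      by (simp add: mult.commute)
    also have "\<dots> = cnj (c k)" unfolding Bochner_Integration.integral_cnj pser_coeff[OF c] ..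
    finally show ?thesis .
  qed
  moreover have "(\<integral>z. cnj (pser c z) * pser c z \<partial>circle_measure) =
      of_real (\<integral>z. (cmod (pser c z))\<^sup>2 \<partial>circle_measure)"
    unfolding integral_complex_of_real[symmetric] complex_norm_square by (simp add: mult.commute)
  ultimately have "(\<lambda>k. complex_of_real ((cmod (c k))\<^sup>2)) sums of_real (\<integral>z. (cmod (pser c z))\<^sup>2 \<partial>circle_measure)"
    by (simp only: complex_norm_square)
  then show ?thesis by (simp only: sums_of_real_iff)
qed

subsection \<open>Measures on the circle are determined by their moments\<close>

text \<open>On the circle every such monomial is a power of z or of \<open>cnj z\<close>, and a
  moment of the latter kind is the conjugate of one of the former because measures are
  positive.\<close>

lemma integral_trig_monomial_eq:
  fixes M N :: "complex measure"
  assumes M: "sets M = sets circle_borel" and N: "sets N = sets circle_borel"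
    and mom: "\<And>k. (\<integral>z. z ^ k \<partial>M) = (\<integral>z. z ^ k \<partial>N)"
  shows "(\<integral>z. z ^ i * cnj z ^ j \<partial>M) = (\<integral>z. z ^ i * cnj z ^ j \<partial>N)"
proof -
  have "(\<integral>z. z ^ i * cnj z ^ j \<partial>K) = (if j \<le> i then \<integral>z. z ^ (i - j) \<partial>K else cnj (\<integral>z. z ^ (j - i) \<partial>K))"
    if "sets K = sets circle_borel" for K :: "complex measure"
  proof -
    have sp: "space K = sphere 0 1" using sets_eq_imp_space_eq[OF that] by simp
    have "(\<integral>z. z ^ i * cnj z ^ j \<partial>K) = (\<integral>z. (if j \<le> i then z ^ (i - j) else cnj (z ^ (j - i))) \<partial>K)"
      by (intro Bochner_Integration.integral_cong refl, subst power_cnj_power) (auto simp: sp)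
    also have "\<dots> = (if j \<le> i then \<integral>z. z ^ (i - j) \<partial>K else cnj (\<integral>z. z ^ (j - i) \<partial>K))"
      unfolding Bochner_Integration.integral_cnj[symmetric] by (cases "j \<le> i") auto
    finally show ?thesis .
  qed
  from this[OF M] this[OF N] show ?thesis using mom by simp
qed

text \<open>Stone-Weierstrass supplies polynomials in Re z and Im z. On the circle they are Laurent
  polynomials, encoded as a polynomial times \<open>cnj z ^ n\<close>, that is, divided by z^n; sums
  need a common denominator.\<close>

lemma real_polynomial_trig:
  fixes f :: "complex \<Rightarrow> real"
  assumes "real_polynomial_function f"
  shows "\<exists>p n. \<forall>z. cmod z = 1 \<longrightarrow> of_real (f z) = poly p z * cnj z ^ n"
  using assms
proof (induction rule: real_polynomial_function.induct)
  case (linear f)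
  \<comment> \<open>With Re z = (z + cnj z) / 2 and Im z = (z - cnj z) / (2 i), this is z times the
    linear form; z cnj z = 1 puts its two parts in degrees 2 and 0.\<close>
  define p where "p = [:(of_real (f 1) + \<i> * of_real (f \<i>)) / 2, 0, (of_real (f 1) - \<i> * of_real (f \<i>)) / 2:]"
  have "of_real (f z) = poly p z * cnj z ^ 1" if "cmod z = 1" for z
  proof -
    have "f z = f (Re z *\<^sub>R 1 + Im z *\<^sub>R \<i>)"
      by (rule arg_cong[of _ _ f]) (simp add: complex_eq_iff)
    also have "\<dots> = Re z * f 1 + Im z * f \<i>"
      using linear_add[OF bounded_linear.linear[OF linear]]
        linear_cmul[OF bounded_linear.linear[OF linear]] by simp
    finally have fz: "of_real (f z) = of_real (Re z) * of_real (f 1) + of_real (Im z) * complex_of_real (f \<i>)"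
      by simp
    have "poly p z * cnj z = (of_real (f 1) + \<i> * of_real (f \<i>)) / 2 * cnj z +
        (of_real (f 1) - \<i> * of_real (f \<i>)) / 2 * z * (z * cnj z)"
      unfolding p_def by (simp add: algebra_simps)
    also have "\<dots> = (z + cnj z) / 2 * of_real (f 1) - \<i> * ((z - cnj z) / 2) * of_real (f \<i>)"
      unfolding cnj_eq_inverse_circle[OF that] by (simp add: field_simps)
    also have "\<dots> = of_real (f z)"
      unfolding fz complex_add_cnj complex_diff_cnj by (simp add: mult_ac)
    finally show ?thesis by simp
  qed
  then show ?case by blast
next
  case (const c)
  show ?case by (rule exI[of _ "[:of_real c:]"], rule exI[of _ 0]) simp
next
  case (add f g)
  then obtain p n q m where *: "\<And>z. cmod z = 1 \<Longrightarrow> of_real (f z) = poly p z * cnj z ^ n"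
    "\<And>z. cmod z = 1 \<Longrightarrow> of_real (g z) = poly q z * cnj z ^ m" by blast
  have "of_real (f z + g z) = poly (p * monom 1 m + q * monom 1 n) z * cnj z ^ (n + m)" if "cmod z = 1" for z
  proof -
    have one: "z ^ k * cnj z ^ k = 1" for k
      using cnj_eq_inverse_circle[OF that] by (simp add: power_mult_distrib[symmetric])
    have "poly (p * monom 1 m + q * monom 1 n) z * cnj z ^ (n + m) =
        poly p z * cnj z ^ n * (z ^ m * cnj z ^ m) + poly q z * cnj z ^ m * (z ^ n * cnj z ^ n)"
      by (simp add: poly_monom power_add algebra_simps)
    then show ?thesis using *[OF that] unfolding one by simp
  qed
  then show ?case by blast
next
  case (mult f g)
  then obtain p n q m where *: "\<And>z. cmod z = 1 \<Longrightarrow> of_real (f z) = poly p z * cnj z ^ n"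
    "\<And>z. cmod z = 1 \<Longrightarrow> of_real (g z) = poly q z * cnj z ^ m" by blast
  have "of_real (f z * g z) = poly (p * q) z * cnj z ^ (n + m)" if "cmod z = 1" for z
    using *[OF that] by (simp add: power_add mult_ac)
  then show ?case by blast
qed

lemma integral_continuous_eq_of_moments:
  fixes M N :: "complex measure" and f :: "complex \<Rightarrow> real"
  assumes "finite_measure M" and sM: "sets M = sets circle_borel"
    and "finite_measure N" and sN: "sets N = sets circle_borel"
    and mom: "\<And>k. (\<integral>z. z ^ k \<partial>M) = (\<integral>z. z ^ k \<partial>N)"
    and f: "continuous_on (sphere 0 1) f"
  shows "(\<integral>z. f z \<partial>M) = (\<integral>z. f z \<partial>N)"
proof -
  interpret M: finite_measure M by fact
  interpret N: finite_measure N by fact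
  have spM: "space M = sphere 0 1" using sets_eq_imp_space_eq[OF sM] by simp
  have spN: "space N = sphere 0 1" using sets_eq_imp_space_eq[OF sN] by simp
  note iM = integrable_continuous_circle[OF M.finite_measure_axioms sM]
  note iN = integrable_continuous_circle[OF N.finite_measure_axioms sN]
  have poly: "(\<integral>z. g z \<partial>M) = (\<integral>z. g z \<partial>N)" if g: "real_polynomial_function g" for g
  proof -
    obtain p n where p: "\<And>z. cmod z = 1 \<Longrightarrow> of_real (g z) = poly p z * cnj z ^ n"
      using real_polynomial_trig[OF g] by blast
    have eq: "complex_of_real (\<integral>z. g z \<partial>K) = (\<Sum>i\<le>degree p. coeff p i * (\<integral>z. z ^ i * cnj z ^ n \<partial>K))"
      if K: "finite_measure K" "sets K = sets circle_borel" for K :: "complex measure"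
    proof -
      have sp: "space K = sphere 0 1" using sets_eq_imp_space_eq[OF K(2)] by simp
      have "complex_of_real (\<integral>z. g z \<partial>K) = (\<integral>z. (\<Sum>i\<le>degree p. coeff p i * (z ^ i * cnj z ^ n)) \<partial>K)"
        unfolding integral_complex_of_real[symmetric]
        by (intro Bochner_Integration.integral_cong refl, subst p)
           (auto simp: sp poly_altdef sum_distrib_right mult.assoc)
      also have "\<dots> = (\<Sum>i\<le>degree p. (\<integral>z. coeff p i * (z ^ i * cnj z ^ n) \<partial>K))"
        by (intro Bochner_Integration.integral_sum integrable_continuous_circle[OF K] continuous_intros)
      finally show ?thesis by simp
    qed
    have "complex_of_real (\<integral>z. g z \<partial>M) = complex_of_real (\<integral>z. g z \<partial>N)"
      unfolding eq[OF M.finite_measure_axioms sM] eq[OF N.finite_measure_axioms sN]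
      using integral_trig_monomial_eq[OF sM sN mom] by simp
    then show ?thesis by simp
  qed
  have "\<bar>(\<integral>z. f z \<partial>M) - (\<integral>z. f z \<partial>N)\<bar> \<le> e * (measure M (space M) + measure N (space N))" if "e > 0" for e
  proof -
    obtain g where g: "real_polynomial_function g" "\<And>z. z \<in> sphere 0 1 \<Longrightarrow> \<bar>f z - g z\<bar> < e"
      using Stone_Weierstrass_real_polynomial_function[OF compact_sphere f \<open>e > 0\<close>] by metis
    have cg: "continuous_on (sphere 0 1) g"
      using continuous_real_polymonial_function[OF g(1)] by (simp add: continuous_at_imp_continuous_on)
    have K: "\<bar>(\<integral>z. f z \<partial>K) - (\<integral>z. g z \<partial>K)\<bar> \<le> e * measure K (space K)"
      if K: "finite_measure K" "sets K = sets circle_borel" for K :: "complex measure"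
    proof -
      interpret K: finite_measure K by fact
      have sp: "space K = sphere 0 1" using sets_eq_imp_space_eq[OF K(2)] by simp
      note iK = integrable_continuous_circle[OF K]
      have "(\<integral>z. f z \<partial>K) - (\<integral>z. g z \<partial>K) = (\<integral>z. f z - g z \<partial>K)"
        by (intro Bochner_Integration.integral_diff[symmetric] iK f cg)
      also have "\<bar>\<dots>\<bar> \<le> (\<integral>z. \<bar>f z - g z\<bar> \<partial>K)" by (rule integral_abs_bound)
      also have "\<dots> \<le> (\<integral>z. e \<partial>K)"
        using g(2) by (intro integral_mono iK continuous_intros f cg) (auto simp: sp less_imp_le)
      finally show ?thesis by (simp add: mult.commute)
    qed
    show ?thesis
      using K[OF M.finite_measure_axioms sM] K[OF N.finite_measure_axioms sN] poly[OF g(1)]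
      by (simp add: distrib_left)
  qed
  note bound = this
  show ?thesis
  proof (rule ccontr)
    assume ne: "(\<integral>z. f z \<partial>M) \<noteq> (\<integral>z. f z \<partial>N)"
    define d where "d = \<bar>(\<integral>z. f z \<partial>M) - (\<integral>z. f z \<partial>N)\<bar>"
    define m where "m = measure M (space M) + measure N (space N)"
    have "d > 0" using ne unfolding d_def by simp
    have "m \<ge> 0" unfolding m_def by simp
    then have dm: "0 \<le> d * m" using \<open>d > 0\<close> by simp
    \<comment> \<open>The + 1 avoids division by 0 when both masses vanish; the factor m / (2 (m +
      1)) is below 1.\<close>
    have "d \<le> d / (2 * (m + 1)) * m"
      using bound[of "d / (2 * (m + 1))"] \<open>d > 0\<close> \<open>m \<ge> 0\<close> unfolding d_def m_def by simp
    also have "\<dots> < d" using \<open>d > 0\<close> \<open>m \<ge> 0\<close> using dm by (simp add: field_simps add_nonneg_pos)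
    finally show False by simp
  qed
qed

lemma emeasure_open_eq_of_moments:
  fixes M N :: "complex measure"
  assumes "finite_measure M" and sM: "sets M = sets circle_borel"
    and "finite_measure N" and sN: "sets N = sets circle_borel"
    and mom: "\<And>k. (\<integral>z. z ^ k \<partial>M) = (\<integral>z. z ^ k \<partial>N)"
    and U: "open U"
  shows "emeasure M (U \<inter> sphere 0 1) = emeasure N (U \<inter> sphere 0 1)"
proof -
  interpret M: finite_measure M by fact
  interpret N: finite_measure N by fact
  \<comment> \<open>Continuous functions increasing to the indicator of U. The whole plane is
    treated apart because \<open>infdist\<close> to the empty set is 0.\<close>
  define f where "f n z = (if U = UNIV then 1 else min 1 (real n * infdist z (- U)))" for n and z :: complex
  have cf: "continuous_on (sphere 0 1) (f n)" for n
    unfolding f_def by (cases "U = UNIV") (auto intro!: continuous_intros)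
  have f_nonneg: "0 \<le> f n z" "f n z \<le> 1" for n z
    unfolding f_def by (auto simp: infdist_nonneg)
  have lim: "(\<lambda>n. f n z) \<longlonglongrightarrow> indicator U z" for z
  proof (cases "U = UNIV \<or> z \<notin> U")
    case True
    moreover have "infdist z (- U) = 0" if "z \<notin> U" using that by (simp add: infdist_zero)
    ultimately show ?thesis unfolding f_def by (cases "U = UNIV") auto
  next
    case False
    then have "infdist z (- U) > 0"
      using U by (intro infdist_pos_not_in_closed) auto
    then obtain n0 where "1 < real n0 * infdist z (- U)" using reals_Archimedean3 by blast
    have "f n z = 1" if "n \<ge> n0" for n
    proof -
      have "real n0 * infdist z (- U) \<le> real n * infdist z (- U)"
        using that by (intro mult_right_mono infdist_nonneg) simp
      then have "1 \<le> real n * infdist z (- U)"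
        using \<open>1 < real n0 * infdist z (- U)\<close> by linarith
      then show ?thesis using False unfolding f_def by simp
    qed
    then have "(\<lambda>n. f n z) \<longlonglongrightarrow> 1"
      by (intro tendsto_eventually) (auto simp: eventually_sequentially)
    then show ?thesis using False by simp
  qed
  have conv: "(\<lambda>n. \<integral>z. f n z \<partial>K) \<longlonglongrightarrow> measure K (U \<inter> sphere 0 1)"
    if K: "finite_measure K" "sets K = sets circle_borel" for K :: "complex measure"
  proof -
    interpret K: finite_measure K by fact
    have sp: "space K = sphere 0 1" using sets_eq_imp_space_eq[OF K(2)] by simp
    have inK: "U \<inter> sphere 0 1 \<in> sets K"
      unfolding K(2) sets_restrict_space using U by auto
    have "(\<lambda>n. \<integral>z. f n z \<partial>K) \<longlonglongrightarrow> (\<integral>z. indicator (U \<inter> sphere 0 1) z \<partial>K)"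
    proof (rule integral_dominated_convergence[where w = "\<lambda>_. 1"])
      show "f n \<in> borel_measurable K" for n
        using integrable_continuous_circle[OF K cf] by blast
      show "AE z in K. (\<lambda>n. f n z) \<longlonglongrightarrow> indicator (U \<inter> sphere 0 1) z"
        using lim by (intro AE_I2) (auto simp: sp indicator_def)
    qed (use inK f_nonneg in auto)
    then show ?thesis using inK K.emeasure_finite by (simp add: sp Int_absorb2)
  qed
  have "(\<lambda>n. \<integral>z. f n z \<partial>M) = (\<lambda>n. \<integral>z. f n z \<partial>N)"
    using integral_continuous_eq_of_moments[OF assms(1-5) cf] by blast
  then have "measure M (U \<inter> sphere 0 1) = measure N (U \<inter> sphere 0 1)"
    using conv[OF M.finite_measure_axioms sM] conv[OF N.finite_measure_axioms sN] LIMSEQ_unique by metis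
  then show ?thesis by (simp add: M.emeasure_eq_measure N.emeasure_eq_measure)
qed

text \<open>Traces of open sets on the circle form an intersection-stable generator that contains
  the circle itself.\<close>

theorem measure_eq_of_moments:
  fixes M N :: "complex measure"
  assumes "finite_measure M" and sM: "sets M = sets circle_borel"
    and "finite_measure N" and sN: "sets N = sets circle_borel"
    and mom: "\<And>k. (\<integral>z. z ^ k \<partial>M) = (\<integral>z. z ^ k \<partial>N)"
  shows "M = N"
proof -
  interpret M: finite_measure M by fact
  interpret N: finite_measure N by fact
  define E where "E = {U \<inter> sphere 0 1 | U :: complex set. open U}"
  have gen: "sets circle_borel = sigma_sets (sphere 0 1) E"
  proof -
    have "sets circle_borel = (\<inter>) (sphere 0 1) ` sigma_sets UNIV {U :: complex set. open U}"
      by (simp add: sets_restrict_space borel_def)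
    also have "\<dots> = sigma_sets (sphere 0 1) ((\<inter>) (sphere 0 1) ` {U. open U})"
      using borel_closed[OF closed_sphere, of "0 :: complex" 1]
      by (intro sigma_sets_Int) (auto simp: borel_def)
    also have "(\<inter>) (sphere 0 1) ` {U. open U} = E"
      unfolding E_def by auto
    finally show ?thesis .
  qed
  show ?thesis
  proof (rule measure_eqI_generator_eq[where \<Omega> = "sphere 0 1" and E = E and A = "\<lambda>_. sphere 0 1"])
    show "Int_stable E"
      unfolding E_def Int_stable_def
    proof (clarsimp)
      fix U V :: "complex set" assume "open U" "open V"
      then show "\<exists>W. U \<inter> sphere 0 1 \<inter> (V \<inter> sphere 0 1) = W \<inter> sphere 0 1 \<and> open W"
        by (intro exI[of _ "U \<inter> V"]) auto
    qed
    show "emeasure M X = emeasure N X" if "X \<in> E" for X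
      using that emeasure_open_eq_of_moments[OF assms] unfolding E_def by auto
    show "range (\<lambda>_. sphere 0 1) \<subseteq> E" unfolding E_def by (auto intro!: exI[of _ UNIV])
  qed (use sM sN gen M.emeasure_finite in \<open>auto simp: E_def\<close>)
qed

lemma borel_measurable_circle:
  fixes f :: "complex \<Rightarrow> 'b::{banach, second_countable_topology}"
  assumes "continuous_on (sphere 0 1) f"
  shows "f \<in> borel_measurable circle_measure"
  by (rule borel_measurable_integrable[OF integrable_circle[OF assms]])

lemma borel_measurable_circle_power [measurable]:
  "(\<lambda>z::complex. z ^ k) \<in> borel_measurable circle_measure"
  by (intro borel_measurable_circle continuous_intros)

lemma finite_measure_density_circle:
  fixes f :: "complex \<Rightarrow> real"
  assumes f: "integrable circle_measure f" "\<And>z. z \<in> sphere 0 1 \<Longrightarrow> 0 \<le> f z"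
  shows "finite_measure (density circle_measure (\<lambda>z. ennreal (f z)))"
proof (rule finite_measureI)
  let ?D = "density circle_measure (\<lambda>z. ennreal (f z))"
  have [measurable]: "f \<in> borel_measurable circle_measure" using f(1) by (rule borel_measurable_integrable)
  have "emeasure ?D (space ?D) = (\<integral>\<^sup>+z. ennreal (f z) \<partial>circle_measure)"
    unfolding space_density using sets.top[of circle_measure]
    by (subst emeasure_density) (auto intro!: nn_integral_cong)
  also have "\<dots> = ennreal (\<integral>z. f z \<partial>circle_measure)"
    by (intro nn_integral_eq_integral f AE_I2) simp
  finally show "emeasure ?D (space ?D) \<noteq> \<infinity>" by simp
qed

text \<open>The positive and the negative part of G are densities of two finite measures with the
  same moments, so the measures and hence the densities agree.\<close>

lemma fourier_unique_zero:
  fixes G :: "complex \<Rightarrow> real"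
  assumes G: "integrable circle_measure G"
    and mom: "\<And>k. (\<integral>z. z ^ k * of_real (G z) \<partial>circle_measure) = 0"
  shows "AE z in circle_measure. G z = 0"
proof -
  have [measurable]: "G \<in> borel_measurable circle_measure" using G by blast
  define D where "D s = density circle_measure (\<lambda>z. ennreal (max 0 (s * G z)))" for s
  have int: "integrable circle_measure (\<lambda>z. max 0 (s * G z))" for s
    using G by (intro Bochner_Integration.integrable_max) auto
  have fin: "finite_measure (D s)" for s
    unfolding D_def by (rule finite_measure_density_circle[OF int]) simp
  have sD: "sets (D s) = sets circle_borel" for s unfolding D_def by simp
  have i1: "integrable circle_measure (\<lambda>z. of_real (max 0 (s * G z)) * z ^ k)" for s k
  proof (rule Bochner_Integration.integrable_bound[OF int[of s]])
    show "(\<lambda>z. of_real (max 0 (s * G z)) * z ^ k) \<in> borel_measurable circle_measure"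
      using borel_measurable_circle_power by measurable
  qed (auto intro!: AE_I2 simp: norm_mult norm_power)
  have momD: "(\<integral>z. z ^ k \<partial>D s) = (\<integral>z. of_real (max 0 (s * G z)) * z ^ k \<partial>circle_measure)" for s k
    unfolding D_def
  proof (subst integral_density)
    show "(\<lambda>z::complex. z ^ k) \<in> borel_measurable circle_measure"
      by (rule borel_measurable_circle_power)
  qed (auto simp: scaleR_conv_of_real)
  have "(\<integral>z. z ^ k \<partial>D 1) - (\<integral>z. z ^ k \<partial>D (-1)) = 0" for k
  proof -
    have "(\<integral>z. z ^ k \<partial>D 1) - (\<integral>z. z ^ k \<partial>D (-1)) =
        (\<integral>z. of_real (max 0 (1 * G z)) * z ^ k - of_real (max 0 ((-1) * G z)) * z ^ k \<partial>circle_measure)"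
      unfolding momD by (intro Bochner_Integration.integral_diff[symmetric] i1)
    also have "\<dots> = (\<integral>z. z ^ k * of_real (G z) \<partial>circle_measure)"
      by (intro Bochner_Integration.integral_cong refl) (auto simp: max_def mult.commute)
    finally show ?thesis using mom by simp
  qed
  then have "D 1 = D (-1)"
    by (intro measure_eq_of_moments fin sD) auto
  then have "AE z in circle_measure. ennreal (max 0 (1 * G z)) = ennreal (max 0 ((-1) * G z))"
    unfolding D_def by (intro circle.density_unique) auto
  then show ?thesis by eventually_elim (auto simp: max_def split: if_splits)
qed

subsection \<open>The Lebedev-Milin inequality\<close>

text \<open>Let T and s be the polynomials with coefficients B and b up to degree K. The recursion
  gives T' \<le> s' T for x > 0, since enlarging the triangle l + j \<le> K to a square only adds
  nonnegative terms. So T exp (- s) does not increase from 0 to 1, and at 1 the polynomials are the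
  two sums.\<close>

lemma gronwall_convolution:
  fixes B b :: "nat \<Rightarrow> real"
  assumes B0: "B 0 \<le> 1" and B: "\<And>k. B k \<ge> 0" and b: "\<And>k. b k \<ge> 0"
    and rec: "\<And>k. real k * B k \<le> (\<Sum>l\<le>k. real l * b l * B (k - l))"
  shows "(\<Sum>k\<le>K. B k) \<le> exp (\<Sum>l\<le>K. b l)"
proof -
  define T where "T x = (\<Sum>k\<le>K. B k * x ^ k)" for x
  define s where "s x = (\<Sum>l\<le>K. b l * x ^ l)" for x
  define T' where "T' x = (\<Sum>k\<le>K. B k * (real k * x ^ (k - 1)))" for x
  define s' where "s' x = (\<Sum>l\<le>K. b l * (real l * x ^ (l - 1)))" for x
  have DT: "(T has_real_derivative T' x) (at x)" for x
    unfolding T_def T'_def by (auto intro!: derivative_eq_intros simp: mult_ac)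
  have Ds: "(s has_real_derivative s' x) (at x)" for x
    unfolding s_def s'_def by (auto intro!: derivative_eq_intros simp: mult_ac)
  have le: "T' x \<le> s' x * T x" if x: "0 < x" for x
  proof -
    have pow: "x * (c * (real k * x ^ (k - 1))) = real k * c * x ^ k" for c k
      by (cases k) auto
    have "x * T' x = (\<Sum>k\<le>K. real k * B k * x ^ k)"
      unfolding T'_def sum_distrib_left pow ..
    also have "\<dots> \<le> (\<Sum>k\<le>K. (\<Sum>l\<le>k. real l * b l * B (k - l)) * x ^ k)"
      using rec x by (intro sum_mono mult_right_mono) auto
    also have "\<dots> = (\<Sum>k\<le>K. \<Sum>l\<le>k. (real l * b l * x ^ l) * (B (k - l) * x ^ (k - l)))"
      unfolding sum_distrib_right
      by (intro sum.cong refl) (auto simp: power_add[symmetric] mult_ac)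
    also have "\<dots> = (\<Sum>(l,j)\<in>{(l,j). l + j \<le> K}. (real l * b l * x ^ l) * (B j * x ^ j))"
      by (rule sum.triangle_reindex_eq[symmetric])
    also have "\<dots> \<le> (\<Sum>(l,j)\<in>{..K} \<times> {..K}. (real l * b l * x ^ l) * (B j * x ^ j))"
      using B b x by (intro sum_mono2) auto
    also have "\<dots> = (\<Sum>l\<le>K. real l * b l * x ^ l) * T x"
      unfolding T_def sum_product sum.cartesian_product ..
    also have "(\<Sum>l\<le>K. real l * b l * x ^ l) = x * s' x"
      unfolding s'_def sum_distrib_left pow ..
    finally have "x * T' x \<le> x * (s' x * T x)" by (simp add: mult.assoc)
    then show ?thesis using x by simp
  qed
  define G where "G x = T x * exp (- s x)" for x
  have DG: "(G has_real_derivative (T' x - s' x * T x) * exp (- s x)) (at x)" for x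
    unfolding G_def by (auto intro!: derivative_eq_intros DT Ds simp: algebra_simps)
  have "G 1 \<le> G 0"
  proof (rule DERIV_nonpos_imp_decreasing_open[of 0 1 G])
    show "\<exists>y. (G has_real_derivative y) (at x) \<and> y \<le> 0" if "0 < x" "x < 1" for x
      using DG[of x] le[OF that(1)] by (intro exI conjI) (auto simp: mult_le_0_iff)
    show "continuous_on {0..1} G"
      using DG by (intro DERIV_continuous_on) (auto intro: has_field_derivative_at_within)
  qed simp
  also have "G 0 \<le> 1"
  proof -
    have "T 0 = B 0" "s 0 = b 0"
      unfolding T_def s_def by (simp_all add: power_0_left if_distrib sum.delta cong: if_cong)
    moreover have "B 0 * exp (- b 0) \<le> 1 * 1"
      using B0 b[of 0] B[of 0] by (intro mult_mono) auto
    ultimately show ?thesis unfolding G_def by simp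
  qed
  finally show ?thesis
    unfolding G_def T_def s_def by (simp add: exp_minus field_simps)
qed

text \<open>As the term at 0 vanishes, Cauchy-Schwarz costs a factor k instead of k + 1; this k
  cancels against one of the two in k^2 |c_k|^2 below.\<close>

lemma sum_squared_norm_le:
  assumes "u 0 = (0::complex)"
  shows "(cmod (\<Sum>l\<le>k. u l))\<^sup>2 \<le> real k * (\<Sum>l\<le>k. (cmod (u l))\<^sup>2)"
proof -
  have drop: "(\<Sum>l\<le>k. f l) = (\<Sum>l\<in>{1..k}. f l)" if "f 0 = 0" for f :: "nat \<Rightarrow> real"
    using that by (intro sum.mono_neutral_right) (auto simp: not_le)
  have "(cmod (\<Sum>l\<le>k. u l))\<^sup>2 \<le> (\<Sum>l\<le>k. cmod (u l))\<^sup>2"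
    by (intro power_mono norm_sum) auto
  also have "\<dots> = (\<Sum>l\<in>{1..k}. cmod (u l))\<^sup>2"
    using assms by (subst drop) auto
  also have "\<dots> \<le> (\<Sum>l\<in>{1..k}. (cmod (u l))\<^sup>2) * card {1..k}"
    by (rule sum_squared_le_sum_of_squares)
  also have "\<dots> = real k * (\<Sum>l\<le>k. (cmod (u l))\<^sup>2)"
    using assms by (subst drop) auto
  finally show ?thesis .
qed

text \<open>The recursion is f' = p' f for f = exp p, read off on coefficients. Cauchy-Schwarz turns
  it into the convolution inequality for |c_k|^2 with b_l = l |a_l|^2.\<close>

lemma lebedev_milin_coefficients:
  fixes a c :: "nat \<Rightarrow> complex"
  assumes c0: "c 0 = 1" and rec: "\<And>k. of_nat k * c k = (\<Sum>l\<le>k. of_nat l * a l * c (k - l))"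
  shows "(\<Sum>k\<le>K. (cmod (c k))\<^sup>2) \<le> exp (\<Sum>l\<le>K. real l * (cmod (a l))\<^sup>2)"
proof (rule gronwall_convolution)
  fix k :: nat
  have "(real k)\<^sup>2 * (cmod (c k))\<^sup>2 = (cmod (\<Sum>l\<le>k. of_nat l * a l * c (k - l)))\<^sup>2"
    unfolding rec[symmetric] by (simp add: norm_mult power_mult_distrib)
  also have "\<dots> \<le> real k * (\<Sum>l\<le>k. (cmod (of_nat l * a l * c (k - l)))\<^sup>2)"
    by (rule sum_squared_norm_le) simp
  also have "(\<Sum>l\<le>k. (cmod (of_nat l * a l * c (k - l)))\<^sup>2) =
      (\<Sum>l\<le>k. real l * (real l * (cmod (a l))\<^sup>2) * (cmod (c (k - l)))\<^sup>2)"
    by (simp add: norm_mult power_mult_distrib power2_eq_square mult_ac)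
  finally have "real k * (real k * (cmod (c k))\<^sup>2) \<le>
      real k * (\<Sum>l\<le>k. real l * (real l * (cmod (a l))\<^sup>2) * (cmod (c (k - l)))\<^sup>2)"
    by (simp add: power2_eq_square mult.assoc)
  then show "real k * (cmod (c k))\<^sup>2 \<le>
      (\<Sum>l\<le>k. real l * (real l * (cmod (a l))\<^sup>2) * (cmod (c (k - l)))\<^sup>2)"
    by (cases "k = 0") auto
qed (use c0 in auto)

lemma has_fps_expansion_poly: "poly p has_fps_expansion fps_of_poly (p :: complex poly)"
proof (induction p)
  case 0
  then show ?case using has_fps_expansion_const[of "0::complex"] by (simp add: fun_eq_iff)
next
  case (pCons a p)
  have "(\<lambda>z. a + z * poly p z) has_fps_expansion (fps_const a + fps_X * fps_of_poly p)"
    by (intro has_fps_expansion_add has_fps_expansion_const has_fps_expansion_mult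
        has_fps_expansion_fps_X pCons)
  moreover have "poly (pCons a p) = (\<lambda>z. a + z * poly p z)" by (rule ext) simp
  ultimately show ?case by (simp add: fps_of_poly_pCons mult.commute)
qed

text \<open>Convergence at one point beyond the unit circle gives absolute convergence on the closed
  disc.\<close>

lemma power_series_abs_summable:
  assumes f: "f holomorphic_on ball 0 R" and R: "R > 1"
  defines "c \<equiv> \<lambda>n. (deriv ^^ n) f 0 / fact n"
  shows "summable (\<lambda>k. cmod (c k))" and "cmod z \<le> 1 \<Longrightarrow> f z = pser c z"
proof -
  have s: "(\<lambda>n. c n * w ^ n) sums f w" if "w \<in> ball 0 R" for w
    using holomorphic_power_series[OF f that] unfolding c_def by simp
  define w where "w = complex_of_real ((1 + R) / 2)"
  have w: "w \<in> ball 0 R" "cmod w > 1" using R unfolding w_def by (auto simp del: of_real_add)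
  have "summable (\<lambda>n. c n * w ^ n)" using s[OF w(1)] by (rule sums_summable)
  from powser_insidea[OF this, of 1] show "summable (\<lambda>k. cmod (c k))" using w(2) by simp
  show "f z = pser c z" if "cmod z \<le> 1"
    unfolding pser_def using s[of z] that R by (auto intro!: sums_unique)
qed

text \<open>The recursion compares coefficients in f' = p' f, as an identity of formal power
  series.\<close>

lemma exp_poly_coefficients:
  fixes p :: "complex poly"
  assumes p0: "coeff p 0 = 0"
  obtains c where "summable (\<lambda>k. cmod (c k))" "\<And>z. cmod z \<le> 1 \<Longrightarrow> exp (poly p z) = pser c z"
    "c 0 = 1" "\<And>k. of_nat k * c k = (\<Sum>l\<le>k. of_nat l * coeff p l * c (k - l))"
proof -
  define f where "f z = exp (poly p z)" for z
  define c where "c n = (deriv ^^ n) f 0 / fact n" for n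
  have hol: "f holomorphic_on A" for A
    unfolding f_def by (intro holomorphic_intros)
  have c: "fps_expansion f 0 = Abs_fps c"
    unfolding fps_expansion_def c_def by simp
  have F: "f has_fps_expansion Abs_fps c"
    unfolding c[symmetric] using hol[of UNIV] by (intro analytic_at_imp_has_fps_expansion_0) (auto simp: analytic_at)
  have "deriv f z = f z * poly (pderiv p) z" for z
    unfolding f_def by (rule DERIV_imp_deriv) (auto intro!: derivative_eq_intros poly_DERIV)
  then have d: "deriv f = (\<lambda>z. f z * poly (pderiv p) z)" by (rule ext)
  have "fps_deriv (Abs_fps c) = Abs_fps c * fps_of_poly (pderiv p)"
    using has_fps_expansion_deriv[OF F] has_fps_expansion_mult[OF F has_fps_expansion_poly[of "pderiv p"]]
    unfolding d by (rule fps_expansion_unique_complex)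
  then have rec: "fps_nth (fps_deriv (Abs_fps c)) k = fps_nth (Abs_fps c * fps_of_poly (pderiv p)) k" for k
    by simp
  show ?thesis
  proof
    show "exp (poly p z) = pser c z" if "cmod z \<le> 1" for z
      using power_series_abs_summable[OF hol, of 2] that unfolding c_def f_def by auto
    show "summable (\<lambda>k. cmod (c k))"
      using power_series_abs_summable(1)[OF hol, of 2] unfolding c_def f_def by auto
    show "c 0 = 1" unfolding c_def f_def using p0 by (simp add: poly_0_coeff_0)
    show "of_nat k * c k = (\<Sum>l\<le>k. of_nat l * coeff p l * c (k - l))" for k
    proof (cases k)
      case (Suc m)
      have "of_nat (Suc m) * c (Suc m) = (\<Sum>i=0..m. c i * (of_nat (Suc (m - i)) * coeff p (Suc (m - i))))"
        using rec[of m] by (simp add: fps_mult_nth coeff_pderiv)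
      also have "\<dots> = (\<Sum>l\<in>{1..Suc m}. of_nat l * coeff p l * c (Suc m - l))"
        by (rule sum.reindex_bij_witness[of _ "\<lambda>l. Suc m - l" "\<lambda>i. Suc m - i"])
           (auto simp: Suc_diff_le mult_ac)
      also have "\<dots> = (\<Sum>l\<le>Suc m. of_nat l * coeff p l * c (Suc m - l))"
        by (rule sum.mono_neutral_left) (auto simp: not_le)
      finally show ?thesis unfolding Suc .
    qed simp
  qed
qed

lemma lebedev_milin_poly:
  fixes p :: "complex poly"
  assumes p0: "coeff p 0 = 0" and S: "\<And>K. (\<Sum>l\<le>K. real l * (cmod (coeff p l))\<^sup>2) \<le> S"
  shows "(\<integral>z. (cmod (exp (poly p z)))\<^sup>2 \<partial>circle_measure) \<le> exp S"
proof -
  obtain c where c: "summable (\<lambda>k. cmod (c k))" "\<And>z. cmod z \<le> 1 \<Longrightarrow> exp (poly p z) = pser c z"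
    "c 0 = 1" "\<And>k. of_nat k * c k = (\<Sum>l\<le>k. of_nat l * coeff p l * c (k - l))"
    by (rule exp_poly_coefficients[OF p0]) (rule that)
  have "(\<integral>z. (cmod (exp (poly p z)))\<^sup>2 \<partial>circle_measure) = (\<integral>z. (cmod (pser c z))\<^sup>2 \<partial>circle_measure)"
    using c(2) by (intro Bochner_Integration.integral_cong) auto
  also have "\<dots> \<le> exp S"
  proof (rule LIMSEQ_le_const2)
    show "(\<lambda>K. \<Sum>k\<le>K. (cmod (c k))\<^sup>2) \<longlonglongrightarrow> (\<integral>z. (cmod (pser c z))\<^sup>2 \<partial>circle_measure)"
      using pser_parseval[OF c(1)] by (simp add: sums_def_le)
    have "(\<Sum>k\<le>K. (cmod (c k))\<^sup>2) \<le> exp S" for K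
      using lebedev_milin_coefficients[of c "coeff p" K, OF c(3,4)] S[of K]
      by (meson exp_le_cancel_iff order_trans)
    then show "\<exists>N. \<forall>n\<ge>N. (\<Sum>k\<le>n. (cmod (c k))\<^sup>2) \<le> exp S" by blast
  qed
  finally show ?thesis .
qed

definition trunc_poly :: "(nat \<Rightarrow> complex) \<Rightarrow> nat \<Rightarrow> complex poly" where
  "trunc_poly a N = (\<Sum>k<N. monom (a k) k)"

lemma coeff_trunc_poly [simp]: "coeff (trunc_poly a N) k = (if k < N then a k else 0)"
  unfolding trunc_poly_def by (simp add: coeff_sum)

lemma poly_trunc_poly: "poly (trunc_poly a N) z = (\<Sum>k<N. a k * z ^ k)"
  unfolding trunc_poly_def by (simp add: poly_sum poly_monom)

lemma lebedev_milin:
  assumes a: "summable (\<lambda>k. cmod (a k))" and a0: "a 0 = 0"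
    and S: "\<And>K. (\<Sum>l\<le>K. real l * (cmod (a l))\<^sup>2) \<le> S"
  shows "(\<integral>z. (cmod (exp (pser a z)))\<^sup>2 \<partial>circle_measure) \<le> exp S"
proof (rule LIMSEQ_le_const2)
  \<comment> \<open>This sum of moduli bounds every truncation on the circle, so a constant
    dominates all the exponentials.\<close>
  define A where "A = (\<Sum>k. cmod (a k))"
  show "(\<lambda>N. \<integral>z. (cmod (exp (poly (trunc_poly a N) z)))\<^sup>2 \<partial>circle_measure)
      \<longlonglongrightarrow> (\<integral>z. (cmod (exp (pser a z)))\<^sup>2 \<partial>circle_measure)"
  proof (rule integral_dominated_convergence[where w = "\<lambda>_. (exp A)\<^sup>2"])
    show "(\<lambda>z. (cmod (exp (pser a z)))\<^sup>2) \<in> borel_measurable circle_measure"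
      by (intro borel_measurable_circle continuous_intros continuous_on_pser_circle a)
    show "(\<lambda>z. (cmod (exp (poly (trunc_poly a N) z)))\<^sup>2) \<in> borel_measurable circle_measure" for N
      by (intro borel_measurable_circle continuous_intros)
    show "AE z in circle_measure. (\<lambda>N. (cmod (exp (poly (trunc_poly a N) z)))\<^sup>2)
        \<longlonglongrightarrow> (cmod (exp (pser a z)))\<^sup>2"
    proof (rule AE_I2)
      fix z assume "z \<in> space circle_measure"
      then have "cmod z \<le> 1" by simp
      have "(\<lambda>N. \<Sum>k<N. a k * z ^ k) \<longlonglongrightarrow> pser a z"
        unfolding pser_def using summable_pser(2)[OF a \<open>cmod z \<le> 1\<close>] by (rule summable_LIMSEQ)
      then show "(\<lambda>N. (cmod (exp (poly (trunc_poly a N) z)))\<^sup>2) \<longlonglongrightarrow> (cmod (exp (pser a z)))\<^sup>2"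
        unfolding poly_trunc_poly by (intro tendsto_intros)
    qed
    show "AE z in circle_measure. norm ((cmod (exp (poly (trunc_poly a N) z)))\<^sup>2) \<le> (exp A)\<^sup>2" for N
    proof (rule AE_I2)
      fix z assume z: "z \<in> space circle_measure"
      have "Re (poly (trunc_poly a N) z) \<le> cmod (\<Sum>k<N. a k * z ^ k)"
        unfolding poly_trunc_poly by (rule complex_Re_le_cmod)
      also have "\<dots> \<le> (\<Sum>k<N. cmod (a k * z ^ k))" by (rule norm_sum)
      also have "\<dots> = (\<Sum>k<N. cmod (a k))" using z by (simp add: norm_mult norm_power)
      also have "\<dots> \<le> A" unfolding A_def by (rule sum_le_suminf[OF a]) auto
      finally have "exp (Re (poly (trunc_poly a N) z)) \<le> exp A" by simp
      then show "norm ((cmod (exp (poly (trunc_poly a N) z)))\<^sup>2) \<le> (exp A)\<^sup>2"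
        by (simp add: norm_exp_eq_Re power_mono)
    qed
  qed simp
  have "(\<integral>z. (cmod (exp (poly (trunc_poly a N) z)))\<^sup>2 \<partial>circle_measure) \<le> exp S" for N
  proof (rule lebedev_milin_poly)
    show "(\<Sum>l\<le>K. real l * (cmod (coeff (trunc_poly a N) l))\<^sup>2) \<le> S" for K
      by (rule order_trans[OF sum_mono S[of K]]) auto
  qed (use a0 in simp)
  then show "\<exists>N. \<forall>n\<ge>N. (\<integral>z. (cmod (exp (poly (trunc_poly a n) z)))\<^sup>2 \<partial>circle_measure) \<le> exp S"
    by blast
qed

subsection \<open>Orthogonal polynomials and Verblunsky coefficients\<close>

lemma cmod_add_squared: "(cmod (x + y))\<^sup>2 = (cmod x)\<^sup>2 + (cmod y)\<^sup>2 + 2 * Re (x * cnj y)"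
  unfolding cmod_power2 by (simp add: power2_eq_square algebra_simps)

text \<open>Positivity of all polynomial norms is the form in which nontriviality enters. The mass
  is left free, so that Bernstein-Szego weights belong here without normalization.\<close>

locale circle_weight = finite_measure M for M :: "complex measure" +
  assumes sets_M: "sets M = sets circle_borel"
    and norm_pos: "p \<noteq> 0 \<Longrightarrow> 0 < (\<integral>z. (cmod (poly p z))\<^sup>2 \<partial>M)"
begin

lemma space_M: "space M = sphere 0 1"
  using sets_eq_imp_space_eq[OF sets_M] by simp

lemmas integrable_cont = integrable_continuous_circle[OF finite_measure_axioms sets_M]

definition orth :: "complex poly \<Rightarrow> nat \<Rightarrow> bool" where
  "orth p n \<longleftrightarrow> (\<forall>j<n. (\<integral>z. cnj (z ^ j) * poly p z \<partial>M) = 0)"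

lemma integral_cnj_poly_mult:
  assumes "degree q \<le> n" and "continuous_on (sphere 0 1) f"
  shows "(\<integral>z. cnj (poly q z) * f z \<partial>M) = (\<Sum>j\<le>n. cnj (coeff q j) * (\<integral>z. cnj (z ^ j) * f z \<partial>M))"
proof -
  have q: "poly q z = (\<Sum>j\<le>n. coeff q j * z ^ j)" for z
    unfolding poly_altdef using assms(1)
    by (intro sum.mono_neutral_left) (auto simp: coeff_eq_0)
  have "(\<integral>z. cnj (poly q z) * f z \<partial>M) = (\<integral>z. (\<Sum>j\<le>n. cnj (coeff q j) * (cnj (z ^ j) * f z)) \<partial>M)"
    unfolding q by (simp add: sum_distrib_right mult.assoc)
  also have "\<dots> = (\<Sum>j\<le>n. (\<integral>z. cnj (coeff q j) * (cnj (z ^ j) * f z) \<partial>M))"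
    by (intro Bochner_Integration.integral_sum integrable_cont continuous_intros assms)
  finally show ?thesis by simp
qed

lemma integral_poly_moments:
  assumes "degree q \<le> n"
  shows "(\<integral>z. poly q z \<partial>M) = (\<Sum>j\<le>n. coeff q j * (\<integral>z. z ^ j \<partial>M))"
proof -
  have q: "poly q z = (\<Sum>j\<le>n. coeff q j * z ^ j)" for z
    unfolding poly_altdef using assms(1)
    by (intro sum.mono_neutral_left) (auto simp: coeff_eq_0)
  have "(\<integral>z. (\<Sum>j\<le>n. coeff q j * z ^ j) \<partial>M) = (\<Sum>j\<le>n. (\<integral>z. coeff q j * z ^ j \<partial>M))"
    by (intro Bochner_Integration.integral_sum integrable_cont continuous_intros assms)
  then show ?thesis unfolding q by simp
qed

text \<open>The zero polynomial is a case of its own: its degree is 0, which is not below n =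
  0.\<close>

lemma orth_poly:
  assumes "orth p n" "degree q < n \<or> q = 0"
  shows "(\<integral>z. cnj (poly q z) * poly p z \<partial>M) = 0"
proof (cases "q = 0")
  case False
  then have "degree q < n" using assms by auto
  then show ?thesis
    using assms(1) unfolding orth_def
    by (subst integral_cnj_poly_mult[of q "degree q"]) (auto intro!: continuous_intros sum.neutral)
qed simp

lemma norm_sq_eq: "of_real (\<integral>z. (cmod (poly p z))\<^sup>2 \<partial>M) = (\<integral>z. cnj (poly p z) * poly p z \<partial>M)"
  unfolding integral_complex_of_real[symmetric] complex_norm_square by (simp add: mult.commute)

text \<open>The difference has smaller degree, hence is orthogonal to itself.\<close>

lemma orth_unique:
  assumes p: "degree p = n \<and> lead_coeff p = 1" "orth p n"
    and q: "degree q = n \<and> lead_coeff q = 1" "orth q n"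
  shows "p = q"
proof (rule ccontr)
  assume "p \<noteq> q"
  then have ne: "p - q \<noteq> 0" by simp
  have "coeff (p - q) n = 0" using p(1) q(1) by auto
  moreover have "degree (p - q) \<le> n" using p(1) q(1) by (intro degree_diff_le) auto
  ultimately have "degree (p - q) < n"
    using ne by (metis leading_coeff_0_iff nat_less_le)
  then have *: "degree (p - q) < n \<or> p - q = 0" by simp
  have "(\<integral>z. cnj (poly (p - q) z) * poly (p - q) z \<partial>M) =
      (\<integral>z. cnj (poly (p - q) z) * poly p z - cnj (poly (p - q) z) * poly q z \<partial>M)"
    by (simp add: algebra_simps)
  also have "\<dots> = (\<integral>z. cnj (poly (p - q) z) * poly p z \<partial>M) - (\<integral>z. cnj (poly (p - q) z) * poly q z \<partial>M)"
    by (intro Bochner_Integration.integral_diff integrable_cont continuous_intros)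
  also have "\<dots> = 0" using orth_poly[OF p(2) *] orth_poly[OF q(2) *] by simp
  finally show False using norm_sq_eq[of "p - q"] norm_pos[OF ne] by simp
qed

lemma monic_opuc_eqI:
  assumes "degree p = n \<and> lead_coeff p = 1" "orth p n"
  shows "monic_opuc M n = p"
  unfolding monic_opuc_def
proof (rule the_equality)
  show "degree p = n \<and> lead_coeff p = 1 \<and> (\<forall>j<n. (\<integral>z. cnj (z ^ j) * poly p z \<partial>M) = 0)"
    using assms unfolding orth_def by blast
  show "q = p" if "degree q = n \<and> lead_coeff q = 1 \<and> (\<forall>j<n. (\<integral>z. cnj (z ^ j) * poly q z \<partial>M) = 0)" for q
    using that assms orth_unique[of q n p] unfolding orth_def by blast
qed

text \<open>On the circle reversal is conjugation followed by multiplication with z^n, which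
  reverses the order of the test powers. Orthogonality of p to 1, ..., z^(n-1) thus becomes
  orthogonality of the reversal to z, ..., z^n.\<close>

lemma integral_reversed:
  assumes "degree p \<le> n" "j \<le> n"
  shows "(\<integral>z. cnj (z ^ j) * poly (reversed_poly n p) z \<partial>M) = cnj (\<integral>z. cnj (z ^ (n - j)) * poly p z \<partial>M)"
proof -
  have "(\<integral>z. cnj (z ^ j) * poly (reversed_poly n p) z \<partial>M) = (\<integral>z. cnj (cnj (z ^ (n - j)) * poly p z) \<partial>M)"
  proof (intro Bochner_Integration.integral_cong refl)
    fix z assume "z \<in> space M"
    then have z: "cmod z = 1" by (simp add: space_M)
    have "cnj (z ^ j) * poly (reversed_poly n p) z = (z ^ n * cnj z ^ j) * cnj (poly p z)"
      unfolding poly_reversed_poly_circle[OF assms(1) z] by (simp add: mult_ac)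
    also have "z ^ n * cnj z ^ j = z ^ (n - j)"
      using power_cnj_power[OF z, of n j] assms(2) by simp
    finally show "cnj (z ^ j) * poly (reversed_poly n p) z = cnj (cnj (z ^ (n - j)) * poly p z)"
      by simp
  qed
  also have "\<dots> = cnj (\<integral>z. cnj (z ^ (n - j)) * poly p z \<partial>M)"
    by (rule Bochner_Integration.integral_cnj)
  finally show ?thesis .
qed

text \<open>Testing the reversal with 1 amounts to testing p with z^n, and z^n differs from p by
  terms orthogonal to p. This writes the squared norm as an integral of a polynomial, hence through
  moments.\<close>

lemma integral_reversed_orth:
  assumes p: "degree p = n \<and> lead_coeff p = 1" "orth p n"
  shows "(\<integral>z. poly (reversed_poly n p) z \<partial>M) = of_real (\<integral>z. (cmod (poly p z))\<^sup>2 \<partial>M)"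
proof -
  define q where "q = p - monom 1 n"
  have "coeff q n = 0" "degree q \<le> n"
    using p(1) unfolding q_def by (auto intro!: degree_diff_le simp: degree_monom_le)
  then have "degree q < n \<or> q = 0"
    by (metis leading_coeff_0_iff nat_less_le)
  from orth_poly[OF p(2) this] have q0: "(\<integral>z. cnj (poly q z) * poly p z \<partial>M) = 0" .
  have "(\<integral>z. cnj (poly p z) * poly p z \<partial>M) =
      (\<integral>z. cnj (poly q z) * poly p z + cnj (z ^ n) * poly p z \<partial>M)"
    unfolding q_def by (simp add: poly_monom algebra_simps)
  also have "\<dots> = (\<integral>z. cnj (poly q z) * poly p z \<partial>M) + (\<integral>z. cnj (z ^ n) * poly p z \<partial>M)"
    by (intro Bochner_Integration.integral_add integrable_cont continuous_intros)
  finally have E: "(\<integral>z. cnj (z ^ n) * poly p z \<partial>M) = of_real (\<integral>z. (cmod (poly p z))\<^sup>2 \<partial>M)"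
    using q0 norm_sq_eq by simp
  show ?thesis using integral_reversed[of p n 0] p(1) E by simp
qed

text \<open>Both z p and the reversal are orthogonal to z, ..., z^n, and b is chosen to make their
  combination q orthogonal to 1 as well. The reversal has degree at most n and is therefore
  orthogonal to q, so writing z p as q plus b times the reversal is a Pythagorean decomposition.
  Positivity of the norm of q then forces |b| < 1.\<close>

lemma opuc_step:
  assumes p: "degree p = n \<and> lead_coeff p = 1" "orth p n"
  defines "E \<equiv> (\<integral>z. (cmod (poly p z))\<^sup>2 \<partial>M)"
  defines "b \<equiv> (\<integral>z. z * poly p z \<partial>M) / of_real E"
  defines "q \<equiv> pCons 0 p - smult b (reversed_poly n p)"
  shows "degree q = Suc n \<and> lead_coeff q = 1" "orth q (Suc n)" "cmod b < 1"
    "(\<integral>z. (cmod (poly q z))\<^sup>2 \<partial>M) = (1 - (cmod b)\<^sup>2) * E"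
proof -
  show mq: "degree q = Suc n \<and> lead_coeff q = 1"
    unfolding q_def by (rule monic_recursion[OF p(1)])
  have "p \<noteq> 0" using p(1) by auto
  from norm_pos[OF this] have E: "E > 0" unfolding E_def .
  show oq: "orth q (Suc n)"
    unfolding orth_def
  proof (intro allI impI)
    fix j assume j: "j < Suc n"
    have "(\<integral>z. cnj (z ^ j) * poly q z \<partial>M) =
        (\<integral>z. cnj (z ^ j) * (z * poly p z) - b * (cnj (z ^ j) * poly (reversed_poly n p) z) \<partial>M)"
      unfolding q_def by (simp add: algebra_simps)
    also have "\<dots> = (\<integral>z. cnj (z ^ j) * (z * poly p z) \<partial>M) - (\<integral>z. b * (cnj (z ^ j) * poly (reversed_poly n p) z) \<partial>M)"
      by (intro Bochner_Integration.integral_diff integrable_cont continuous_intros)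
    finally have I: "(\<integral>z. cnj (z ^ j) * poly q z \<partial>M) =
       (\<integral>z. cnj (z ^ j) * (z * poly p z) \<partial>M) - b * (\<integral>z. cnj (z ^ j) * poly (reversed_poly n p) z \<partial>M)"
      by simp
    show "(\<integral>z. cnj (z ^ j) * poly q z \<partial>M) = 0"
    proof (cases j)
      case 0
      then show ?thesis
        using I integral_reversed_orth[OF p] E unfolding b_def E_def[symmetric] by simp
    next
      case (Suc i)
      have "(\<integral>z. cnj (z ^ j) * (z * poly p z) \<partial>M) = (\<integral>z. cnj (z ^ i) * poly p z \<partial>M)"
      proof (intro Bochner_Integration.integral_cong refl)
        fix z assume "z \<in> space M"
        then have "z * cnj z = 1" by (intro cnj_eq_inverse_circle) (simp add: space_M)
        then show "cnj (z ^ j) * (z * poly p z) = cnj (z ^ i) * poly p z"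
          unfolding Suc by (simp add: algebra_simps)
      qed
      also have "\<dots> = 0" using p(2) j Suc unfolding orth_def by simp
      finally have 1: "(\<integral>z. cnj (z ^ j) * (z * poly p z) \<partial>M) = 0" .
      have "(\<integral>z. cnj (z ^ (n - j)) * poly p z \<partial>M) = 0"
        using p(2) j Suc unfolding orth_def by simp
      then have "(\<integral>z. cnj (z ^ j) * poly (reversed_poly n p) z \<partial>M) = 0"
        using integral_reversed[of p n j] p(1) j by simp
      with I 1 show ?thesis by simp
    qed
  qed
  have dr: "degree (reversed_poly n p) < Suc n"
    by (intro le_imp_less_Suc degree_le) (simp add: coeff_reversed_poly)
  have cross: "(\<integral>z. cnj (poly (reversed_poly n p) z) * poly q z \<partial>M) = 0"
    using orth_poly[OF oq] dr by blast
  have zp: "z * poly p z = poly q z + b * poly (reversed_poly n p) z" for z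
    unfolding q_def by simp
  have pt: "(cmod (poly p z))\<^sup>2 = (cmod (poly q z))\<^sup>2 + (cmod b)\<^sup>2 * (cmod (poly p z))\<^sup>2
      + 2 * Re (cnj b * (cnj (poly (reversed_poly n p) z) * poly q z))" if "z \<in> space M" for z
  proof -
    have z: "cmod z = 1" using that by (simp add: space_M)
    have r: "cmod (poly (reversed_poly n p) z) = cmod (poly p z)"
      using p(1) z by (subst poly_reversed_poly_circle) (auto simp: norm_mult norm_power)
    have "(cmod (poly p z))\<^sup>2 = (cmod (z * poly p z))\<^sup>2" using z by (simp add: norm_mult)
    also have "\<dots> = (cmod (poly q z))\<^sup>2 + (cmod (b * poly (reversed_poly n p) z))\<^sup>2
        + 2 * Re (poly q z * cnj (b * poly (reversed_poly n p) z))"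
      unfolding zp by (rule cmod_add_squared)
    also have "(cmod (b * poly (reversed_poly n p) z))\<^sup>2 = (cmod b)\<^sup>2 * (cmod (poly p z))\<^sup>2"
      by (simp add: norm_mult r power_mult_distrib)
    also have "poly q z * cnj (b * poly (reversed_poly n p) z) = cnj b * (cnj (poly (reversed_poly n p) z) * poly q z)"
      by simp
    finally show ?thesis .
  qed
  have i1: "integrable M (\<lambda>z. (cmod (poly q z))\<^sup>2)"
    and i2: "integrable M (\<lambda>z. (cmod b)\<^sup>2 * (cmod (poly p z))\<^sup>2)"
    and i3: "integrable M (\<lambda>z. 2 * Re (cnj b * (cnj (poly (reversed_poly n p) z) * poly q z)))"
    and i4: "integrable M (\<lambda>z. cnj b * (cnj (poly (reversed_poly n p) z) * poly q z))"
    by (intro integrable_cont continuous_intros)+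
  have "E = (\<integral>z. (cmod (poly q z))\<^sup>2 + (cmod b)\<^sup>2 * (cmod (poly p z))\<^sup>2
      + 2 * Re (cnj b * (cnj (poly (reversed_poly n p) z) * poly q z)) \<partial>M)"
    unfolding E_def using pt by (intro Bochner_Integration.integral_cong) auto
  also have "\<dots> = (\<integral>z. (cmod (poly q z))\<^sup>2 \<partial>M) + (\<integral>z. (cmod b)\<^sup>2 * (cmod (poly p z))\<^sup>2 \<partial>M)
      + (\<integral>z. 2 * Re (cnj b * (cnj (poly (reversed_poly n p) z) * poly q z)) \<partial>M)"
    by (simp only: Bochner_Integration.integral_add Bochner_Integration.integrable_add i1 i2 i3)
  also have "(\<integral>z. (cmod b)\<^sup>2 * (cmod (poly p z))\<^sup>2 \<partial>M) = (cmod b)\<^sup>2 * E"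
    unfolding E_def by simp
  also have "(\<integral>z. 2 * Re (cnj b * (cnj (poly (reversed_poly n p) z) * poly q z)) \<partial>M) =
      2 * Re (\<integral>z. cnj b * (cnj (poly (reversed_poly n p) z) * poly q z) \<partial>M)"
    by (simp only: integral_mult_right_zero integral_Re[OF i4])
  also have "\<dots> = 0" using cross by simp
  finally show nq: "(\<integral>z. (cmod (poly q z))\<^sup>2 \<partial>M) = (1 - (cmod b)\<^sup>2) * E"
    by (simp add: algebra_simps)
  have "q \<noteq> 0" using mq by auto
  from norm_pos[OF this] have "(1 - (cmod b)\<^sup>2) > 0" using nq E by (simp add: zero_less_mult_iff)
  then show "cmod b < 1" by (simp add: power_less_one_iff)
qed

lemma ex_orth: "\<exists>p. (degree p = n \<and> lead_coeff p = 1) \<and> orth p n"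
proof (induction n)
  case 0
  show ?case by (rule exI[of _ 1]) (simp add: orth_def)
next
  case (Suc n)
  then show ?case using opuc_step(1,2) by blast
qed

lemma monic_opuc:
  "degree (monic_opuc M n) = n \<and> lead_coeff (monic_opuc M n) = 1" "orth (monic_opuc M n) n"
proof -
  obtain p where p: "degree p = n \<and> lead_coeff p = 1" "orth p n"
    using ex_orth[of n] by blast
  show "degree (monic_opuc M n) = n \<and> lead_coeff (monic_opuc M n) = 1" "orth (monic_opuc M n) n"
    unfolding monic_opuc_eqI[OF p] by (rule p)+
qed

text \<open>The formula for the coefficient is a quotient of two integrals of polynomials;
  \<open>verblunsky_tendsto\<close> draws continuity in the moments from it.\<close>

lemma verblunsky_step:
  shows "verblunsky M n = cnj ((\<integral>z. z * poly (monic_opuc M n) z \<partial>M) /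
      (\<integral>z. poly (reversed_poly n (monic_opuc M n)) z \<partial>M))" (is "_ = cnj ?b")
    and "cmod (verblunsky M n) < 1"
    and "monic_opuc M (Suc n) = pCons 0 (monic_opuc M n) -
      smult (cnj (verblunsky M n)) (reversed_poly n (monic_opuc M n))"
    and "(\<integral>z. (cmod (poly (monic_opuc M (Suc n)) z))\<^sup>2 \<partial>M) =
      (1 - (cmod (verblunsky M n))\<^sup>2) * (\<integral>z. (cmod (poly (monic_opuc M n) z))\<^sup>2 \<partial>M)"
proof -
  define b where "b = ?b"
  note step = opuc_step[OF monic_opuc(1,2)[of n], folded integral_reversed_orth[OF monic_opuc(1,2)[of n]], folded b_def]
  have S: "monic_opuc M (Suc n) = pCons 0 (monic_opuc M n) - smult b (reversed_poly n (monic_opuc M n))"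
    by (rule monic_opuc_eqI) (use step in auto)
  have m: "monom 1 1 * p = pCons 0 p" for p :: "complex poly"
    by (simp add: monom_altdef)
  have "coeff (monic_opuc M n) n = 1"
    using conjunct2[OF monic_opuc(1)[of n]] unfolding conjunct1[OF monic_opuc(1)[of n]] .
  \<comment> \<open>The constant coefficient 1 of the reversal makes the number in the recursion
    unique.\<close>
  then have c0: "coeff (reversed_poly n (monic_opuc M n)) 0 = 1"
    by (simp add: coeff_reversed_poly)
  have v: "verblunsky M n = cnj b"
    unfolding verblunsky_def
  proof (rule the_equality)
    show "cmod (cnj b) < 1 \<and> monic_opuc M (Suc n) =
        monom 1 1 * monic_opuc M n - smult (cnj (cnj b)) (reversed_poly n (monic_opuc M n))"
      using S step(3) unfolding m by simp
    fix a assume a: "cmod a < 1 \<and> monic_opuc M (Suc n) =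
        monom 1 1 * monic_opuc M n - smult (cnj a) (reversed_poly n (monic_opuc M n))"
    have "pCons 0 (monic_opuc M n) - smult (cnj a) (reversed_poly n (monic_opuc M n)) =
        pCons 0 (monic_opuc M n) - smult b (reversed_poly n (monic_opuc M n))"
      using trans[OF conjunct2[OF a, symmetric] S] unfolding m .
    then have "smult (cnj a) (reversed_poly n (monic_opuc M n)) = smult b (reversed_poly n (monic_opuc M n))"
      by (rule diff_left_imp_eq)
    then have "coeff (smult (cnj a) (reversed_poly n (monic_opuc M n))) 0 =
        coeff (smult b (reversed_poly n (monic_opuc M n))) 0" by (rule arg_cong)
    then have "cnj a = b" unfolding coeff_smult c0 by (simp only: mult_1_right)
    then show "a = cnj b" by (simp only: complex_cnj_cnj flip: \<open>cnj a = b\<close>)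
  qed
  then show "verblunsky M n = cnj ?b" unfolding b_def .
  show "cmod (verblunsky M n) < 1" using step(3) v by simp
  show "monic_opuc M (Suc n) = pCons 0 (monic_opuc M n) -
      smult (cnj (verblunsky M n)) (reversed_poly n (monic_opuc M n))"
    using S v by simp
  show "(\<integral>z. (cmod (poly (monic_opuc M (Suc n)) z))\<^sup>2 \<partial>M) =
      (1 - (cmod (verblunsky M n))\<^sup>2) * (\<integral>z. (cmod (poly (monic_opuc M n) z))\<^sup>2 \<partial>M)"
    using step(4) unfolding S v complex_mod_cnj .
qed

lemma monic_opuc_0: "monic_opuc M 0 = 1"
  by (rule monic_opuc_eqI) (auto simp: orth_def)

lemma monic_opuc_szego: "monic_opuc M n = szego (verblunsky M) n"
  by (induction n) (simp_all add: monic_opuc_0 verblunsky_step(3))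

lemma norm_monic_opuc:
  "(\<integral>z. (cmod (poly (monic_opuc M n) z))\<^sup>2 \<partial>M) =
     measure M (space M) * (\<Prod>j<n. 1 - (cmod (verblunsky M j))\<^sup>2)"
  by (induction n) (simp_all add: monic_opuc_0 verblunsky_step(4) mult_ac)

end

section \<open>Verblunsky coefficients and moments\<close>

lemma smult_left_cancel:
  assumes "(c :: complex) \<noteq> 0" "smult c p = smult c q"
  shows "p = q"
  using assms by (auto simp: poly_eq_iff)

text \<open>The inverse recursion: the constant coefficient of \<Phi>_(n+1) yields a_n, and adding
  \<open>cnj (a n)\<close> times its reversal to \<Phi>_(n+1) gives (1 - |a_n|^2) z \<Phi>_n, with a
  nonzero factor.\<close>

lemma szego_determines_initial:
  assumes "szego a n = szego a' n" "\<And>j. j < n \<Longrightarrow> cmod (a j) < 1" "k \<le> n"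
  shows "szego a k = szego a' k"
  using assms
proof (induction n)
  case (Suc n)
  have c: "coeff (szego x (Suc n)) 0 = - cnj (x n)" for x
    by (simp add: coeff_reversed_poly)
  have an: "a n = a' n" using Suc.prems(1) c[of a] c[of a'] by simp
  have inv: "smult (1 - of_real ((cmod (x n))\<^sup>2)) (pCons 0 (szego x n)) =
      szego x (Suc n) + smult (cnj (x n)) (szego_rev x (Suc n))" for x
    unfolding szego_rev_Suc complex_norm_square
    by (simp add: smult_diff_right smult_diff_left mult.commute)
  have ne: "1 - of_real ((cmod (a n))\<^sup>2) \<noteq> (0 :: complex)"
  proof -
    have "(cmod (a n))\<^sup>2 < 1" using Suc.prems(2)[of n] by (simp add: power_less_one_iff)
    then have "complex_of_real (1 - (cmod (a n))\<^sup>2) \<noteq> 0" unfolding of_real_eq_0_iff by linarith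
    then show ?thesis unfolding of_real_diff of_real_1 .
  qed
  have "smult (1 - of_real ((cmod (a n))\<^sup>2)) (pCons 0 (szego a n)) =
      smult (1 - of_real ((cmod (a n))\<^sup>2)) (pCons 0 (szego a' n))"
    unfolding inv[of a] inv[of a', folded an] Suc.prems(1) ..
  then have "pCons 0 (szego a n) = pCons 0 (szego a' n)"
    by (rule smult_left_cancel[OF ne])
  then have eq: "szego a n = szego a' n" by simp
  show ?case
  proof (cases "k = Suc n")
    case False
    then show ?thesis using Suc.IH[OF eq] Suc.prems by simp
  qed (use Suc.prems in simp)
qed simp

text \<open>For k > 0 the integral of \<Phi>_k vanishes, which expresses the k-th moment linearly
  through lower ones; the polynomials leave only the mass free.\<close>

lemma moments_eq_of_monic_opuc_eq:
  assumes "circle_weight M" "circle_weight N"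
    and eq: "\<And>k. k \<le> n \<Longrightarrow> monic_opuc M k = monic_opuc N k"
    and mass: "(\<integral>z. 1 \<partial>M) = c * (\<integral>z. (1::complex) \<partial>N)"
  shows "k \<le> n \<Longrightarrow> (\<integral>z. z ^ k \<partial>M) = c * (\<integral>z. z ^ k \<partial>N)"
proof (induction k rule: less_induct)
  case (less k)
  interpret M: circle_weight M by fact
  interpret N: circle_weight N by fact
  show ?case
  proof (cases k)
    case 0
    then show ?thesis using mass by simp
  next
    case (Suc m)
    have dM: "degree (monic_opuc M k) \<le> k" "coeff (monic_opuc M k) k = 1"
      using M.monic_opuc(1)[of k] by auto
    have I: "(\<Sum>j\<le>k. coeff (monic_opuc K k) j * (\<integral>z. z ^ j \<partial>K)) = 0" if "circle_weight K" for K
    proof -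
      interpret K: circle_weight K by fact
      have "(\<integral>z. cnj (z ^ 0) * poly (monic_opuc K k) z \<partial>K) = 0"
        using K.monic_opuc(2)[of k] unfolding K.orth_def Suc by blast
      then show ?thesis
        using K.integral_poly_moments[of "monic_opuc K k" k] K.monic_opuc(1)[of k] by simp
    qed
    have split: "(\<Sum>j\<le>k. f j) = (\<Sum>j<k. f j) + f k" for f :: "nat \<Rightarrow> complex"
      by (simp add: lessThan_Suc_atMost[symmetric])
    have "(\<Sum>j<k. coeff (monic_opuc M k) j * (\<integral>z. z ^ j \<partial>M)) = c * (\<Sum>j<k. coeff (monic_opuc N k) j * (\<integral>z. z ^ j \<partial>N))"
      unfolding sum_distrib_left using less eq[of k] by (intro sum.cong refl) auto
    then show ?thesis
      using I[OF assms(1)] I[OF assms(2)] dM eq[of k] less.prems unfolding split by (simp add: add_eq_0_iff)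
  qed
qed

text \<open>The coefficients of \<Phi>_n and the number \<alpha>_n converge in alternation along the
  recursion: \<alpha>_n is a quotient of integrals whose limiting denominator is the positive
  squared norm of \<Phi>_n. The scalars c cancel in this quotient.\<close>

lemma verblunsky_tendsto:
  assumes "\<And>i. circle_weight (Mi i)" "circle_weight M"
    and mom: "\<And>k. (\<lambda>i. c i * (\<integral>z. z ^ k \<partial>Mi i)) \<longlonglongrightarrow> (\<integral>z. z ^ k \<partial>M)"
    and c: "\<And>i. c i \<noteq> 0"
  shows "(\<lambda>i. verblunsky (Mi i) n) \<longlonglongrightarrow> verblunsky M n"
proof -
  interpret M: circle_weight M by fact
  have I: "(\<lambda>i. c i * (\<integral>z. poly (q i) z \<partial>Mi i)) \<longlonglongrightarrow> (\<integral>z. poly q' z \<partial>M)"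
    if "\<And>i. degree (q i) \<le> n" "degree q' \<le> n" "\<And>k. (\<lambda>i. coeff (q i) k) \<longlonglongrightarrow> coeff q' k" for q q' n
  proof -
    have "c i * (\<integral>z. poly (q i) z \<partial>Mi i) = (\<Sum>j\<le>n. coeff (q i) j * (c i * (\<integral>z. z ^ j \<partial>Mi i)))" for i
      unfolding circle_weight.integral_poly_moments[OF assms(1) that(1)] sum_distrib_left
      by (simp only: mult.left_commute)
    moreover have "(\<integral>z. poly q' z \<partial>M) = (\<Sum>j\<le>n. coeff q' j * (\<integral>z. z ^ j \<partial>M))"
      using M.integral_poly_moments[OF that(2)] .
    ultimately show ?thesis using that(3) mom by (simp add: tendsto_intros)
  qed
  have V: "(\<lambda>i. verblunsky (Mi i) n) \<longlonglongrightarrow> verblunsky M n"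
    if cf: "\<And>k. (\<lambda>i. coeff (monic_opuc (Mi i) n) k) \<longlonglongrightarrow> coeff (monic_opuc M n) k" for n
  proof -
    have di: "degree (monic_opuc (Mi i) n) = n" for i
      using circle_weight.monic_opuc(1)[OF assms(1)] by blast
    have dM: "degree (monic_opuc M n) = n" using M.monic_opuc(1) by blast
    have 1: "(\<lambda>i. c i * (\<integral>z. poly (pCons 0 (monic_opuc (Mi i) n)) z \<partial>Mi i)) \<longlonglongrightarrow>
        (\<integral>z. poly (pCons 0 (monic_opuc M n)) z \<partial>M)"
    proof (rule I)
      show "(\<lambda>i. coeff (pCons 0 (monic_opuc (Mi i) n)) k) \<longlonglongrightarrow> coeff (pCons 0 (monic_opuc M n)) k" for k
        using cf by (cases k) auto
      show "degree (pCons 0 (monic_opuc (Mi i) n)) \<le> Suc n" "degree (pCons 0 (monic_opuc M n)) \<le> Suc n" for i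
        using degree_pCons_le[of 0 "monic_opuc (Mi i) n"] degree_pCons_le[of 0 "monic_opuc M n"] di dM by auto
    qed
    have 2: "(\<lambda>i. c i * (\<integral>z. poly (reversed_poly n (monic_opuc (Mi i) n)) z \<partial>Mi i)) \<longlonglongrightarrow>
        (\<integral>z. poly (reversed_poly n (monic_opuc M n)) z \<partial>M)"
    proof (rule I[of _ n])
      show "(\<lambda>i. coeff (reversed_poly n (monic_opuc (Mi i) n)) k) \<longlonglongrightarrow> coeff (reversed_poly n (monic_opuc M n)) k" for k
        unfolding coeff_reversed_poly using cf by (auto intro!: tendsto_intros)
    qed (auto intro!: degree_le simp: coeff_reversed_poly)
    have "monic_opuc M n \<noteq> 0" using M.monic_opuc(1)[of n] by auto
    then have "(\<integral>z. poly (reversed_poly n (monic_opuc M n)) z \<partial>M) \<noteq> 0"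
      using M.norm_pos[of "monic_opuc M n"] unfolding M.integral_reversed_orth[OF M.monic_opuc(1,2)] of_real_eq_0_iff by simp
    from tendsto_cnj[OF tendsto_divide[OF 1 2 this]] show ?thesis
      unfolding M.verblunsky_step(1) circle_weight.verblunsky_step(1)[OF assms(1)] using c by simp
  qed
  have "(\<lambda>i. coeff (monic_opuc (Mi i) n) k) \<longlonglongrightarrow> coeff (monic_opuc M n) k" for k
  proof (induction n arbitrary: k)
    case 0
    then show ?case by (simp add: M.monic_opuc_0 circle_weight.monic_opuc_0[OF assms(1)])
  next
    case (Suc n)
    have "(\<lambda>i. coeff (pCons 0 (monic_opuc (Mi i) n)) k) \<longlonglongrightarrow> coeff (pCons 0 (monic_opuc M n)) k"
      using Suc by (cases k) auto
    moreover have "(\<lambda>i. coeff (reversed_poly n (monic_opuc (Mi i) n)) k) \<longlonglongrightarrow> coeff (reversed_poly n (monic_opuc M n)) k"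
      unfolding coeff_reversed_poly using Suc by (auto intro!: tendsto_intros)
    ultimately show ?case
      unfolding M.verblunsky_step(3) circle_weight.verblunsky_step(3)[OF assms(1)] coeff_diff coeff_smult
      by (intro tendsto_intros V Suc)
  qed
  then show ?thesis by (rule V)
qed

text \<open>If |p|^2 has integral 0, the open set where p does not vanish has measure 0, and the
  support lies among the finitely many roots of p.\<close>

lemma circle_weight_of_nontrivial:
  assumes "prob_space M" and s: "sets M = sets circle_borel" and "nontrivial_measure M"
  shows "circle_weight M"
proof -
  interpret prob_space M by fact
  have sp: "space M = sphere 0 1" using sets_eq_imp_space_eq[OF s] by simp
  note ic = integrable_continuous_circle[OF finite_measure_axioms s]
  show ?thesis
  proof
    fix p :: "complex poly" assume "p \<noteq> 0"
    have int: "integrable M (\<lambda>z. (cmod (poly p z))\<^sup>2)" by (intro ic continuous_intros)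
    show "0 < (\<integral>z. (cmod (poly p z))\<^sup>2 \<partial>M)"
    proof (rule ccontr)
      assume "\<not> 0 < (\<integral>z. (cmod (poly p z))\<^sup>2 \<partial>M)"
      moreover have "0 \<le> (\<integral>z. (cmod (poly p z))\<^sup>2 \<partial>M)" by simp
      ultimately have "(\<integral>z. (cmod (poly p z))\<^sup>2 \<partial>M) = 0" by linarith
      then have ae: "AE z in M. (cmod (poly p z))\<^sup>2 = 0"
        using int by (subst (asm) integral_nonneg_eq_0_iff_AE) auto
      have "measure_support M \<subseteq> {z. poly p z = 0}"
      proof
        fix x assume x: "x \<in> measure_support M"
        show "x \<in> {z. poly p z = 0}"
        proof (rule ccontr)
          assume "x \<notin> {z. poly p z = 0}"
          moreover have op: "open {z. poly p z \<noteq> 0}"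
            by (intro open_Collect_neq continuous_intros)
          ultimately have "emeasure M ({z. poly p z \<noteq> 0} \<inter> space M) > 0"
            using x unfolding measure_support_def by auto
          moreover have "emeasure M {z \<in> space M. \<not> (cmod (poly p z))\<^sup>2 = 0} = 0"
          proof (rule AE_iff_measurable[THEN iffD1, OF _ refl ae])
            have "{z \<in> space M. \<not> (cmod (poly p z))\<^sup>2 = 0} = sphere 0 1 \<inter> {z. poly p z \<noteq> 0}"
              by (auto simp: sp)
            then show "{z \<in> space M. \<not> (cmod (poly p z))\<^sup>2 = 0} \<in> sets M"
              unfolding s sets_restrict_space using op by auto
          qed
          moreover have "{z. poly p z \<noteq> 0} \<inter> space M = {z \<in> space M. \<not> (cmod (poly p z))\<^sup>2 = 0}" by auto
          ultimately show False by simp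
        qed
      qed
      then have "finite (measure_support M)"
        using poly_roots_finite[OF \<open>p \<noteq> 0\<close>] finite_subset by blast
      with assms(3) show False unfolding nontrivial_measure_def by simp
    qed
  qed (use s in auto)
qed

section \<open>Continuous weights and Bernstein-Szego measures\<close>

lemma poly_eq_pser: "poly p z = pser (coeff p) z"
  unfolding pser_def poly_altdef by (rule suminf_finite[symmetric]) (auto simp: coeff_eq_0 not_le)

lemma summable_coeff: "summable (\<lambda>k. cmod (coeff p k))"
  by (rule summable_finite[of "{..degree p}"]) (auto simp: coeff_eq_0 not_le)

lemma integral_density_circle:
  fixes g :: "complex \<Rightarrow> 'b::{banach, second_countable_topology}"
  assumes "continuous_on (sphere 0 1) f" "\<And>z. z \<in> sphere 0 1 \<Longrightarrow> f z \<ge> 0"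
    "continuous_on (sphere 0 1) g"
  shows "(\<integral>z. g z \<partial>density circle_measure (\<lambda>z. ennreal (f z))) = (\<integral>z. f z *\<^sub>R g z \<partial>circle_measure)"
  using assms by (intro integral_density borel_measurable_circle) auto

text \<open>The minimum of f on the circle is a positive lower bound, and Parseval settles the
  constant weight.\<close>

lemma circle_weight_density:
  assumes f: "continuous_on (sphere 0 1) f" "\<And>z. z \<in> sphere 0 1 \<Longrightarrow> f z > 0"
  shows "circle_weight (density circle_measure (\<lambda>z. ennreal (f z)))"
proof -
  let ?D = "density circle_measure (\<lambda>z. ennreal (f z))"
  interpret D: finite_measure ?D
    by (intro finite_measure_density_circle integrable_circle f less_imp_le)
  obtain w where w: "w \<in> sphere 0 1" "\<And>z. z \<in> sphere 0 1 \<Longrightarrow> f w \<le> f z"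
    using continuous_attains_inf[OF compact_sphere _ f(1)] by auto
  show ?thesis
  proof
    fix p :: "complex poly" assume "p \<noteq> 0"
    have pos: "0 < (\<integral>z. (cmod (poly p z))\<^sup>2 \<partial>circle_measure)"
    proof -
      have s: "(\<lambda>k. (cmod (coeff p k))\<^sup>2) sums (\<integral>z. (cmod (poly p z))\<^sup>2 \<partial>circle_measure)"
        unfolding poly_eq_pser by (rule pser_parseval[OF summable_coeff])
      have "0 < (cmod (coeff p (degree p)))\<^sup>2" using \<open>p \<noteq> 0\<close> by simp
      then have "0 < (\<Sum>k. (cmod (coeff p k))\<^sup>2)"
        by (intro suminf_pos2[OF sums_summable[OF s], of "degree p"]) auto
      then show ?thesis using s by (simp add: sums_iff)
    qed
    have "0 < f w * (\<integral>z. (cmod (poly p z))\<^sup>2 \<partial>circle_measure)"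
      using f(2)[OF w(1)] pos by simp
    also have "\<dots> = (\<integral>z. f w * (cmod (poly p z))\<^sup>2 \<partial>circle_measure)" by simp
    also have "\<dots> \<le> (\<integral>z. f z *\<^sub>R (cmod (poly p z))\<^sup>2 \<partial>circle_measure)"
      using w by (intro integral_mono integrable_circle continuous_intros f) (auto intro!: mult_right_mono)
    also have "\<dots> = (\<integral>z. (cmod (poly p z))\<^sup>2 \<partial>?D)"
      using f by (intro integral_density_circle[symmetric] continuous_intros) (auto intro: less_imp_le)
    finally show "0 < (\<integral>z. (cmod (poly p z))\<^sup>2 \<partial>?D)" .
  qed (simp add: sets_density)
qed

lemma inverse_poly_power_series:
  assumes Z: "\<And>x. x \<in># Z \<Longrightarrow> cmod x < 1"
    and q: "\<And>w. poly q w = (\<Prod>y\<in>#Z. 1 - cnj y * w)"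
  obtains c where "summable (\<lambda>k. cmod (c k))" "\<And>z. cmod z \<le> 1 \<Longrightarrow> 1 / poly q z = pser c z"
proof -
  obtain r where r: "0 \<le> r" "r < 1" "\<And>x. x \<in># Z \<Longrightarrow> cmod x \<le> r"
    using max_norm_mset[OF Z] by blast
  \<comment> \<open>The midpoint of r and 1 is positive even for r = 0, and the disc of radius 1 / s
    > 1 contains no zero of q.\<close>
  define s where "s = (r + 1) / 2"
  have s: "0 < s" "s < 1" "r \<le> s" using r unfolding s_def by auto
  have nz: "poly q w \<noteq> 0" if "w \<in> ball 0 (1 / s)" for w
  proof
    assume "poly q w = 0"
    then obtain y where y: "y \<in># Z" "1 - cnj y * w = 0"
      unfolding q by (auto simp: prod_mset_zero_iff)
    have "cnj y * w = 1" using y(2) unfolding right_minus_eq by (rule sym)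
    from arg_cong[OF this, of cmod] have "1 = cmod (cnj y * w)" unfolding norm_one by (rule sym)
    also have "\<dots> \<le> s * cmod w"
      using r(3)[OF y(1)] s by (auto simp: norm_mult intro!: mult_right_mono)
    also have "\<dots> < 1" using that s by (simp add: field_simps)
    finally show False by simp
  qed
  have hol: "(\<lambda>w. 1 / poly q w) holomorphic_on ball 0 (1 / s)"
  proof (rule holomorphic_on_divide[OF holomorphic_on_const _ nz])
    show "poly q holomorphic_on ball 0 (1 / s)" by (intro holomorphic_intros)
  qed
  have "1 / s > 1" using s by simp
  note ps = power_series_abs_summable[OF hol this]
  show ?thesis by (rule that[OF ps(1)]) (rule ps(2))
qed

text \<open>On the circle, q divided by z^j |q|^2 equals z^(n - j) divided by the reversal of q. The
  reversal has no zero in the closed disc, so this is a power series vanishing at 0, and its mean is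
  0. The last claim expresses that q has norm 1 in M.\<close>

lemma monic_opuc_bernstein_szego:
  assumes q: "degree q = n \<and> lead_coeff q = 1"
    and roots: "\<And>x. poly q x = 0 \<Longrightarrow> cmod x < 1"
  defines "M \<equiv> density circle_measure (\<lambda>z. ennreal (1 / (cmod (poly q z))\<^sup>2))"
  shows "circle_weight M" "monic_opuc M n = q"
    "(\<integral>z. 1 / (cmod (poly q z))\<^sup>2 \<partial>circle_measure) * (\<Prod>j<n. 1 - (cmod (verblunsky M j))\<^sup>2) = 1"
proof -
  have nz: "poly q z \<noteq> 0" if "z \<in> sphere 0 1" for z
    using roots[of z] that by auto
  have f: "continuous_on (sphere 0 1) (\<lambda>z. 1 / (cmod (poly q z))\<^sup>2)"
    using nz by (auto intro!: continuous_intros)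
  have fpos: "1 / (cmod (poly q z))\<^sup>2 > 0" if "z \<in> sphere 0 1" for z
    using nz[OF that] by simp
  show cw: "circle_weight M"
    unfolding M_def by (rule circle_weight_density[OF f fpos])
  interpret circle_weight M by fact
  have "q \<noteq> 0" using q by auto
  have Z: "cmod x < 1" if "x \<in># proots q" for x
    using that roots \<open>q \<noteq> 0\<close> by auto
  obtain c where c: "summable (\<lambda>k. cmod (c k))" "\<And>z. cmod z \<le> 1 \<Longrightarrow> 1 / poly (reversed_poly n q) z = pser c z"
    by (rule inverse_poly_power_series[of "proots q" "reversed_poly n q"])
       (rule Z, assumption, rule poly_reversed_monic[OF conjunct1[OF q] conjunct2[OF q]], rule that)
  have "orth q n"
    unfolding orth_def
  proof (intro allI impI)
    fix j assume j: "j < n"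
    then obtain d where d: "n = j + Suc d" using less_imp_Suc_add by auto
    have "(\<integral>z. cnj (z ^ j) * poly q z \<partial>M) =
        (\<integral>z. (1 / (cmod (poly q z))\<^sup>2) *\<^sub>R (cnj (z ^ j) * poly q z) \<partial>circle_measure)"
      unfolding M_def
      by (rule integral_density_circle[OF f]) (auto intro!: continuous_intros)
    also have "\<dots> = (\<integral>z. z ^ Suc d * pser c z \<partial>circle_measure)"
    proof (intro Bochner_Integration.integral_cong refl)
      fix z assume "z \<in> space circle_measure"
      then have z: "z \<in> sphere 0 1" "cmod z = 1" by auto
      have r: "poly (reversed_poly n q) z = z ^ n * cnj (poly q z)"
        using q z by (intro poly_reversed_poly_circle) auto
      have cj: "cnj (z ^ j) = z ^ Suc d / z ^ n"
      proof -
        have "z ^ j * cnj z ^ j = 1" using power_cnj_power[OF z(2), of j j] by simp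
        moreover have "cnj z ^ j * z ^ n = (z ^ j * cnj z ^ j) * z ^ Suc d"
          unfolding d power_add by (simp only: mult_ac)
        ultimately have "cnj (z ^ j) * z ^ n = z ^ Suc d" by simp
        moreover have "z ^ n \<noteq> 0" using z by auto
        ultimately show ?thesis by (simp only: eq_divide_eq not_False_eq_True if_True)
      qed
      have "(1 / (cmod (poly q z))\<^sup>2) *\<^sub>R (cnj (z ^ j) * poly q z) = cnj (z ^ j) / cnj (poly q z)"
        unfolding scaleR_conv_of_real of_real_divide complex_norm_square of_real_1
        using nz[OF z(1)] by (simp add: field_simps)
      also have "\<dots> = z ^ Suc d / z ^ n / cnj (poly q z)" unfolding cj ..
      also have "z ^ Suc d / z ^ n / cnj (poly q z) = z ^ Suc d * (1 / poly (reversed_poly n q) z)"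
        unfolding r by (simp add: field_simps)
      also have "\<dots> = z ^ Suc d * pser c z" using c(2) z by simp
      finally show "(1 / (cmod (poly q z))\<^sup>2) *\<^sub>R (cnj (z ^ j) * poly q z) = z ^ Suc d * pser c z" .
    qed
    also have "\<dots> = 0" by (rule pser_neg_coeff[OF c(1)])
    finally show "(\<integral>z. cnj (z ^ j) * poly q z \<partial>M) = 0" .
  qed
  with q show mq: "monic_opuc M n = q" by (rule monic_opuc_eqI)
  have "1 = (\<integral>z. (1 / (cmod (poly q z))\<^sup>2) *\<^sub>R (cmod (poly q z))\<^sup>2 \<partial>circle_measure)"
  proof -
    have "(\<integral>z. (1 / (cmod (poly q z))\<^sup>2) *\<^sub>R (cmod (poly q z))\<^sup>2 \<partial>circle_measure) = (\<integral>z. 1 \<partial>circle_measure)"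
      using nz by (intro Bochner_Integration.integral_cong) auto
    then show ?thesis by (simp add: circle.prob_space)
  qed
  also have "\<dots> = (\<integral>z. (cmod (poly q z))\<^sup>2 \<partial>M)"
    unfolding M_def by (rule integral_density_circle[OF f, symmetric]) (auto intro!: continuous_intros)
  also have "\<dots> = measure M (space M) * (\<Prod>j<n. 1 - (cmod (verblunsky M j))\<^sup>2)"
    using norm_monic_opuc[of n] unfolding mq .
  also have "measure M (space M) = (\<integral>z. 1 \<partial>M)" by simp
  also have "\<dots> = (\<integral>z. (1 / (cmod (poly q z))\<^sup>2) *\<^sub>R 1 \<partial>circle_measure)"
    unfolding M_def by (rule integral_density_circle[OF f]) (auto intro!: continuous_intros)
  finally show "(\<integral>z. 1 / (cmod (poly q z))\<^sup>2 \<partial>circle_measure) * (\<Prod>j<n. 1 - (cmod (verblunsky M j))\<^sup>2) = 1"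
    by simp
qed

subsection \<open>Convergence of exponentials under energy bounds\<close>

text \<open>Bounded L2 norms give uniform integrability. Fatou puts v into L2; the difference w is
  cut at a level K, where the lower part converges by domination and the part above K is at most w^2
  / K.\<close>

lemma (in finite_measure) L2_bounded_convergence:
  fixes u :: "nat \<Rightarrow> 'a \<Rightarrow> 'b::{banach, second_countable_topology}"
  assumes [measurable]: "\<And>n. u n \<in> borel_measurable M" "v \<in> borel_measurable M"
    and lim: "AE x in M. (\<lambda>n. u n x) \<longlonglongrightarrow> v x"
    and int: "\<And>n. integrable M (\<lambda>x. (norm (u n x))\<^sup>2)"
    and C: "\<And>n. (\<integral>x. (norm (u n x))\<^sup>2 \<partial>M) \<le> C"
  shows "integrable M v" and "(\<lambda>n. \<integral>x. norm (u n x - v x) \<partial>M) \<longlonglongrightarrow> 0"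
    and "integrable M (\<lambda>x. (norm (v x))\<^sup>2)" and "\<And>n. integrable M (u n)"
proof -
  have sq: "norm y \<le> 1 + (norm y)\<^sup>2" for y :: 'b
    using zero_le_power2[of "norm y - 1 / 2"] by (simp add: power2_eq_square algebra_simps)
  have int1: "integrable M w" if "w \<in> borel_measurable M" "integrable M (\<lambda>x. (norm (w x))\<^sup>2)" for w :: "'a \<Rightarrow> 'b"
  proof (rule Bochner_Integration.integrable_bound[of M "\<lambda>x. 1 + (norm (w x))\<^sup>2"])
    show "AE x in M. norm (w x) \<le> norm (1 + (norm (w x))\<^sup>2)"
    proof (rule AE_I2)
      fix x
      have "norm (1 + (norm (w x))\<^sup>2) = 1 + (norm (w x))\<^sup>2" by simp
      then show "norm (w x) \<le> norm (1 + (norm (w x))\<^sup>2)" using sq[of "w x"] by simp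
    qed
  qed (use that in auto)
  have "C \<ge> 0" using C[of 0] integral_nonneg_AE[of "\<lambda>x. (norm (u 0 x))\<^sup>2" M] by (smt (verit) AE_I2 zero_le_power2)
  have "(\<integral>\<^sup>+x. ennreal ((norm (v x))\<^sup>2) \<partial>M) = (\<integral>\<^sup>+x. liminf (\<lambda>n. ennreal ((norm (u n x))\<^sup>2)) \<partial>M)"
  proof (rule nn_integral_cong_AE)
    show "AE x in M. ennreal ((norm (v x))\<^sup>2) = liminf (\<lambda>n. ennreal ((norm (u n x))\<^sup>2))"
      using lim
    proof eventually_elim
      fix x assume "(\<lambda>n. u n x) \<longlonglongrightarrow> v x"
      then have "(\<lambda>n. ennreal ((norm (u n x))\<^sup>2)) \<longlonglongrightarrow> ennreal ((norm (v x))\<^sup>2)"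
        by (intro tendsto_ennrealI tendsto_intros)
      then show "ennreal ((norm (v x))\<^sup>2) = liminf (\<lambda>n. ennreal ((norm (u n x))\<^sup>2))"
        by (intro lim_imp_Liminf[symmetric]) simp
    qed
  qed
  also have "\<dots> \<le> liminf (\<lambda>n. \<integral>\<^sup>+x. ennreal ((norm (u n x))\<^sup>2) \<partial>M)"
    by (intro nn_integral_liminf) measurable
  also have "\<dots> \<le> limsup (\<lambda>n. \<integral>\<^sup>+x. ennreal ((norm (u n x))\<^sup>2) \<partial>M)"
    by (rule Liminf_le_Limsup) simp
  also have "\<dots> \<le> ennreal C"
  proof (rule Limsup_bounded, rule always_eventually, rule allI)
    fix n
    show "(\<integral>\<^sup>+x. ennreal ((norm (u n x))\<^sup>2) \<partial>M) \<le> ennreal C"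
      using C[of n] by (subst nn_integral_eq_integral[OF int]) (auto intro: ennreal_leI)
  qed
  finally have vC: "(\<integral>\<^sup>+x. ennreal ((norm (v x))\<^sup>2) \<partial>M) \<le> ennreal C" .
  show iv2: "integrable M (\<lambda>x. (norm (v x))\<^sup>2)"
  proof (rule integrableI_bounded)
    show "(\<integral>\<^sup>+x. ennreal (norm ((norm (v x))\<^sup>2)) \<partial>M) < \<infinity>"
      using vC by (simp add: le_less_trans[OF _ ennreal_less_top])
  qed measurable
  have vC': "(\<integral>x. (norm (v x))\<^sup>2 \<partial>M) \<le> C"
    using vC \<open>C \<ge> 0\<close> by (subst (asm) nn_integral_eq_integral[OF iv2]) auto
  show iv: "integrable M v" by (rule int1[OF _ iv2]) measurable
  show iu: "integrable M (u n)" for n by (rule int1[OF _ int]) measurable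
  define w where "w n x = norm (u n x - v x)" for n x
  have wm [measurable]: "w n \<in> borel_measurable M" for n unfolding w_def by measurable
  have w2: "(w n x)\<^sup>2 \<le> 2 * (norm (u n x))\<^sup>2 + 2 * (norm (v x))\<^sup>2" for n x
  proof -
    have "(w n x)\<^sup>2 \<le> (norm (u n x) + norm (v x))\<^sup>2"
      unfolding w_def by (intro power_mono norm_triangle_ineq4) simp
    also have "\<dots> \<le> 2 * (norm (u n x))\<^sup>2 + 2 * (norm (v x))\<^sup>2"
      using zero_le_power2[of "norm (u n x) - norm (v x)"] by (simp add: power2_eq_square algebra_simps)
    finally show ?thesis .
  qed
  have iw2: "integrable M (\<lambda>x. (w n x)\<^sup>2)" for n
  proof (rule Bochner_Integration.integrable_bound[of M "\<lambda>x. 2 * (norm (u n x))\<^sup>2 + 2 * (norm (v x))\<^sup>2"])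
    show "AE x in M. norm ((w n x)\<^sup>2) \<le> norm (2 * (norm (u n x))\<^sup>2 + 2 * (norm (v x))\<^sup>2)"
      using w2 by (intro AE_I2) (simp add: abs_of_nonneg)
  qed (use int iv2 in auto)
  \<comment> \<open>4 C is 2 C + 2 C, from (x + y)^2 \<le> 2 x^2 + 2 y^2 and the bound C for u and
    for v.\<close>
  have wC: "(\<integral>x. (w n x)\<^sup>2 \<partial>M) \<le> 4 * C" for n
  proof -
    have "(\<integral>x. (w n x)\<^sup>2 \<partial>M) \<le> (\<integral>x. 2 * (norm (u n x))\<^sup>2 + 2 * (norm (v x))\<^sup>2 \<partial>M)"
      using w2 iw2 int iv2 by (intro integral_mono) auto
    also have "\<dots> = 2 * (\<integral>x. (norm (u n x))\<^sup>2 \<partial>M) + 2 * (\<integral>x. (norm (v x))\<^sup>2 \<partial>M)"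
      using int iv2 by (subst Bochner_Integration.integral_add) auto
    finally show ?thesis using C[of n] vC' by simp
  qed
  have iw: "integrable M (w n)" for n unfolding w_def by (intro integrable_norm Bochner_Integration.integrable_diff iu iv)
  have imin: "integrable M (\<lambda>x. min (w n x) K)" if "K \<ge> 0" for n K
    using that by (intro integrable_const_bound[of _ K] AE_I2) (auto simp: w_def)
  have split: "(\<integral>x. w n x \<partial>M) \<le> (\<integral>x. min (w n x) K \<partial>M) + 4 * C / K" if "K > 0" for n K
  proof -
    have pt: "w n x \<le> min (w n x) K + (w n x)\<^sup>2 / K" for x
    proof (cases "w n x \<le> K")
      case False
      then have "w n x * K \<le> w n x * w n x" using that by (intro mult_left_mono) auto
      then have "w n x \<le> (w n x)\<^sup>2 / K" using that by (simp add: power2_eq_square field_simps)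
      moreover have "0 \<le> min (w n x) K" using that unfolding w_def by simp
      ultimately show ?thesis by linarith
    qed (use that in auto)
    have "(\<integral>x. w n x \<partial>M) \<le> (\<integral>x. min (w n x) K + (w n x)\<^sup>2 / K \<partial>M)"
      using pt iw imin[of K] iw2 that by (intro integral_mono) auto
    also have "\<dots> = (\<integral>x. min (w n x) K \<partial>M) + (\<integral>x. (w n x)\<^sup>2 \<partial>M) / K"
      using imin[of K] iw2 that by (subst Bochner_Integration.integral_add) auto
    also have "\<dots> \<le> (\<integral>x. min (w n x) K \<partial>M) + 4 * C / K"
      using wC that by (intro add_left_mono divide_right_mono) auto
    finally show ?thesis .
  qed
  have lmin: "(\<lambda>n. \<integral>x. min (w n x) K \<partial>M) \<longlonglongrightarrow> 0" if "K > 0" for K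
  proof -
    have "(\<lambda>n. \<integral>x. min (w n x) K \<partial>M) \<longlonglongrightarrow> (\<integral>x. 0 \<partial>M)"
    proof (rule integral_dominated_convergence[where w = "\<lambda>_. K"])
      show "AE x in M. (\<lambda>n. min (w n x) K) \<longlonglongrightarrow> 0"
        using lim
      proof eventually_elim
        fix x assume "(\<lambda>n. u n x) \<longlonglongrightarrow> v x"
        then have "(\<lambda>n. norm (u n x - v x)) \<longlonglongrightarrow> norm (v x - v x)" by (intro tendsto_intros)
        then have "(\<lambda>n. min (w n x) K) \<longlonglongrightarrow> min 0 K"
          unfolding w_def by (intro tendsto_min tendsto_const) simp
        then show "(\<lambda>n. min (w n x) K) \<longlonglongrightarrow> 0" using that by (simp add: min_def)
      qed
    qed (use that in \<open>auto simp: w_def\<close>)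
    then show ?thesis by simp
  qed
  have "(\<lambda>n. \<integral>x. w n x \<partial>M) \<longlonglongrightarrow> 0"
  proof (rule tendstoI)
    fix e :: real assume "e > 0"
    \<comment> \<open>Chosen so that 4 C / K = e C / (2 (C + 1)) < e / 2; the + 1 covers C =
      0.\<close>
    define K where "K = 8 * (C + 1) / e"
    have "K > 0" using \<open>e > 0\<close> \<open>C \<ge> 0\<close> unfolding K_def by simp
    have "4 * C / K < e / 2 + 0"
      unfolding K_def using \<open>e > 0\<close> \<open>C \<ge> 0\<close> by (simp add: field_simps)
    moreover have "eventually (\<lambda>n. (\<integral>x. min (w n x) K \<partial>M) < e / 2) sequentially"
      using order_tendstoD(2)[OF lmin[OF \<open>K > 0\<close>], of "e / 2"] \<open>e > 0\<close> by simp
    ultimately show "eventually (\<lambda>n. dist (\<integral>x. w n x \<partial>M) 0 < e) sequentially"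
    proof (elim eventually_mono)
      fix n assume "4 * C / K < e / 2 + 0" "(\<integral>x. min (w n x) K \<partial>M) < e / 2"
      then have "(\<integral>x. w n x \<partial>M) < e" using split[OF \<open>K > 0\<close>, of n] by linarith
      moreover have "(\<integral>x. w n x \<partial>M) \<ge> 0" by (rule integral_nonneg_AE) (simp add: w_def)
      ultimately show "dist (\<integral>x. w n x \<partial>M) 0 < e" by simp
    qed
  qed
  then show "(\<lambda>n. \<integral>x. norm (u n x - v x) \<partial>M) \<longlonglongrightarrow> 0" unfolding w_def .
qed

lemma integral_bounded_mult_tendsto:
  fixes g :: "'a \<Rightarrow> complex" and u :: "nat \<Rightarrow> 'a \<Rightarrow> complex"
  assumes g: "g \<in> borel_measurable M" "\<And>x. x \<in> space M \<Longrightarrow> cmod (g x) \<le> B"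
    and u: "\<And>n. integrable M (u n)" "integrable M v"
    and lim: "(\<lambda>n. \<integral>x. cmod (u n x - v x) \<partial>M) \<longlonglongrightarrow> 0"
  shows "(\<lambda>n. \<integral>x. g x * u n x \<partial>M) \<longlonglongrightarrow> (\<integral>x. g x * v x \<partial>M)"
proof -
  have ig: "integrable M (\<lambda>x. g x * w x)" if "integrable M w" for w :: "'a \<Rightarrow> complex"
  proof (rule Bochner_Integration.integrable_bound[of M "\<lambda>x. of_real B * w x"])
    show "AE x in M. cmod (g x * w x) \<le> cmod (of_real B * w x)"
    proof (rule AE_I2)
      fix x assume "x \<in> space M"
      then have "cmod (g x) \<le> \<bar>B\<bar>" using g(2)[of x] by linarith
      then show "cmod (g x * w x) \<le> cmod (of_real B * w x)"
        by (simp add: norm_mult mult_right_mono)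
    qed
  qed (use g(1) that in auto)
  have "(\<lambda>n. (\<integral>x. g x * u n x \<partial>M) - (\<integral>x. g x * v x \<partial>M)) \<longlonglongrightarrow> 0"
  proof (rule Lim_null_comparison)
    show "eventually (\<lambda>n. cmod ((\<integral>x. g x * u n x \<partial>M) - (\<integral>x. g x * v x \<partial>M)) \<le>
        B * (\<integral>x. cmod (u n x - v x) \<partial>M)) sequentially"
    proof (rule always_eventually, rule allI)
      fix n
      have id: "integrable M (\<lambda>x. cmod (u n x - v x))"
        by (intro integrable_norm Bochner_Integration.integrable_diff u)
      have "(\<integral>x. g x * u n x \<partial>M) - (\<integral>x. g x * v x \<partial>M) = (\<integral>x. g x * u n x - g x * v x \<partial>M)"
        by (intro Bochner_Integration.integral_diff[symmetric] ig u)
      also have "\<dots> = (\<integral>x. g x * (u n x - v x) \<partial>M)" by (simp add: algebra_simps)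
      also have "cmod \<dots> \<le> (\<integral>x. cmod (g x * (u n x - v x)) \<partial>M)" by (rule integral_norm_bound)
      also have "\<dots> \<le> (\<integral>x. B * cmod (u n x - v x) \<partial>M)"
      proof (rule integral_mono)
        show "integrable M (\<lambda>x. cmod (g x * (u n x - v x)))"
          by (intro integrable_norm ig Bochner_Integration.integrable_diff u)
        show "integrable M (\<lambda>x. B * cmod (u n x - v x))" using id by simp
      qed (auto simp: norm_mult intro!: mult_right_mono g(2))
      finally show "cmod ((\<integral>x. g x * u n x \<partial>M) - (\<integral>x. g x * v x \<partial>M)) \<le> B * (\<integral>x. cmod (u n x - v x) \<partial>M)"
        by simp
    qed
    show "(\<lambda>n. B * (\<integral>x. cmod (u n x - v x) \<partial>M)) \<longlonglongrightarrow> 0"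
      using tendsto_mult_left[OF lim, of B] by simp
  qed
  then show ?thesis by (simp only: LIM_zero_iff)
qed

text \<open>Cauchy-Schwarz against 1 on a probability space, read off from the variance of
  |f|.\<close>

lemma L1_le_L2_circle:
  fixes f :: "complex \<Rightarrow> complex"
  assumes "continuous_on (sphere 0 1) f"
  shows "(\<integral>z. cmod (f z) \<partial>circle_measure) \<le> sqrt (\<integral>z. (cmod (f z))\<^sup>2 \<partial>circle_measure)"
proof (rule real_le_rsqrt)
  have "0 \<le> circle.variance (\<lambda>z. cmod (f z))" by (rule circle.variance_positive)
  also have "\<dots> = (\<integral>z. (cmod (f z))\<^sup>2 \<partial>circle_measure) - (\<integral>z. cmod (f z) \<partial>circle_measure)\<^sup>2"
    by (intro circle.variance_eq integrable_circle continuous_intros assms)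
  finally show "(\<integral>z. cmod (f z) \<partial>circle_measure)\<^sup>2 \<le> (\<integral>z. (cmod (f z))\<^sup>2 \<partial>circle_measure)" by simp
qed

lemma summable_square_of_energy:
  fixes a :: "nat \<Rightarrow> complex"
  assumes "summable (\<lambda>l. real l * (cmod (a l))\<^sup>2)"
  shows "summable (\<lambda>l. (cmod (a l))\<^sup>2)"
proof (rule summable_comparison_test[OF _ assms], intro exI allI impI)
  fix l :: nat assume "1 \<le> l"
  then have "1 * (cmod (a l))\<^sup>2 \<le> real l * (cmod (a l))\<^sup>2" by (intro mult_right_mono) auto
  then show "norm ((cmod (a l))\<^sup>2) \<le> real l * (cmod (a l))\<^sup>2" by simp
qed

text \<open>A Riesz-Fischer argument. Square summability does not give absolute convergence, so h is
  found differently: by Parseval the truncations are Cauchy in L1, a subsequence converges almost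
  everywhere, and Fourier coefficients pass to L1 limits.\<close>

lemma L2_limit_of_truncations:
  fixes a :: "nat \<Rightarrow> complex"
  assumes a: "summable (\<lambda>l. (cmod (a l))\<^sup>2)"
  obtains h r where "h \<in> borel_measurable circle_measure" "integrable circle_measure h" "strict_mono r"
    "AE z in circle_measure. (\<lambda>n. poly (trunc_poly a (r n)) z) \<longlonglongrightarrow> h z"
    "(\<lambda>n. \<integral>z. cmod (poly (trunc_poly a (r n)) z - h z) \<partial>circle_measure) \<longlonglongrightarrow> 0"
    "\<And>k. (\<integral>z. cnj z ^ k * h z \<partial>circle_measure) = a k"
    "\<And>k. (\<integral>z. z ^ Suc k * h z \<partial>circle_measure) = 0"
proof -
  define p where "p n z = poly (trunc_poly a n) z" for n z
  have cont: "continuous_on (sphere 0 1) (p n)" for n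
    unfolding p_def by (intro continuous_intros)
  have pm [measurable]: "p n \<in> borel_measurable circle_measure" for n
    by (rule borel_measurable_circle[OF cont])
  have tail: "(\<integral>z. cmod (p n z - p m z) \<partial>circle_measure) \<le> sqrt (\<Sum>k. (cmod (a (k + min m n)))\<^sup>2)" for m n
  proof -
    define q where "q = trunc_poly a n - trunc_poly a m"
    have "(\<lambda>k. (cmod (coeff q k))\<^sup>2) sums (\<integral>z. (cmod (poly q z))\<^sup>2 \<partial>circle_measure)"
      unfolding poly_eq_pser by (rule pser_parseval[OF summable_coeff])
    then have "(\<integral>z. (cmod (poly q z))\<^sup>2 \<partial>circle_measure) = (\<Sum>k. (cmod (coeff q (k + min m n)))\<^sup>2)"
    proof (subst suminf_minus_initial_segment)
      \<comment> \<open>Both truncations agree below \<open>min m n\<close>, so only the tail of the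
        difference contributes.\<close>
      have "(\<Sum>i<min m n. (cmod (coeff q i))\<^sup>2) = 0" unfolding q_def by simp
      then show "(\<lambda>k. (cmod (coeff q k))\<^sup>2) sums (\<integral>z. (cmod (poly q z))\<^sup>2 \<partial>circle_measure) \<Longrightarrow>
          (\<integral>z. (cmod (poly q z))\<^sup>2 \<partial>circle_measure) =
          (\<Sum>i. (cmod (coeff q i))\<^sup>2) - (\<Sum>i<min m n. (cmod (coeff q i))\<^sup>2)"
        by (simp add: sums_iff)
    qed (auto simp: sums_iff)
    also have "\<dots> \<le> (\<Sum>k. (cmod (a (k + min m n)))\<^sup>2)"
    proof (rule suminf_le)
      show "(cmod (coeff q (k + min m n)))\<^sup>2 \<le> (cmod (a (k + min m n)))\<^sup>2" for k
        unfolding q_def by auto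
      show sa: "summable (\<lambda>k. (cmod (a (k + min m n)))\<^sup>2)" by (rule summable_ignore_initial_segment[OF a])
      show "summable (\<lambda>k. (cmod (coeff q (k + min m n)))\<^sup>2)"
        by (rule summable_comparison_test[OF _ sa]) (auto simp: q_def intro!: exI[of _ 0])
    qed
    finally have "(\<integral>z. (cmod (poly q z))\<^sup>2 \<partial>circle_measure) \<le> (\<Sum>k. (cmod (a (k + min m n)))\<^sup>2)" .
    moreover have "(\<integral>z. cmod (poly q z) \<partial>circle_measure) \<le> sqrt (\<integral>z. (cmod (poly q z))\<^sup>2 \<partial>circle_measure)"
      by (intro L1_le_L2_circle continuous_intros)
    ultimately have "(\<integral>z. cmod (poly q z) \<partial>circle_measure) \<le> sqrt (\<Sum>k. (cmod (a (k + min m n)))\<^sup>2)"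
      by (meson order_trans real_sqrt_le_mono)
    then show ?thesis unfolding q_def p_def by simp
  qed
  have tail0: "(\<lambda>m. sqrt (\<Sum>k. (cmod (a (k + m)))\<^sup>2)) \<longlonglongrightarrow> 0"
  proof -
    have "(\<lambda>m. sqrt (\<Sum>k. (cmod (a (k + m)))\<^sup>2)) \<longlonglongrightarrow> sqrt 0"
      by (intro tendsto_intros suminf_exist_split2 a)
    then show ?thesis by simp
  qed
  obtain r where r: "strict_mono r" "AE z in circle_measure. Cauchy (\<lambda>i. p (r i) z)"
  proof (rule cauchy_L1_AE_cauchy_subseq[of circle_measure p])
    show "integrable circle_measure (p n)" for n by (rule integrable_circle[OF cont])
    fix e :: real assume "e > 0"
    then obtain N where N: "\<And>m. m \<ge> N \<Longrightarrow> sqrt (\<Sum>k. (cmod (a (k + m)))\<^sup>2) < e"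
      using order_tendstoD(2)[OF tail0, of e] by (auto simp: eventually_sequentially)
    show "\<exists>N. \<forall>i\<ge>N. \<forall>j\<ge>N. (LINT x|circle_measure. norm (p i x - p j x)) < e"
    proof (intro exI[of _ N] allI impI)
      fix i j assume "N \<le> i" "N \<le> j"
      then show "(LINT x|circle_measure. norm (p i x - p j x)) < e"
        using le_less_trans[OF tail[of i j] N[of "min j i"]] by simp
    qed
  qed (rule that)
  \<comment> \<open>Off a null set the limit exists; elsewhere \<open>lim\<close> has an unspecified
    value, which the almost everywhere statements ignore.\<close>
  define h where "h z = lim (\<lambda>i. p (r i) z)" for z
  have hm [measurable]: "h \<in> borel_measurable circle_measure"
    unfolding h_def by (intro borel_measurable_lim_metric) measurable
  have lim: "AE z in circle_measure. (\<lambda>i. p (r i) z) \<longlonglongrightarrow> h z"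
    using r(2) by eventually_elim (simp add: h_def Cauchy_convergent_iff convergent_LIMSEQ_iff)
  have i2: "integrable circle_measure (\<lambda>z. (cmod (p (r n) z))\<^sup>2)" for n
    by (intro integrable_circle continuous_intros cont)
  have C: "(\<integral>z. (cmod (p (r n) z))\<^sup>2 \<partial>circle_measure) \<le> (\<Sum>k. (cmod (a k))\<^sup>2)" for n
  proof -
    have s: "(\<lambda>k. (cmod (coeff (trunc_poly a (r n)) k))\<^sup>2) sums (\<integral>z. (cmod (p (r n) z))\<^sup>2 \<partial>circle_measure)"
      unfolding p_def poly_eq_pser by (rule pser_parseval[OF summable_coeff])
    show ?thesis
      by (rule sums_le[OF _ s summable_sums[OF a]]) simp
  qed
  note conv = circle.L2_bounded_convergence[of "\<lambda>n. p (r n)" h, OF _ _ lim i2 C]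
  have ih: "integrable circle_measure h" by (rule conv(1)) measurable
  have l1: "(\<lambda>n. \<integral>z. cmod (p (r n) z - h z) \<partial>circle_measure) \<longlonglongrightarrow> 0" by (rule conv(2)) measurable
  have ip: "integrable circle_measure (p (r n))" for n by (rule integrable_circle[OF cont])
  have coef: "(\<lambda>n. \<integral>z. g z * p (r n) z \<partial>circle_measure) \<longlonglongrightarrow> (\<integral>z. g z * h z \<partial>circle_measure)"
    if "continuous_on (sphere 0 1) g" "\<And>z. z \<in> sphere 0 1 \<Longrightarrow> cmod (g z) \<le> 1" for g
    using that borel_measurable_circle[OF that(1)] by (intro integral_bounded_mult_tendsto[OF _ _ ip ih l1]) auto
  have c1: "(\<integral>z. cnj z ^ k * h z \<partial>circle_measure) = a k" for k
  proof -
    have "(\<lambda>n. \<integral>z. cnj z ^ k * p (r n) z \<partial>circle_measure) \<longlonglongrightarrow> (\<integral>z. cnj z ^ k * h z \<partial>circle_measure)"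
      by (intro coef continuous_intros) (simp add: norm_power)
    moreover have "(\<lambda>n. \<integral>z. cnj z ^ k * p (r n) z \<partial>circle_measure) \<longlonglongrightarrow> a k"
    proof (rule tendsto_eventually)
      have "eventually (\<lambda>n. k < r n) sequentially"
        using seq_suble[OF r(1)] by (intro eventually_sequentiallyI[of "Suc k"]) (meson Suc_le_lessD order_trans)
      then show "eventually (\<lambda>n. (\<integral>z. cnj z ^ k * p (r n) z \<partial>circle_measure) = a k) sequentially"
        by eventually_elim (simp add: p_def poly_eq_pser pser_coeff[OF summable_coeff])
    qed
    ultimately show ?thesis by (rule LIMSEQ_unique)
  qed
  have c2: "(\<integral>z. z ^ Suc k * h z \<partial>circle_measure) = 0" for k
  proof -
    have "(\<lambda>n. \<integral>z. z ^ Suc k * p (r n) z \<partial>circle_measure) \<longlonglongrightarrow> (\<integral>z. z ^ Suc k * h z \<partial>circle_measure)"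
      by (intro coef continuous_intros) (simp add: norm_mult norm_power)
    moreover have "(\<integral>z. z ^ Suc k * p (r n) z \<partial>circle_measure) = 0" for n
      unfolding p_def poly_eq_pser by (rule pser_neg_coeff[OF summable_coeff])
    ultimately show ?thesis by (simp only: LIMSEQ_const_iff)
  qed
  show ?thesis
    by (rule that[OF hm ih r(1) lim[unfolded p_def] l1[unfolded p_def] c1 c2])
qed

text \<open>The inequality x \<le> - ln (1 - x) always holds here, and - ln (1 - x) \<le> 2 x holds
  for x \<le> 1/2. The latter range is reached eventually, because n x_n tends to 0 when its series
  converges.\<close>

lemma summable_weighted_log_iff:
  fixes x :: "nat \<Rightarrow> real"
  assumes x: "\<And>n. 0 \<le> x n" "\<And>n. x n < 1"
  shows "summable (\<lambda>n. real n * x n) \<longleftrightarrow> summable (\<lambda>n. - real (Suc n) * ln (1 - x n))"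
proof
  assume s: "summable (\<lambda>n. real n * x n)"
  from summable_LIMSEQ_zero[OF s] have "eventually (\<lambda>n. real n * x n < 1 / 2) sequentially"
    by (rule order_tendstoD) simp
  then obtain N where N: "\<And>n. n \<ge> N \<Longrightarrow> real n * x n < 1 / 2"
    by (auto simp: eventually_sequentially)
  show "summable (\<lambda>n. - real (Suc n) * ln (1 - x n))"
  proof (rule summable_comparison_test[OF _ summable_mult[OF s, of 4]], intro exI allI impI)
    \<comment> \<open>From 1 on, x_n \<le> n x_n and n + 1 \<le> 2 n; the constant 4 combines this 2
      with the 2 from the logarithm.\<close>
    fix n assume n: "max N 1 \<le> n"
    have "1 * x n \<le> real n * x n" using n x(1) by (intro mult_right_mono) auto
    then have half: "x n \<le> 1 / 2" using N[of n] n by auto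
    have "- x n - 2 * (x n)\<^sup>2 \<le> ln (1 - x n)"
      using ln_one_minus_pos_lower_bound[OF x(1) half] .
    moreover have "2 * (x n)\<^sup>2 \<le> x n"
      using mult_mono[OF half order_refl, of "x n"] x(1) by (simp add: power2_eq_square)
    ultimately have l: "- ln (1 - x n) \<le> 2 * x n" by linarith
    have "0 \<le> - ln (1 - x n)" using x[of n] by simp
    then have "norm (- real (Suc n) * ln (1 - x n)) = real (Suc n) * - ln (1 - x n)"
      by (simp add: abs_mult)
    also have "\<dots> \<le> (2 * real n) * (2 * x n)"
      using l n \<open>0 \<le> - ln (1 - x n)\<close> by (intro mult_mono) auto
    finally show "norm (- real (Suc n) * ln (1 - x n)) \<le> 4 * (real n * x n)" by simp
  qed
next
  assume s: "summable (\<lambda>n. - real (Suc n) * ln (1 - x n))"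
  show "summable (\<lambda>n. real n * x n)"
  proof (rule summable_comparison_test[OF _ s], intro exI allI impI)
    fix n :: nat
    have "x n \<le> - ln (1 - x n)" using ln_le_minus_one[of "1 - x n"] x(2)[of n] by simp
    then have "real n * x n \<le> real (Suc n) * - ln (1 - x n)"
      using x(1)[of n] by (intro mult_mono) auto
    then show "norm (real n * x n) \<le> - real (Suc n) * ln (1 - x n)"
      using x(1)[of n] by (simp del: of_nat_Suc)
  qed
qed

text \<open>The square of exp (2 Re f) is |exp (2 f)|^2, and doubling f multiplies its energy by
  4.\<close>

lemma integral_exp_le_of_energy:
  assumes a: "summable (\<lambda>k. cmod (a k))" "a 0 = 0" and S: "\<And>K. (\<Sum>l\<le>K. real l * (cmod (a l))\<^sup>2) \<le> S"
  shows "(\<integral>z. (cmod (complex_of_real (exp (2 * Re (pser a z)))))\<^sup>2 \<partial>circle_measure) \<le> exp (4 * S)"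
proof -
  have p2: "pser (\<lambda>k. 2 * a k) z = 2 * pser a z" if "cmod z \<le> 1" for z
    unfolding pser_def using suminf_mult[OF summable_pser(2)[OF a(1) that], of 2] by (simp add: mult.assoc)
  have "(\<integral>z. (cmod (complex_of_real (exp (2 * Re (pser a z)))))\<^sup>2 \<partial>circle_measure) =
      (\<integral>z. (cmod (exp (pser (\<lambda>k. 2 * a k) z)))\<^sup>2 \<partial>circle_measure)"
    by (intro Bochner_Integration.integral_cong refl) (simp add: p2 norm_exp_eq_Re)
  also have "\<dots> \<le> exp (4 * S)"
  proof (rule lebedev_milin)
    show "summable (\<lambda>k. cmod (2 * a k))" using summable_mult[OF a(1), of 2] by (simp add: norm_mult)
    show "(\<Sum>l\<le>K. real l * (cmod (2 * a l))\<^sup>2) \<le> 4 * S" for K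
    proof -
      have "(\<Sum>l\<le>K. real l * (cmod (2 * a l))\<^sup>2) = 4 * (\<Sum>l\<le>K. real l * (cmod (a l))\<^sup>2)"
        unfolding sum_distrib_left by (intro sum.cong refl) (simp add: norm_mult power_mult_distrib)
      then show ?thesis using S[of K] by simp
    qed
  qed (use a in simp)
  finally show ?thesis .
qed

text \<open>The energy bound stands in for a dominating function: it bounds the weights in L2, and
  almost everywhere convergence becomes convergence in L1.\<close>

lemma exp_convergence_of_energy:
  fixes A :: "nat \<Rightarrow> nat \<Rightarrow> complex"
  assumes A: "\<And>i. summable (\<lambda>l. cmod (A i l))" "\<And>i. A i 0 = 0"
    and S: "\<And>i K. (\<Sum>l\<le>K. real l * (cmod (A i l))\<^sup>2) \<le> S"
    and v: "v \<in> borel_measurable circle_measure"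
      "AE z in circle_measure. (\<lambda>i. complex_of_real (exp (2 * Re (pser (A i) z)))) \<longlonglongrightarrow> v z"
  shows "integrable circle_measure v"
    and "(\<lambda>i. \<integral>z. z ^ k * complex_of_real (exp (2 * Re (pser (A i) z))) \<partial>circle_measure) \<longlonglongrightarrow>
      (\<integral>z. z ^ k * v z \<partial>circle_measure)"
proof -
  define u where "u i z = complex_of_real (exp (2 * Re (pser (A i) z)))" for i z
  have cu: "continuous_on (sphere 0 1) (u i)" for i
    unfolding u_def by (intro continuous_intros continuous_on_pser_circle A)
  have um: "u i \<in> borel_measurable circle_measure" for i by (rule borel_measurable_circle[OF cu])
  have iu2: "integrable circle_measure (\<lambda>z. (norm (u i z))\<^sup>2)" for i
    by (intro integrable_circle continuous_intros cu)
  have u2: "(\<integral>z. (norm (u i z))\<^sup>2 \<partial>circle_measure) \<le> exp (4 * S)" for i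
    unfolding u_def by (rule integral_exp_le_of_energy[OF A S])
  note conv = circle.L2_bounded_convergence[of u v, OF um v(1) v(2)[folded u_def] iu2 u2]
  show "integrable circle_measure v" by (rule conv(1))
  have "(\<lambda>i. \<integral>z. z ^ k * u i z \<partial>circle_measure) \<longlonglongrightarrow> (\<integral>z. z ^ k * v z \<partial>circle_measure)"
  proof (rule integral_bounded_mult_tendsto[where B = 1])
    show "integrable circle_measure (u i)" for i by (rule integrable_circle[OF cu])
    show "integrable circle_measure v" by (rule conv(1))
    show "(\<lambda>i. \<integral>z. cmod (u i z - v z) \<partial>circle_measure) \<longlonglongrightarrow> 0" by (rule conv(2))
  qed (auto simp: norm_power)
  then show "(\<lambda>i. \<integral>z. z ^ k * complex_of_real (exp (2 * Re (pser (A i) z))) \<partial>circle_measure) \<longlonglongrightarrow>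
      (\<integral>z. z ^ k * v z \<partial>circle_measure)" unfolding u_def .
qed

lemma pser_diff:
  assumes "summable (\<lambda>k. cmod (a k))" "summable (\<lambda>k. cmod (b k))" "cmod z \<le> 1"
  shows "pser a z - pser b z = pser (\<lambda>k. a k - b k) z"
  unfolding pser_def using suminf_diff[OF summable_pser(2)[OF assms(1,3)] summable_pser(2)[OF assms(2,3)]]
  by (simp add: algebra_simps)

text \<open>Below N the coefficients are compared one by one; from N on the polynomial has none, and
  |A_l|^2 \<le> l |A_l|^2 / N. A common energy bound thus makes the tails of a whole family
  uniformly small.\<close>

lemma L2_distance_truncation:
  assumes A: "summable (\<lambda>k. cmod (A k))" and N: "N > 0"
    and S: "\<And>K. (\<Sum>l\<le>K. real l * (cmod (A l))\<^sup>2) \<le> S"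
  shows "(\<integral>z. cmod (pser A z - poly (trunc_poly a N) z) \<partial>circle_measure) \<le>
    sqrt ((\<Sum>l<N. (cmod (A l - a l))\<^sup>2) + S / N)"
proof -
  define d where "d l = A l - coeff (trunc_poly a N) l" for l
  have sd: "summable (\<lambda>l. cmod (d l))"
    unfolding d_def
    by (rule summable_comparison_test[OF _ summable_add[OF A summable_coeff[of "trunc_poly a N"]]])
       (auto intro!: exI[of _ 0] norm_triangle_ineq4)
  have eq: "pser A z - poly (trunc_poly a N) z = pser d z" if "cmod z \<le> 1" for z
    unfolding poly_eq_pser d_def by (rule pser_diff[OF A summable_coeff that])
  have s: "(\<lambda>l. (cmod (d l))\<^sup>2) sums (\<integral>z. (cmod (pser d z))\<^sup>2 \<partial>circle_measure)"
    by (rule pser_parseval[OF sd])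
  have "(\<integral>z. (cmod (pser d z))\<^sup>2 \<partial>circle_measure) \<le> (\<Sum>l<N. (cmod (A l - a l))\<^sup>2) + S / N"
  proof (rule LIMSEQ_le_const2)
    show "(\<lambda>K. \<Sum>l<K. (cmod (d l))\<^sup>2) \<longlonglongrightarrow> (\<integral>z. (cmod (pser d z))\<^sup>2 \<partial>circle_measure)"
      using s by (simp add: sums_def)
    have "(\<Sum>l<K. (cmod (d l))\<^sup>2) \<le> (\<Sum>l<N. (cmod (A l - a l))\<^sup>2) + S / N" if "K \<ge> N" for K
    proof -
      have "(\<Sum>l<K. (cmod (d l))\<^sup>2) = (\<Sum>l<N. (cmod (d l))\<^sup>2) + (\<Sum>l\<in>{N..<K}. (cmod (d l))\<^sup>2)"
        using that by (simp add: atLeast0LessThan[symmetric] sum.atLeastLessThan_concat)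
      also have "(\<Sum>l<N. (cmod (d l))\<^sup>2) = (\<Sum>l<N. (cmod (A l - a l))\<^sup>2)" unfolding d_def by simp
      also have "(\<Sum>l\<in>{N..<K}. (cmod (d l))\<^sup>2) \<le> (\<Sum>l\<in>{N..<K}. real l * (cmod (A l))\<^sup>2 / N)"
      proof (rule sum_mono)
        fix l assume l: "l \<in> {N..<K}"
        then have "real N * (cmod (A l))\<^sup>2 \<le> real l * (cmod (A l))\<^sup>2" by (intro mult_right_mono) auto
        then show "(cmod (d l))\<^sup>2 \<le> real l * (cmod (A l))\<^sup>2 / N"
          using l N unfolding d_def by (simp add: field_simps)
      qed
      also have "\<dots> = (\<Sum>l\<in>{N..<K}. real l * (cmod (A l))\<^sup>2) / N" by (simp add: sum_divide_distrib)
      also have "\<dots> \<le> (\<Sum>l\<le>K. real l * (cmod (A l))\<^sup>2) / N"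
        using N by (intro divide_right_mono sum_mono2) auto
      also have "\<dots> \<le> S / N" using S N by (intro divide_right_mono) auto
      finally show ?thesis by simp
    qed
    then show "\<exists>M. \<forall>K\<ge>M. (\<Sum>l<K. (cmod (d l))\<^sup>2) \<le> (\<Sum>l<N. (cmod (A l - a l))\<^sup>2) + S / N" by blast
  qed
  then have "sqrt (\<integral>z. (cmod (pser d z))\<^sup>2 \<partial>circle_measure) \<le> sqrt ((\<Sum>l<N. (cmod (A l - a l))\<^sup>2) + S / N)"
    by simp
  moreover have "(\<integral>z. cmod (pser d z) \<partial>circle_measure) \<le> sqrt (\<integral>z. (cmod (pser d z))\<^sup>2 \<partial>circle_measure)"
    by (rule L1_le_L2_circle[OF continuous_on_pser_circle[OF sd]])
  moreover have "(\<integral>z. cmod (pser A z - poly (trunc_poly a N) z) \<partial>circle_measure) = (\<integral>z. cmod (pser d z) \<partial>circle_measure)"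
    using eq by (intro Bochner_Integration.integral_cong) auto
  ultimately show ?thesis by linarith
qed

lemma energy_partial_sums_limit:
  assumes lim: "\<And>l. (\<lambda>n. A n l) \<longlonglongrightarrow> a l" and S: "\<And>n K. (\<Sum>l\<le>K. real l * (cmod (A n l))\<^sup>2) \<le> S"
  shows "(\<Sum>l\<le>K. real l * (cmod (a l))\<^sup>2) \<le> S"
proof (rule LIMSEQ_le_const2)
  show "(\<lambda>n. \<Sum>l\<le>K. real l * (cmod (A n l))\<^sup>2) \<longlonglongrightarrow> (\<Sum>l\<le>K. real l * (cmod (a l))\<^sup>2)"
    by (intro tendsto_intros lim)
qed (use S in blast)

lemma summable_of_bounded_energy:
  assumes "\<And>K. (\<Sum>l\<le>K. real l * (cmod (a l))\<^sup>2) \<le> S"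
  shows "summable (\<lambda>l. real l * (cmod (a l))\<^sup>2)"
proof (rule summableI_nonneg_bounded)
  show "(\<Sum>l<n. real l * (cmod (a l))\<^sup>2) \<le> S" for n
    by (rule order_trans[OF sum_mono2 assms[of n]]) auto
qed auto

text \<open>A diagonal subsequence converges coefficientwise to some a. It converges in L1 to the
  function h of a, because for each N the first N coefficients converge and the rest costs at most S
  / N, uniformly. A further subsequence then converges almost everywhere.\<close>

lemma energy_compactness:
  fixes A :: "nat \<Rightarrow> nat \<Rightarrow> complex"
  assumes A: "\<And>n. summable (\<lambda>k. cmod (A n k))" "\<And>n. A n 0 = 0"
    and S: "\<And>n K. (\<Sum>l\<le>K. real l * (cmod (A n l))\<^sup>2) \<le> S"
  obtains a h s where "a 0 = 0" "\<And>K. (\<Sum>l\<le>K. real l * (cmod (a l))\<^sup>2) \<le> S"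
    "h \<in> borel_measurable circle_measure" "integrable circle_measure h" "strict_mono s"
    "AE z in circle_measure. (\<lambda>n. pser (A (s n)) z) \<longlonglongrightarrow> h z"
    "\<And>k. (\<integral>z. cnj z ^ k * h z \<partial>circle_measure) = a k"
    "\<And>k. (\<integral>z. z ^ Suc k * h z \<partial>circle_measure) = 0"
proof -
  \<comment> \<open>The diagonal argument asks for bounded coefficients; x \<le> x^2 + 1 passes from
    the squares to the moduli.\<close>
  have bound: "cmod (A n l) \<le> S + 1" for n l
  proof (cases "l = 0")
    case True
    then show ?thesis using A(2) S[of n 0] by simp
  next
    case False
    then have "1 * (cmod (A n l))\<^sup>2 \<le> real l * (cmod (A n l))\<^sup>2" by (intro mult_right_mono) auto
    also have "\<dots> \<le> (\<Sum>l\<le>l. real l * (cmod (A n l))\<^sup>2)" by (rule member_le_sum) auto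
    also have "\<dots> \<le> S" by (rule S)
    finally have "(cmod (A n l))\<^sup>2 \<le> S" by simp
    moreover have "cmod (A n l) \<le> (cmod (A n l))\<^sup>2 + 1"
      using zero_le_power2[of "cmod (A n l) - 1 / 2"] by (simp add: power2_eq_square algebra_simps)
    ultimately show ?thesis by linarith
  qed
  obtain k where k: "strict_mono k" "\<And>l. \<exists>c. (\<lambda>n. A (k n) l) \<longlonglongrightarrow> c"
    using function_convergent_subsequence[of "UNIV :: nat set" A "S + 1"] bound by (metis UNIV_I uncountable_def countableI_type)
  then obtain a where a: "\<And>l. (\<lambda>n. A (k n) l) \<longlonglongrightarrow> a l" by metis
  have a0: "a 0 = 0" using a[of 0] A(2) by (simp add: LIMSEQ_const_iff)
  have aS: "(\<Sum>l\<le>K. real l * (cmod (a l))\<^sup>2) \<le> S" for K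
    by (rule energy_partial_sums_limit[of "\<lambda>n. A (k n)", OF a S])
  have a2: "summable (\<lambda>l. (cmod (a l))\<^sup>2)"
    by (rule summable_square_of_energy[OF summable_of_bounded_energy[OF aS]])
  obtain h r where h: "h \<in> borel_measurable circle_measure" "integrable circle_measure h" "strict_mono r"
    "AE z in circle_measure. (\<lambda>n. poly (trunc_poly a (r n)) z) \<longlonglongrightarrow> h z"
    "(\<lambda>n. \<integral>z. cmod (poly (trunc_poly a (r n)) z - h z) \<partial>circle_measure) \<longlonglongrightarrow> 0"
    "\<And>k. (\<integral>z. cnj z ^ k * h z \<partial>circle_measure) = a k"
    "\<And>k. (\<integral>z. z ^ Suc k * h z \<partial>circle_measure) = 0"
    by (rule L2_limit_of_truncations[OF a2]) (rule that)
  have ci: "integrable circle_measure (pser (A n))" for n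
    by (rule integrable_circle[OF continuous_on_pser_circle[OF A(1)]])
  have ti: "integrable circle_measure (\<lambda>z. poly (trunc_poly a N) z)" for N
    by (intro integrable_circle continuous_intros)
  have l1: "(\<lambda>n. \<integral>z. cmod (pser (A (k n)) z - h z) \<partial>circle_measure) \<longlonglongrightarrow> 0"
  proof (rule tendstoI)
    fix e :: real assume e: "e > 0"
    have "(\<lambda>i. S / real (r i)) \<longlonglongrightarrow> 0"
      by (intro real_tendsto_divide_at_top[OF tendsto_const]
          filterlim_compose[OF filterlim_real_sequentially filterlim_subseq[OF h(3)]])
    \<comment> \<open>The threshold is squared because the truncation estimate carries a root. The
      cutoff \<open>r i\<close> is fixed before n grows.\<close>
    then have "eventually (\<lambda>i. S / real (r i) < (e / 2)\<^sup>2) sequentially"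
      by (rule order_tendstoD) (use e in simp)
    moreover have "eventually (\<lambda>i. (\<integral>z. cmod (poly (trunc_poly a (r i)) z - h z) \<partial>circle_measure) < e / 2) sequentially"
      by (rule order_tendstoD(2)[OF h(5)]) (use e in simp)
    moreover have "eventually (\<lambda>i. 0 < r i) sequentially"
      using seq_suble[OF h(3)] by (intro eventually_sequentiallyI[of 1]) (meson less_le_trans less_numeral_extra(1))
    ultimately have "eventually (\<lambda>i. S / real (r i) < (e / 2)\<^sup>2 \<and>
        (\<integral>z. cmod (poly (trunc_poly a (r i)) z - h z) \<partial>circle_measure) < e / 2 \<and> 0 < r i) sequentially"
      by eventually_elim simp
    then obtain i where "S / real (r i) < (e / 2)\<^sup>2 \<and>
        (\<integral>z. cmod (poly (trunc_poly a (r i)) z - h z) \<partial>circle_measure) < e / 2 \<and> 0 < r i"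
      using eventually_happens' sequentially_bot by blast
    then have i: "S / real (r i) < (e / 2)\<^sup>2"
        "(\<integral>z. cmod (poly (trunc_poly a (r i)) z - h z) \<partial>circle_measure) < e / 2" "0 < r i"
      by auto
    have "(\<lambda>n. (\<Sum>l<r i. (cmod (A (k n) l - a l))\<^sup>2) + S / real (r i)) \<longlonglongrightarrow>
        (\<Sum>l<r i. (cmod (a l - a l))\<^sup>2) + S / real (r i)"
      by (intro tendsto_intros a)
    then have "eventually (\<lambda>n. (\<Sum>l<r i. (cmod (A (k n) l - a l))\<^sup>2) + S / real (r i) < (e / 2)\<^sup>2) sequentially"
      by (rule order_tendstoD) (use i in simp)
    then show "eventually (\<lambda>n. dist (\<integral>z. cmod (pser (A (k n)) z - h z) \<partial>circle_measure) 0 < e) sequentially"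
    proof eventually_elim
      fix n assume n: "(\<Sum>l<r i. (cmod (A (k n) l - a l))\<^sup>2) + S / real (r i) < (e / 2)\<^sup>2"
      have "(\<integral>z. cmod (pser (A (k n)) z - h z) \<partial>circle_measure) \<le>
          (\<integral>z. cmod (pser (A (k n)) z - poly (trunc_poly a (r i)) z) + cmod (poly (trunc_poly a (r i)) z - h z) \<partial>circle_measure)"
      proof (rule integral_mono)
        show "cmod (pser (A (k n)) z - h z) \<le>
          cmod (pser (A (k n)) z - poly (trunc_poly a (r i)) z) + cmod (poly (trunc_poly a (r i)) z - h z)" for z
          using norm_triangle_ineq[of "pser (A (k n)) z - poly (trunc_poly a (r i)) z" "poly (trunc_poly a (r i)) z - h z"] by simp
      qed (intro Bochner_Integration.integrable_add integrable_norm Bochner_Integration.integrable_diff ci ti h(2))+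
      also have "\<dots> = (\<integral>z. cmod (pser (A (k n)) z - poly (trunc_poly a (r i)) z) \<partial>circle_measure)
          + (\<integral>z. cmod (poly (trunc_poly a (r i)) z - h z) \<partial>circle_measure)"
        by (intro Bochner_Integration.integral_add integrable_norm Bochner_Integration.integrable_diff ci ti h(2))
      also have "(\<integral>z. cmod (pser (A (k n)) z - poly (trunc_poly a (r i)) z) \<partial>circle_measure) \<le>
          sqrt ((\<Sum>l<r i. (cmod (A (k n) l - a l))\<^sup>2) + S / real (r i))"
        by (rule L2_distance_truncation[OF A(1) i(3) S])
      also have "\<dots> < e / 2" using n e by (intro real_less_lsqrt) auto
      also note i(2)
      finally have "(\<integral>z. cmod (pser (A (k n)) z - h z) \<partial>circle_measure) < e" by simp
      moreover have "0 \<le> (\<integral>z. cmod (pser (A (k n)) z - h z) \<partial>circle_measure)" by simp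
      ultimately show "dist (\<integral>z. cmod (pser (A (k n)) z - h z) \<partial>circle_measure) 0 < e" by simp
    qed
  qed
  obtain t where t: "strict_mono t" "AE z in circle_measure. (\<lambda>n. pser (A (k (t n))) z - h z) \<longlonglongrightarrow> 0"
    using tendsto_L1_AE_subseq[of circle_measure "\<lambda>n z. pser (A (k n)) z - h z", OF _ l1] ci h(2) by auto
  have "AE z in circle_measure. (\<lambda>n. pser (A ((k \<circ> t) n)) z) \<longlonglongrightarrow> h z"
    using t(2) by eventually_elim (simp add: LIM_zero_iff)
  then show ?thesis
    by (rule that[OF a0 aS h(1,2) strict_mono_o[OF k(1) t(1)] _ h(6,7)])
qed

text \<open>h has nonnegative frequencies only and its conjugate nonpositive ones, so for k > 0 only
  h contributes, while both contribute at k = 0.\<close>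

lemma fourier_coeff_2Re:
  assumes h: "integrable circle_measure h"
    and c: "\<And>k. (\<integral>z. cnj z ^ k * h z \<partial>circle_measure) = a k"
      "\<And>k. (\<integral>z. z ^ Suc k * h z \<partial>circle_measure) = 0"
  shows "(\<integral>z. cnj z ^ k * of_real (x + 2 * Re (h z)) \<partial>circle_measure) =
    (if k = 0 then of_real x + 2 * of_real (Re (a 0)) else a k)"
proof -
  have [measurable]: "h \<in> borel_measurable circle_measure" using h by (rule borel_measurable_integrable)
  have i1: "integrable circle_measure (\<lambda>z. cnj z ^ k * of_real x)"
    by (intro integrable_circle continuous_intros)
  have pm: "(\<lambda>z. cnj z ^ k) \<in> borel_measurable circle_measure"
    by (intro borel_measurable_circle continuous_intros)
  have i2: "integrable circle_measure (\<lambda>z. cnj z ^ k * h z)"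
    by (rule Bochner_Integration.integrable_bound[OF h])
       (use pm in \<open>auto intro!: AE_I2 simp: norm_mult norm_power\<close>)
  have "integrable circle_measure (\<lambda>z. z ^ k * h z)"
    by (rule Bochner_Integration.integrable_bound[OF h])
       (use borel_measurable_circle_power[of k] in \<open>auto intro!: AE_I2 simp: norm_mult norm_power\<close>)
  then have i3: "integrable circle_measure (\<lambda>z. cnj (z ^ k * h z))"
    by (rule integrable_bounded_linear[OF bounded_linear_cnj])
  have "(\<integral>z. cnj z ^ k * of_real (x + 2 * Re (h z)) \<partial>circle_measure) =
      (\<integral>z. cnj z ^ k * of_real x + (cnj z ^ k * h z + cnj (z ^ k * h z)) \<partial>circle_measure)"
  proof (intro Bochner_Integration.integral_cong refl)
    fix z
    have "complex_of_real (x + 2 * Re (h z)) = of_real x + (h z + cnj (h z))"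
      unfolding complex_add_cnj by simp
    then show "cnj z ^ k * of_real (x + 2 * Re (h z)) = cnj z ^ k * of_real x + (cnj z ^ k * h z + cnj (z ^ k * h z))"
      by (simp add: algebra_simps)
  qed
  also have "\<dots> = (\<integral>z. cnj z ^ k * of_real x \<partial>circle_measure) + ((\<integral>z. cnj z ^ k * h z \<partial>circle_measure) + (\<integral>z. cnj (z ^ k * h z) \<partial>circle_measure))"
    by (simp only: Bochner_Integration.integral_add Bochner_Integration.integrable_add i1 i2 i3)
  also have "(\<integral>z. cnj (z ^ k * h z) \<partial>circle_measure) = cnj (\<integral>z. z ^ k * h z \<partial>circle_measure)"
    by (rule Bochner_Integration.integral_cnj)
  also have "(\<integral>z. cnj z ^ k * of_real x \<partial>circle_measure) = of_real x * (\<integral>z. cnj z ^ k \<partial>circle_measure)"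
    by simp
  finally have e: "(\<integral>z. cnj z ^ k * of_real (x + 2 * Re (h z)) \<partial>circle_measure) =
      of_real x * (\<integral>z. cnj z ^ k \<partial>circle_measure) + (a k + cnj (\<integral>z. z ^ k * h z \<partial>circle_measure))"
    unfolding c(1) .
  show ?thesis
  proof (cases k)
    case 0
    have "(\<integral>z. h z \<partial>circle_measure) = a 0" using c(1)[of 0] by simp
    moreover have "a 0 + cnj (a 0) = 2 * of_real (Re (a 0))" unfolding complex_add_cnj by simp
    ultimately show ?thesis using e 0 by (simp add: circle.prob_space)
  next
    case (Suc m)
    then show ?thesis using e c(2)[of m] integral_circle_cnj_power[of m] by simp
  qed
qed

subsection \<open>From the Verblunsky coefficients to the density\<close>

lemma circle_weight_prob_mass:
  assumes "prob_space M"
  shows "(\<integral>z. (1::complex) \<partial>M) = 1"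
  using prob_space.prob_space[OF assms] by simp

text \<open>The Bernstein-Szego weight built from \<Phi>_n has \<Phi>_n as its own orthogonal
  polynomial. The inverse recursion then gives it the same first n coefficients as M, hence the same
  moments up to n, apart from a scalar. The product is that scalar because \<Phi>_n has norm 1 for
  the weight.\<close>

lemma bernstein_szego_moments:
  fixes M :: "complex measure"
  assumes cw: "circle_weight M" and "prob_space M" and "k \<le> n"
  defines "\<alpha> \<equiv> verblunsky M"
  shows "(\<integral>z. z ^ k \<partial>M) = of_real (\<Prod>j<n. 1 - (cmod (\<alpha> j))\<^sup>2) *
    (\<integral>z. z ^ k * of_real (1 / (cmod (poly (szego \<alpha> n) z))\<^sup>2) \<partial>circle_measure)"
proof -
  interpret circle_weight M by fact
  have a: "cmod (\<alpha> j) < 1" for j unfolding \<alpha>_def by (rule verblunsky_step(2))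
  define W where "W = density circle_measure (\<lambda>z. ennreal (1 / (cmod (poly (szego \<alpha> n) z))\<^sup>2))"
  have nz: "poly (szego \<alpha> n) z \<noteq> 0" if "z \<in> sphere 0 1" for z
    using szego_root_in_disc[of n \<alpha> z] a that by auto
  have f: "continuous_on (sphere 0 1) (\<lambda>z. 1 / (cmod (poly (szego \<alpha> n) z))\<^sup>2)"
    using nz by (auto intro!: continuous_intros)
  have roots: "cmod x < 1" if "poly (szego \<alpha> n) x = 0" for x
    using szego_root_in_disc[OF a that] .
  note bs = monic_opuc_bernstein_szego[OF monic_szego[of \<alpha> n] roots, folded W_def]
  interpret W: circle_weight W by (rule bs(1))
  have Wn: "szego (verblunsky W) n = szego \<alpha> n"
    using bs(2) W.monic_opuc_szego[of n] by simp
  have eqk: "szego \<alpha> k = szego (verblunsky W) k" if "k \<le> n" for k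
    by (rule szego_determines_initial[OF Wn[symmetric] a that])
  have eqv: "verblunsky W j = \<alpha> j" if "j < n" for j
  proof -
    have "coeff (szego \<alpha> (Suc j)) 0 = coeff (szego (verblunsky W) (Suc j)) 0"
      using eqk[of "Suc j"] that by simp
    then show ?thesis by (simp add: coeff_reversed_poly)
  qed
  define X where "X = (\<integral>z. 1 / (cmod (poly (szego \<alpha> n) z))\<^sup>2 \<partial>circle_measure)"
  define \<kappa> where "\<kappa> = (\<Prod>j<n. 1 - (cmod (\<alpha> j))\<^sup>2)"
  have "(\<Prod>j<n. 1 - (cmod (verblunsky W j))\<^sup>2) = \<kappa>" unfolding \<kappa>_def using eqv by simp
  then have X\<kappa>: "X * \<kappa> = 1" using bs(3) unfolding X_def by simp
  have Wint: "(\<integral>z. g z \<partial>W) = (\<integral>z. g z * of_real (1 / (cmod (poly (szego \<alpha> n) z))\<^sup>2) \<partial>circle_measure)"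
    if "continuous_on (sphere 0 1) g" for g :: "complex \<Rightarrow> complex"
    unfolding W_def using that by (subst integral_density_circle[OF f]) (auto simp: scaleR_conv_of_real mult.commute)
  have "(\<integral>z. (1::complex) \<partial>W) = (\<integral>z. complex_of_real (1 / (cmod (poly (szego \<alpha> n) z))\<^sup>2) \<partial>circle_measure)"
    by (subst Wint) auto
  also have "\<dots> = of_real X" unfolding X_def by (rule integral_complex_of_real)
  finally have "of_real \<kappa> * (\<integral>z. (1::complex) \<partial>W) = of_real (X * \<kappa>)"
    by (simp add: mult.commute)
  then have mass: "(\<integral>z. 1 \<partial>M) = of_real \<kappa> * (\<integral>z. (1::complex) \<partial>W)"
    unfolding X\<kappa> circle_weight_prob_mass[OF assms(2)] by simp
  have meq: "monic_opuc M k = monic_opuc W k" if "k \<le> n" for k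
    using eqk[OF that] unfolding monic_opuc_szego W.monic_opuc_szego \<alpha>_def .
  have "(\<integral>z. z ^ k \<partial>M) = of_real \<kappa> * (\<integral>z. z ^ k \<partial>W)"
    by (rule moments_eq_of_monic_opuc_eq[OF cw bs(1) meq mass assms(3)])
  also have "(\<integral>z. z ^ k \<partial>W) = (\<integral>z. z ^ k * of_real (1 / (cmod (poly (szego \<alpha> n) z))\<^sup>2) \<partial>circle_measure)"
    by (intro Wint continuous_intros)
  finally show ?thesis unfolding \<kappa>_def .
qed

lemma exp_power_sums_monic:
  assumes q: "degree q = n \<and> lead_coeff q = 1" and roots: "\<And>x. poly q x = 0 \<Longrightarrow> cmod x < 1"
    and z: "cmod z \<le> 1"
  shows "exp (- pser (power_sum_coeff (proots q)) z) = poly (reversed_poly n q) z"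
proof -
  have "q \<noteq> 0" using q by auto
  then have Z: "cmod x < 1" if "x \<in># proots q" for x using that roots by auto
  show ?thesis
    unfolding pser_def poly_reversed_monic[OF conjunct1[OF q] conjunct2[OF q]]
    by (rule exp_power_sum_series[OF Z]) (auto simp: z)
qed

text \<open>The power sums are the coefficients of minus the logarithm of the reversal, which has
  the same modulus as q on the circle.\<close>

lemma inverse_monic_exp:
  assumes q: "degree q = n \<and> lead_coeff q = 1" and roots: "\<And>x. poly q x = 0 \<Longrightarrow> cmod x < 1"
    and z: "cmod z = 1"
  shows "1 / (cmod (poly q z))\<^sup>2 = exp (2 * Re (pser (power_sum_coeff (proots q)) z))"
proof -
  have "exp (- pser (power_sum_coeff (proots q)) z) = poly (reversed_poly n q) z"
    by (rule exp_power_sums_monic[OF q roots]) (simp_all add: z)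
  then have "cmod (poly (reversed_poly n q) z) = exp (- Re (pser (power_sum_coeff (proots q)) z))"
    by (metis norm_exp_eq_Re uminus_complex.simps(1))
  moreover have "cmod (poly (reversed_poly n q) z) = cmod (poly q z)"
    using z q by (subst poly_reversed_poly_circle) (auto simp: norm_mult norm_power)
  ultimately have c: "cmod (poly q z) = exp (- Re (pser (power_sum_coeff (proots q)) z))"
    by simp
  show ?thesis unfolding c by (simp add: exp_minus exp_double power_inverse divide_inverse)
qed

text \<open>The k-th moment of M equals that of the normalized n-th Bernstein-Szego weight once n
  \<ge> k, so the limit weight along a subsequence has exactly the moments of M and is its
  density.\<close>

theorem density_of_summable_verblunsky:
  fixes M :: "complex measure"
  assumes cw: "circle_weight M" and pM: "prob_space M"
    and sm: "summable (\<lambda>n. real n * (cmod (verblunsky M n))\<^sup>2)"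
  obtains L where "integrable circle_measure L" "M = density circle_measure (\<lambda>z. ennreal (exp (L z)))"
    "summable (\<lambda>k. real (Suc k) * (cmod (circle_fourier_coeff L (int (Suc k))))\<^sup>2)"
proof -
  interpret M: circle_weight M by fact
  define \<alpha> where "\<alpha> = verblunsky M"
  have a: "cmod (\<alpha> j) < 1" for j unfolding \<alpha>_def by (rule M.verblunsky_step(2))
  have a2: "0 \<le> (cmod (\<alpha> j))\<^sup>2" "(cmod (\<alpha> j))\<^sup>2 < 1" for j
    using a[of j] by (auto simp: power_less_one_iff)
  define e where "e j = - real (Suc j) * ln (1 - (cmod (\<alpha> j))\<^sup>2)" for j
  have se: "summable e"
    using sm summable_weighted_log_iff[of "\<lambda>j. (cmod (\<alpha> j))\<^sup>2", OF a2] unfolding e_def \<alpha>_def by simp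
  have lneg: "ln (1 - (cmod (\<alpha> j))\<^sup>2) \<le> 0" for j using a2[of j] by simp
  have e_nonneg: "0 \<le> e j" for j unfolding e_def using mult_nonneg_nonpos[OF _ lneg, of "real (Suc j)" j] by (simp del: of_nat_Suc)
  define S where "S = suminf e"
  define A where "A n = power_sum_coeff (proots (szego \<alpha> n))" for n
  have Z: "cmod x < 1" if "x \<in># proots (szego \<alpha> n)" for x n
  proof -
    have "szego \<alpha> n \<noteq> 0" using coeff_szego[of \<alpha> n] by (metis coeff_0 zero_neq_one)
    then show ?thesis using that szego_root_in_disc[OF a] by auto
  qed
  have sA: "summable (\<lambda>l. cmod (A n l))" for n
    unfolding A_def by (rule summable_norm_power_sum_coeff(2)[OF Z])
  have A0: "A n 0 = 0" for n unfolding A_def power_sum_coeff_def by simp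
  have AS: "(\<Sum>l\<le>K. real l * (cmod (A n l))\<^sup>2) \<le> S" for n K
  proof -
    have s: "(\<lambda>l. real l * (cmod (A n l))\<^sup>2) sums (\<Sum>j<n. e j)"
      unfolding A_def e_def by (rule energy_szego[OF a])
    have "(\<Sum>l\<le>K. real l * (cmod (A n l))\<^sup>2) \<le> (\<Sum>j<n. e j)"
      using s sum_le_suminf[OF sums_summable[OF s], of "{..K}"] by (simp add: sums_iff)
    also have "\<dots> \<le> S" unfolding S_def by (rule sum_le_suminf[OF se]) (use e_nonneg in auto)
    finally show ?thesis .
  qed
  obtain c h s where h: "c 0 = 0" "\<And>K. (\<Sum>l\<le>K. real l * (cmod (c l))\<^sup>2) \<le> S"
    "h \<in> borel_measurable circle_measure" "integrable circle_measure h" "strict_mono s"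
    "AE z in circle_measure. (\<lambda>n. pser (A (s n)) z) \<longlonglongrightarrow> h z"
    "\<And>k. (\<integral>z. cnj z ^ k * h z \<partial>circle_measure) = c k"
    "\<And>k. (\<integral>z. z ^ Suc k * h z \<partial>circle_measure) = 0"
    by (rule energy_compactness[OF sA A0 AS]) (rule that)
  note [measurable] = h(3)
  define u where "u n z = complex_of_real (exp (2 * Re (pser (A (s n)) z)))" for n z
  define v where "v z = complex_of_real (exp (2 * Re (h z)))" for z
  have vm: "v \<in> borel_measurable circle_measure" unfolding v_def by measurable
  have uv: "AE z in circle_measure. (\<lambda>n. u n z) \<longlonglongrightarrow> v z"
    using h(6) by eventually_elim (auto simp: u_def v_def intro!: tendsto_intros)
  note conv = exp_convergence_of_energy[OF sA A0 AS vm uv[unfolded u_def], folded u_def]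
  \<comment> \<open>The normalizing products converge to a positive number exp x, because the series
    of logarithms is dominated by that of e.\<close>
  define \<kappa> where "\<kappa> n = (\<Prod>j<n. 1 - (cmod (\<alpha> j))\<^sup>2)" for n
  have sl: "summable (\<lambda>j. ln (1 - (cmod (\<alpha> j))\<^sup>2))"
  proof (rule summable_comparison_test[OF _ se], intro exI allI impI)
    fix j :: nat
    have "1 * - ln (1 - (cmod (\<alpha> j))\<^sup>2) \<le> real (Suc j) * - ln (1 - (cmod (\<alpha> j))\<^sup>2)"
      using lneg[of j] by (intro mult_right_mono) auto
    then show "norm (ln (1 - (cmod (\<alpha> j))\<^sup>2)) \<le> e j" unfolding e_def using lneg[of j] by (simp del: of_nat_Suc)
  qed
  define x where "x = (\<Sum>j. ln (1 - (cmod (\<alpha> j))\<^sup>2))"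
  have "\<kappa> n = exp (\<Sum>j<n. ln (1 - (cmod (\<alpha> j))\<^sup>2))" for n
    unfolding \<kappa>_def exp_sum[OF finite_lessThan] using a2 by (intro prod.cong refl) simp
  moreover have "(\<lambda>n. exp (\<Sum>j<n. ln (1 - (cmod (\<alpha> j))\<^sup>2))) \<longlonglongrightarrow> exp x"
    unfolding x_def by (intro tendsto_exp summable_LIMSEQ sl)
  ultimately have \<kappa>: "\<kappa> \<longlonglongrightarrow> exp x" by presburger
  have mom: "(\<integral>z. z ^ k \<partial>M) = of_real (exp x) * (\<integral>z. z ^ k * v z \<partial>circle_measure)" for k
  proof -
    have "(\<lambda>n. \<integral>z. z ^ k * u n z \<partial>circle_measure) \<longlonglongrightarrow> (\<integral>z. z ^ k * v z \<partial>circle_measure)"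
      by (rule conv(2))
    moreover have "(\<lambda>n. complex_of_real (\<kappa> (s n))) \<longlonglongrightarrow> of_real (exp x)"
      by (intro tendsto_of_real LIMSEQ_subseq_LIMSEQ[OF \<kappa> h(5), unfolded o_def])
    ultimately have "(\<lambda>n. of_real (\<kappa> (s n)) * (\<integral>z. z ^ k * u n z \<partial>circle_measure)) \<longlonglongrightarrow>
        of_real (exp x) * (\<integral>z. z ^ k * v z \<partial>circle_measure)"
      by (intro tendsto_mult)
    moreover have "(\<lambda>n. of_real (\<kappa> (s n)) * (\<integral>z. z ^ k * u n z \<partial>circle_measure)) \<longlonglongrightarrow> (\<integral>z. z ^ k \<partial>M)"
    proof (rule tendsto_eventually)
      \<comment> \<open>The sequence is constant from n = k on, since s n \<ge> n.\<close>
      have "of_real (\<kappa> (s n)) * (\<integral>z. z ^ k * u n z \<partial>circle_measure) = (\<integral>z. z ^ k \<partial>M)" if "k \<le> n" for n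
      proof -
        have "k \<le> s n" using that seq_suble[OF h(5), of n] by linarith
        from bernstein_szego_moments[OF cw pM this, folded \<alpha>_def, folded \<kappa>_def]
        have "(\<integral>z. z ^ k \<partial>M) = of_real (\<kappa> (s n)) *
            (\<integral>z. z ^ k * of_real (1 / (cmod (poly (szego \<alpha> (s n)) z))\<^sup>2) \<partial>circle_measure)" .
        also have "(\<integral>z. z ^ k * of_real (1 / (cmod (poly (szego \<alpha> (s n)) z))\<^sup>2) \<partial>circle_measure) =
            (\<integral>z. z ^ k * u n z \<partial>circle_measure)"
          unfolding u_def A_def
          by (intro Bochner_Integration.integral_cong refl,
              subst inverse_monic_exp[OF monic_szego szego_root_in_disc[OF a]]) auto
        finally show ?thesis by (rule sym)
      qed
      then show "eventually (\<lambda>n. of_real (\<kappa> (s n)) * (\<integral>z. z ^ k * u n z \<partial>circle_measure) = (\<integral>z. z ^ k \<partial>M)) sequentially"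
        by (intro eventually_sequentiallyI)
    qed
    ultimately show ?thesis by (rule LIMSEQ_unique[THEN sym])
  qed
  \<comment> \<open>x is the logarithm of the limiting normalization; it becomes the mean of L,
    which the energy does not see.\<close>
  define L where "L z = x + 2 * Re (h z)" for z
  define D where "D = density circle_measure (\<lambda>z. ennreal (exp (L z)))"
  have Lm [measurable]: "L \<in> borel_measurable circle_measure" unfolding L_def by measurable
  have iL: "integrable circle_measure L"
    unfolding L_def using h(4) by (intro Bochner_Integration.integrable_add) auto
  have expL: "complex_of_real (exp (L z)) = of_real (exp x) * v z" for z
    unfolding L_def v_def by (simp add: exp_add)
  have ieL: "integrable circle_measure (\<lambda>z. exp (L z))"
  proof -
    have "integrable circle_measure (\<lambda>z. complex_of_real (exp (L z)))"
      unfolding expL using conv(1) by (rule integrable_mult_right)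
    then show ?thesis using integrable_Re by fastforce
  qed
  have "M = D"
  proof (rule measure_eq_of_moments)
    show "finite_measure M" by (rule M.finite_measure_axioms)
    show "sets M = sets circle_borel" by (rule M.sets_M)
    show "sets D = sets circle_borel" unfolding D_def by simp
    show "finite_measure D" unfolding D_def by (rule finite_measure_density_circle[OF ieL]) simp
    show "(\<integral>z. z ^ k \<partial>M) = (\<integral>z. z ^ k \<partial>D)" for k
    proof -
      have "(\<integral>z. z ^ k \<partial>D) = (\<integral>z. exp (L z) *\<^sub>R z ^ k \<partial>circle_measure)"
        unfolding D_def by (intro integral_density) auto
      also have "\<dots> = (\<integral>z. of_real (exp x) * (z ^ k * v z) \<partial>circle_measure)"
        unfolding scaleR_conv_of_real expL by (simp add: mult_ac)
      also have "\<dots> = of_real (exp x) * (\<integral>z. z ^ k * v z \<partial>circle_measure)"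
        by (rule integral_mult_right_zero)
      finally show ?thesis using mom by simp
    qed
  qed
  moreover have "summable (\<lambda>k. real (Suc k) * (cmod (circle_fourier_coeff L (int (Suc k))))\<^sup>2)"
  proof -
    have "circle_fourier_coeff L (int (Suc k)) = c (Suc k)" for k
      unfolding circle_fourier_coeff_eq[OF Lm] unfolding L_def
      by (subst fourier_coeff_2Re[OF h(4,7,8)]) simp
    moreover have "summable (\<lambda>k. real (Suc k) * (cmod (c (Suc k)))\<^sup>2)"
      using summable_of_bounded_energy[OF h(2)] by (rule summable_Suc_iff[THEN iffD2])
    ultimately show ?thesis by simp
  qed
  ultimately show ?thesis by (intro that[OF iL]) (simp_all only: D_def)
qed

subsection \<open>From the density to the Verblunsky coefficients\<close>

text \<open>The right side of \<open>energy_szego\<close>, cut off at J so that it depends on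
  finitely many coefficients and is continuous in the moments.\<close>

definition log_energy :: "complex measure \<Rightarrow> nat \<Rightarrow> real" where
  "log_energy M J = (\<Sum>j<J. - real (Suc j) * ln (1 - (cmod (verblunsky M j))\<^sup>2))"

definition exp_weight :: "(nat \<Rightarrow> complex) \<Rightarrow> complex measure" where
  "exp_weight a = density circle_measure (\<lambda>z. ennreal (exp (2 * Re (pser a z))))"

lemma circle_weight_exp_weight:
  assumes "summable (\<lambda>k. cmod (a k))"
  shows "circle_weight (exp_weight a)"
  unfolding exp_weight_def
  by (intro circle_weight_density continuous_intros continuous_on_pser_circle assms) simp

section \<open>Approximation by Bernstein-Szego weights\<close>

lemma reversed_reversed_poly:
  assumes "degree p \<le> n"
  shows "reversed_poly n (reversed_poly n p) = p"
  using assms by (auto simp: poly_eq_iff coeff_reversed_poly coeff_eq_0)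

lemma reversed_poly_monic:
  assumes "coeff p 0 = 1"
  shows "degree (reversed_poly n p) = n \<and> lead_coeff (reversed_poly n p) = 1"
  unfolding degree_monic_iff by (simp add: coeff_reversed_poly assms)

lemma reversed_poly_root:
  assumes p: "coeff p 0 = 1" "\<And>w. cmod w \<le> 1 \<Longrightarrow> poly p w \<noteq> 0" "degree p \<le> n"
    and x: "poly (reversed_poly n p) x = 0"
  shows "cmod x < 1"
proof (rule ccontr)
  assume "\<not> cmod x < 1"
  then have x1: "cmod x \<ge> 1" and "x \<noteq> 0" by auto
  have "x ^ n * cnj (poly p (1 / cnj x)) = 0"
    using poly_reversed_poly[OF p(3) \<open>x \<noteq> 0\<close>] x by simp
  then have "poly p (1 / cnj x) = 0" using \<open>x \<noteq> 0\<close> by simp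
  moreover have "cmod (1 / cnj x) \<le> 1" using x1 by (simp add: norm_divide divide_le_eq_1)
  ultimately show False using p(2) by blast
qed

text \<open>A logarithmic derivative with the denominator cleared. The factor z keeps the index in
  place, so that the sum on the right has the coefficients l a_l, see
  \<open>power_sum_series\<close>.\<close>

lemma log_derivative_linear_factors:
  assumes "\<And>x. x \<in># Z \<Longrightarrow> cmod x < 1" "cmod z \<le> 1"
  shows "z * poly (pderiv (\<Prod>x\<in>#Z. [:1, - cnj x:])) z =
    - (poly (\<Prod>x\<in>#Z. [:1, - cnj x:]) z * (\<Sum>x\<in>#Z. cnj x * z / (1 - cnj x * z)))"
  using assms(1)
proof (induction Z)
  case (add x Z)
  have "cmod (cnj x * z) < 1"
    using add.prems[of x] assms(2) mult_mono[of "cmod x" "cmod x" "cmod z" 1] by (simp add: norm_mult)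
  then have ne: "1 - cnj x * z \<noteq> 0" by auto
  define P where "P = (\<Prod>x\<in>#Z. [:1, - cnj x:])"
  define B where "B = (\<Sum>x\<in>#Z. cnj x * z / (1 - cnj x * z))"
  have IH: "z * poly (pderiv P) z = - (poly P z * B)"
    unfolding P_def B_def using add by auto
  define lin where "lin = [:1, - cnj x:]"
  have lin: "poly lin z = 1 - cnj x * z" "pderiv lin = [:- cnj x:]"
    unfolding lin_def by (simp_all add: pderiv_pCons)
  have "z * poly (pderiv (lin * P)) z = (1 - cnj x * z) * (z * poly (pderiv P) z) - cnj x * z * poly P z"
    unfolding pderiv_mult lin(2) poly_add poly_mult lin(1) by (simp add: algebra_simps)
  also have "\<dots> = - ((1 - cnj x * z) * poly P z * (cnj x * z / (1 - cnj x * z) + B))"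
    unfolding IH using ne by (simp add: distrib_left)
  also have "(1 - cnj x * z) * poly P z = poly (lin * P) z" unfolding poly_mult lin(1) ..
  finally show ?case unfolding P_def B_def lin_def image_mset_add_mset prod_mset.add_mset sum_mset.add_mset .
qed simp

lemma power_sum_series:
  assumes Z: "\<And>x. x \<in># Z \<Longrightarrow> cmod x < 1" and z: "cmod z \<le> 1"
  shows "pser (\<lambda>l. of_nat l * power_sum_coeff Z l) z = (\<Sum>x\<in>#Z. cnj x * z / (1 - cnj x * z))"
proof -
  \<comment> \<open>The term at l = 0 is set to 0, as l a_l vanishes there; the geometric series
    starts at 1.\<close>
  have "(\<lambda>l. \<Sum>x\<in>#Z. if l = 0 then 0 else (cnj x * z) ^ l) sums (\<Sum>x\<in>#Z. cnj x * z / (1 - cnj x * z))"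
  proof (rule sums_sum_mset)
    fix x assume "x \<in># Z"
    then have "cmod (cnj x * z) < 1"
      using Z[of x] z mult_mono[of "cmod x" "cmod x" "cmod z" 1] by (simp add: norm_mult)
    from sums_mult[OF geometric_sums[OF this], of "cnj x * z"]
    have "(\<lambda>l. if Suc l = 0 then 0 else (cnj x * z) ^ Suc l) sums (cnj x * z / (1 - cnj x * z))" by simp
    then show "(\<lambda>l. if l = 0 then 0 else (cnj x * z) ^ l) sums (cnj x * z / (1 - cnj x * z))"
      by (subst (asm) sums_Suc_iff) simp
  qed
  moreover have "(\<Sum>x\<in>#Z. if l = 0 then 0 else (cnj x * z) ^ l) = of_nat l * power_sum_coeff Z l * z ^ l" for l
  proof (cases "l = 0")
    case False
    have "(\<Sum>x\<in>#Z. (cnj x * z) ^ l) = (\<Sum>x\<in>#Z. cnj x ^ l) * z ^ l"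
      by (simp add: power_mult_distrib sum_mset_distrib_right)
    then show ?thesis using False by (simp add: power_sum_coeff_def)
  qed simp
  ultimately show ?thesis unfolding pser_def by (simp add: sums_iff)
qed

text \<open>A weighted square sum controls the maximum: the arithmetic-geometric inequality gives
  |d_l| \<le> e / l^2 + |l d_l|^2 / e, and both parts sum to at most a constant times e. At l = 0
  nothing arises, since d_0 = 0 and \<open>inverse 0 = 0\<close>.\<close>

lemma pser_bound_of_weighted_norm:
  assumes d: "summable (\<lambda>l. cmod (of_nat l * d l))" "d 0 = 0"
    and s: "summable (\<lambda>l. (cmod (of_nat l * d l))\<^sup>2)" "(\<Sum>l. (cmod (of_nat l * d l))\<^sup>2) \<le> e\<^sup>2" and e: "e > 0"
    and sd: "summable (\<lambda>l. cmod (d l))" and z: "cmod z \<le> 1"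
  shows "cmod (pser d z) \<le> e * ((\<Sum>l. inverse ((real l)\<^sup>2)) + 1)"
proof -
  have si: "summable (\<lambda>l. inverse ((real l)\<^sup>2))" by (rule inverse_power_summable) simp
  have pt: "cmod (d l * z ^ l) \<le> e * inverse ((real l)\<^sup>2) + (cmod (of_nat l * d l))\<^sup>2 / e" for l
  proof (cases "l = 0")
    case True
    then show ?thesis using d(2) by simp
  next
    case False
    have "cmod (d l * z ^ l) \<le> cmod (d l)"
      using z by (simp add: norm_mult norm_power mult_left_le power_le_one)
    also have "cmod (d l) \<le> e * inverse ((real l)\<^sup>2) + (cmod (of_nat l * d l))\<^sup>2 / e"
    proof -
      define x where "x = real l * cmod (d l)"
      have l: "real l > 0" using False by simp
      have "2 * (e * inverse (real l)) * x \<le> (e * inverse (real l))\<^sup>2 + x\<^sup>2"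
        by (rule sum_squares_bound)
      moreover have "x\<^sup>2 \<ge> 0" "0 \<le> (e * inverse (real l))\<^sup>2" by auto
      moreover have "(e * inverse (real l)) * x = e * cmod (d l)"
        unfolding x_def using l by simp
      ultimately have "e * cmod (d l) \<le> (e * inverse (real l))\<^sup>2 + x\<^sup>2" by linarith
      then have "e * cmod (d l) / e \<le> ((e * inverse (real l))\<^sup>2 + x\<^sup>2) / e"
        using e by (intro divide_right_mono) auto
      moreover have "e * cmod (d l) / e = cmod (d l)" using e by simp
      moreover have "((e * inverse (real l))\<^sup>2 + x\<^sup>2) / e = e * inverse ((real l)\<^sup>2) + x\<^sup>2 / e"
        using e by (simp add: add_divide_distrib power2_eq_square)
      moreover have "cmod (of_nat l * d l) = x" unfolding x_def by (simp add: norm_mult)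
      ultimately show ?thesis by simp
    qed
    finally show ?thesis .
  qed
  have "cmod (pser d z) \<le> (\<Sum>l. cmod (d l * z ^ l))"
    unfolding pser_def by (rule summable_norm[OF summable_pser(1)[OF sd z]])
  also have "\<dots> \<le> (\<Sum>l. e * inverse ((real l)\<^sup>2) + (cmod (of_nat l * d l))\<^sup>2 / e)"
    by (intro suminf_le pt summable_pser(1)[OF sd z] summable_add summable_mult summable_divide si s)
  also have "\<dots> = e * (\<Sum>l. inverse ((real l)\<^sup>2)) + (\<Sum>l. (cmod (of_nat l * d l))\<^sup>2) / e"
    using suminf_add[OF summable_mult[OF si, of e] summable_divide[OF s(1), of e]]
      suminf_mult[OF si, of e] suminf_divide[OF s(1), of e] by simp
  also have "(\<Sum>l. (cmod (of_nat l * d l))\<^sup>2) / e \<le> e\<^sup>2 / e"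
    using s(2) e by (intro divide_right_mono) auto
  finally show ?thesis using e by (simp add: distrib_left power2_eq_square)
qed

text \<open>From (x + y)^2 \<le> (1 + e) x^2 + (1 + 1 / e) y^2, where a perturbation of energy e^2
  contributes (1 + 1 / e) e^2 = e^2 + e. The weighting by e makes the loss vanish in the limit,
  whereas a plain factor 2 would not.\<close>

lemma energy_perturbation:
  fixes a A :: "nat \<Rightarrow> complex"
  assumes S: "(\<Sum>l\<le>K. real l * (cmod (a l))\<^sup>2) \<le> S"
    and d: "(\<Sum>l\<le>K. real l * (cmod (A l - a l))\<^sup>2) \<le> e\<^sup>2" and e: "e > 0"
  shows "(\<Sum>l\<le>K. real l * (cmod (A l))\<^sup>2) \<le> (1 + e) * S + e\<^sup>2 + e"
proof -
  have pt: "real l * (cmod (A l))\<^sup>2 \<le> (1 + e) * (real l * (cmod (a l))\<^sup>2) + (1 + 1 / e) * (real l * (cmod (A l - a l))\<^sup>2)" for l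
  proof -
    define x y where "x = cmod (a l)" and "y = cmod (A l - a l)"
    have "cmod (A l) \<le> x + y" unfolding x_def y_def using norm_triangle_ineq[of "a l" "A l - a l"] by simp
    then have "(cmod (A l))\<^sup>2 \<le> (x + y)\<^sup>2" by (intro power_mono) auto
    also have "(x + y)\<^sup>2 = x\<^sup>2 + y\<^sup>2 + 2 * (e * x) * y / e"
      using e by (simp add: power2_eq_square algebra_simps)
    also have "2 * (e * x) * y / e \<le> ((e * x)\<^sup>2 + y\<^sup>2) / e"
      using e sum_squares_bound[of "e * x" y] by (intro divide_right_mono) auto
    also have "x\<^sup>2 + y\<^sup>2 + ((e * x)\<^sup>2 + y\<^sup>2) / e = (1 + e) * x\<^sup>2 + (1 + 1 / e) * y\<^sup>2"
      using e by (simp add: power2_eq_square field_simps)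
    finally have "real l * (cmod (A l))\<^sup>2 \<le> real l * ((1 + e) * x\<^sup>2 + (1 + 1 / e) * y\<^sup>2)"
      by (intro mult_left_mono) auto
    then show ?thesis unfolding x_def y_def by (simp add: algebra_simps)
  qed
  have "(\<Sum>l\<le>K. real l * (cmod (A l))\<^sup>2) \<le>
      (1 + e) * (\<Sum>l\<le>K. real l * (cmod (a l))\<^sup>2) + (1 + 1 / e) * (\<Sum>l\<le>K. real l * (cmod (A l - a l))\<^sup>2)"
    unfolding sum_distrib_left sum.distrib[symmetric] by (intro sum_mono pt)
  also have "\<dots> \<le> (1 + e) * S + (1 + 1 / e) * e\<^sup>2"
    using S d e by (intro add_mono mult_left_mono) auto
  also have "(1 + 1 / e) * e\<^sup>2 = e\<^sup>2 + e" using e by (simp add: power2_eq_square field_simps)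
  finally show ?thesis by simp
qed

lemma log_energy_nonneg_terms:
  assumes "circle_weight M"
  shows "0 \<le> - real (Suc j) * ln (1 - (cmod (verblunsky M j))\<^sup>2)"
proof -
  interpret circle_weight M by fact
  have "(cmod (verblunsky M j))\<^sup>2 < 1" using verblunsky_step(2)[of j] by (simp add: power_less_one_iff)
  then have "ln (1 - (cmod (verblunsky M j))\<^sup>2) \<le> 0" by simp
  from mult_nonneg_nonpos[OF _ this, of "real (Suc j)"] show ?thesis by (simp del: of_nat_Suc)
qed

text \<open>The weight \<open>exp (2 Re p)\<close> is approximated by the Bernstein--Szego weights \<open>|1 - p/m|\<^bsup>-2m\<^esup>\<close>;
  the logarithmic derivative of \<open>(1 - p/m)\<^bsup>m\<^esup>\<close> is \<open>- p' / (1 - p/m)\<close>, uniformly close to \<open>- p'\<close>.\<close>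
lemma bernstein_szego_approximation:
  fixes p :: "complex poly"
  assumes p0: "coeff p 0 = 0" and S: "\<And>K. (\<Sum>l\<le>K. real l * (cmod (coeff p l))\<^sup>2) \<le> S"
    and G: "\<And>z. cmod z \<le> 1 \<Longrightarrow> cmod (poly p z) \<le> G" "\<And>z. cmod z \<le> 1 \<Longrightarrow> cmod (poly (pderiv p) z) \<le> G"
    and m: "real m \<ge> 2 * G + 1"
  defines "e \<equiv> (2 * G\<^sup>2 + 1) / real m"
  obtains A where "summable (\<lambda>l. cmod (A l))" "A 0 = 0"
    "\<And>z. cmod z \<le> 1 \<Longrightarrow> cmod (pser A z - poly p z) \<le> e * ((\<Sum>l. inverse ((real l)\<^sup>2)) + 1)"
    "\<And>K. (\<Sum>l\<le>K. real l * (cmod (A l))\<^sup>2) \<le> (1 + e) * S + e\<^sup>2 + e"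
    "log_energy (exp_weight A) J \<le> (1 + e) * S + e\<^sup>2 + e"
proof -
  have "G \<ge> 0" by (rule order_trans[OF norm_ge_zero G(1)[of 0]]) simp
  then have m0: "real m > 0" "m > 0" using m by auto
  \<comment> \<open>e dominates 2 G^2 / m, the error of the logarithmic derivative found below; the
    + 1 in its numerator keeps it positive for G = 0.\<close>
  have e: "e > 0" unfolding e_def using m0 by (simp add: add_nonneg_pos)
  define Q0 where "Q0 = 1 - smult (1 / of_nat m) p"
  have Q0z: "poly Q0 z = 1 - poly p z / of_nat m" for z unfolding Q0_def by simp
  have half: "cmod (poly p z / of_nat m) \<le> 1 / 2" if "cmod z \<le> 1" for z
  proof -
    have "cmod (poly p z / of_nat m) \<le> G / m" using G(1)[OF that] m0 by (simp add: norm_divide divide_right_mono)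
    also have "\<dots> \<le> 1 / 2" using m m0 \<open>G \<ge> 0\<close> by (simp add: field_simps)
    finally show ?thesis .
  qed
  have Q0half: "1 / 2 \<le> cmod (poly Q0 z)" if "cmod z \<le> 1" for z
    using norm_triangle_ineq2[of 1 "poly p z / of_nat m"] half[OF that] unfolding Q0z by simp
  define Q where "Q = Q0 ^ m"
  have Qnz: "poly Q z \<noteq> 0" if "cmod z \<le> 1" for z
    using Q0half[OF that] unfolding Q_def by auto
  have Q1: "coeff Q 0 = 1"
    using p0 unfolding Q_def Q0_def by (simp add: poly_0_coeff_0[symmetric])
  \<comment> \<open>Raising the degree to J lets the exact identity cover the first J coefficients;
    the roots this adds to q lie at 0 and do not affect |q| on the circle.\<close>
  define n where "n = max (degree Q) J"
  have dn: "degree Q \<le> n" "J \<le> n" unfolding n_def by auto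
  define q where "q = reversed_poly n Q"
  have qm: "degree q = n \<and> lead_coeff q = 1" unfolding q_def by (rule reversed_poly_monic[OF Q1])
  have roots: "cmod x < 1" if "poly q x = 0" for x
    using reversed_poly_root[OF Q1 Qnz dn(1)] that unfolding q_def by blast
  have rq: "reversed_poly n q = Q" unfolding q_def by (rule reversed_reversed_poly[OF dn(1)])
  define Z where "Z = proots q"
  have "q \<noteq> 0" using qm by auto
  then have Z: "cmod x < 1" if "x \<in># Z" for x using that roots unfolding Z_def by auto
  define A where "A = power_sum_coeff Z"
  have sA: "summable (\<lambda>l. cmod (A l))" "summable (\<lambda>l. cmod (of_nat l * A l))"
    unfolding A_def using summable_norm_power_sum_coeff[of Z] Z by auto
  have A0: "A 0 = 0" unfolding A_def power_sum_coeff_def by simp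
  define PZ where "PZ = (\<Prod>x\<in>#Z. [:1, - cnj x:])"
  have "poly PZ w = poly Q w" for w
  proof -
    have "poly PZ w = (\<Prod>x\<in>#Z. 1 - cnj x * w)" unfolding PZ_def by (induction Z) (auto simp: algebra_simps)
    also have "\<dots> = poly (reversed_poly n q) w"
      unfolding Z_def by (rule poly_reversed_monic[OF conjunct1[OF qm] conjunct2[OF qm], symmetric])
    finally show ?thesis unfolding rq .
  qed
  then have PZ: "PZ = Q" by (simp add: poly_eq_poly_eq_iff[symmetric] fun_eq_iff)
  \<comment> \<open>In the logarithmic derivative of Q = Q0^m all but one factor Q0 cancel, and the
    factor m cancels the 1 / m in Q0.\<close>
  have deriv: "pser (\<lambda>l. of_nat l * A l) z = z * poly (pderiv p) z / poly Q0 z" if z: "cmod z \<le> 1" for z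
  proof -
    have Q0nz: "poly Q0 z \<noteq> 0" using Q0half[OF z] by auto
    obtain k where k: "m = Suc k" using m0 gr0_conv_Suc by auto
    have "pderiv Q0 = - smult (1 / of_nat m) (pderiv p)"
      unfolding Q0_def by (simp add: pderiv_diff pderiv_smult)
    moreover have "pderiv Q = smult (of_nat m) (Q0 ^ k * pderiv Q0)"
      unfolding Q_def k by (simp add: pderiv_power_Suc del: of_nat_Suc power_Suc)
    ultimately have "poly (pderiv Q) z = - (poly Q0 z ^ k * poly (pderiv p) z)"
      using m0 by simp
    then have "z * poly (pderiv Q) z = - (poly Q0 z ^ k * (z * poly (pderiv p) z))" by simp
    moreover have "z * poly (pderiv PZ) z = - (poly PZ z * (\<Sum>x\<in>#Z. cnj x * z / (1 - cnj x * z)))"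
      unfolding PZ_def by (rule log_derivative_linear_factors[OF _ z]) (rule Z)
    moreover have "pser (\<lambda>l. of_nat l * A l) z = (\<Sum>x\<in>#Z. cnj x * z / (1 - cnj x * z))"
      unfolding A_def by (rule power_sum_series[OF _ z]) (rule Z)
    ultimately have "- (poly Q z * pser (\<lambda>l. of_nat l * A l) z) = - (poly Q0 z ^ k * (z * poly (pderiv p) z))"
      unfolding PZ by simp
    then have "poly Q z * pser (\<lambda>l. of_nat l * A l) z = poly Q0 z ^ k * (z * poly (pderiv p) z)"
      unfolding neg_equal_iff_equal .
    also have "poly Q z = poly Q0 z ^ k * poly Q0 z" unfolding Q_def k by simp
    finally have "poly Q0 z ^ k * (poly Q0 z * pser (\<lambda>l. of_nat l * A l) z) = poly Q0 z ^ k * (z * poly (pderiv p) z)"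
      by (simp only: mult.assoc)
    then have "poly Q0 z * pser (\<lambda>l. of_nat l * A l) z = z * poly (pderiv p) z" using Q0nz by simp
    then show ?thesis using Q0nz by (simp add: field_simps)
  qed
  define d where "d l = A l - coeff p l" for l
  have d0: "d 0 = 0" unfolding d_def using A0 p0 by simp
  define zp where "zp = pCons 0 (pderiv p)"
  have czp: "coeff zp l = of_nat l * coeff p l" for l
    unfolding zp_def by (cases l) (auto simp: coeff_pderiv)
  have ld: "of_nat l * d l = of_nat l * A l - coeff zp l" for l
    unfolding d_def czp by (simp add: algebra_simps)
  have sd: "summable (\<lambda>l. cmod (d l))"
    unfolding d_def
    by (rule summable_comparison_test[OF _ summable_add[OF sA(1) summable_coeff[of p]]])
       (auto intro!: exI[of _ 0] norm_triangle_ineq4)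
  have sld: "summable (\<lambda>l. cmod (of_nat l * d l))"
    unfolding ld
    by (rule summable_comparison_test[OF _ summable_add[OF sA(2) summable_coeff[of zp]]])
       (auto intro!: exI[of _ 0] norm_triangle_ineq4)
  have bd: "cmod (pser (\<lambda>l. of_nat l * d l) z) \<le> e" if z: "cmod z \<le> 1" for z
  proof -
    have Q0nz: "poly Q0 z \<noteq> 0" using Q0half[OF z] by auto
    have "pser (\<lambda>l. of_nat l * d l) z = pser (\<lambda>l. of_nat l * A l) z - poly zp z"
      unfolding ld poly_eq_pser by (rule pser_diff[OF sA(2) summable_coeff z, symmetric])
    also have "\<dots> = z * poly (pderiv p) z / poly Q0 z - z * poly (pderiv p) z"
      unfolding deriv[OF z] zp_def by simp
    \<comment> \<open>With w = p / m this is 1 / (1 - w) - 1 = w / (1 - w), and |1 - w| \<ge> 1 /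
      2.\<close>
    also have "\<dots> = z * poly (pderiv p) z * (poly p z / of_nat m) / poly Q0 z"
      using Q0nz unfolding Q0z by (simp add: field_simps)
    also have "cmod \<dots> = cmod z * cmod (poly (pderiv p) z) * (cmod (poly p z) / m) / cmod (poly Q0 z)"
      by (simp add: norm_mult norm_divide)
    also have "\<dots> \<le> 1 * G * (G / m) / (1 / 2)"
      using z G(1)[OF z] G(2)[OF z] Q0half[OF z] m0 \<open>G \<ge> 0\<close>
      by (intro frac_le mult_mono divide_right_mono mult_nonneg_nonneg) auto
    also have "\<dots> \<le> e" unfolding e_def using m0 by (simp add: power2_eq_square divide_right_mono)
    finally show ?thesis .
  qed
  have pv: "(\<lambda>l. (cmod (of_nat l * d l))\<^sup>2) sums (\<integral>z. (cmod (pser (\<lambda>l. of_nat l * d l) z))\<^sup>2 \<partial>circle_measure)"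
    by (rule pser_parseval[OF sld])
  \<comment> \<open>A uniform bound is an L2 bound on a probability space, and Parseval passes it on
    to the coefficients l d_l.\<close>
  have "(\<integral>z. (cmod (pser (\<lambda>l. of_nat l * d l) z))\<^sup>2 \<partial>circle_measure) \<le> (\<integral>z. e\<^sup>2 \<partial>circle_measure)"
    using bd by (intro integral_mono integrable_circle continuous_intros continuous_on_pser_circle sld)
      (auto intro!: power_mono)
  then have le: "(\<Sum>l. (cmod (of_nat l * d l))\<^sup>2) \<le> e\<^sup>2"
    using pv by (simp add: sums_iff)
  have unif: "cmod (pser A z - poly p z) \<le> e * ((\<Sum>l. inverse ((real l)\<^sup>2)) + 1)" if z: "cmod z \<le> 1" for z
  proof -
    have "pser A z - poly p z = pser d z"
      unfolding d_def poly_eq_pser by (rule pser_diff[OF sA(1) summable_coeff z])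
    then show ?thesis
      using pser_bound_of_weighted_norm[OF sld d0 sums_summable[OF pv] le e sd z] by simp
  qed
  have en: "(\<Sum>l\<le>K. real l * (cmod (A l))\<^sup>2) \<le> (1 + e) * S + e\<^sup>2 + e" for K
  proof (rule energy_perturbation[OF S _ e])
    have "(\<Sum>l\<le>K. real l * (cmod (A l - coeff p l))\<^sup>2) \<le> (\<Sum>l\<le>K. (cmod (of_nat l * d l))\<^sup>2)"
    proof (rule sum_mono)
      fix l :: nat
      have "real l \<le> (real l)\<^sup>2" by (cases "l = 0") (auto simp: power2_eq_square)
      then have "real l * (cmod (d l))\<^sup>2 \<le> (real l)\<^sup>2 * (cmod (d l))\<^sup>2" by (intro mult_right_mono) auto
      then show "real l * (cmod (A l - coeff p l))\<^sup>2 \<le> (cmod (of_nat l * d l))\<^sup>2"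
        unfolding d_def by (simp add: norm_mult power_mult_distrib)
    qed
    also have "\<dots> \<le> (\<Sum>l. (cmod (of_nat l * d l))\<^sup>2)"
      by (rule sum_le_suminf[OF sums_summable[OF pv]]) auto
    also note le
    finally show "(\<Sum>l\<le>K. real l * (cmod (A l - coeff p l))\<^sup>2) \<le> e\<^sup>2" .
  qed
  note bs = monic_opuc_bernstein_szego[OF qm roots]
  have W: "density circle_measure (\<lambda>z. ennreal (1 / (cmod (poly q z))\<^sup>2)) = exp_weight A"
    unfolding exp_weight_def
  proof (rule density_cong)
    have qnz: "poly q z \<noteq> 0" if "z \<in> sphere 0 1" for z using roots[of z] that by auto
    show "(\<lambda>z. ennreal (1 / (cmod (poly q z))\<^sup>2)) \<in> borel_measurable circle_measure"
      using qnz by (intro measurable_compose[OF borel_measurable_circle measurable_ennreal])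
        (auto intro!: continuous_intros)
    show "(\<lambda>z. ennreal (exp (2 * Re (pser A z)))) \<in> borel_measurable circle_measure"
      by (intro measurable_compose[OF borel_measurable_circle measurable_ennreal] continuous_intros
          continuous_on_pser_circle sA)
    show "AE z in circle_measure. ennreal (1 / (cmod (poly q z))\<^sup>2) = ennreal (exp (2 * Re (pser A z)))"
    proof (rule AE_I2)
      fix z assume "z \<in> space circle_measure"
      then have "cmod z = 1" by simp
      from inverse_monic_exp[OF qm roots this]
      show "ennreal (1 / (cmod (poly q z))\<^sup>2) = ennreal (exp (2 * Re (pser A z)))"
        unfolding A_def Z_def by simp
    qed
  qed
  interpret W: circle_weight "exp_weight A" using bs(1) unfolding W .
  have sz: "szego (verblunsky (exp_weight A)) n = q"
    using bs(2) W.monic_opuc_szego[of n] unfolding W by simp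
  have "(\<lambda>l. real l * (cmod (power_sum_coeff (proots (szego (verblunsky (exp_weight A)) n)) l))\<^sup>2) sums
      log_energy (exp_weight A) n"
    unfolding log_energy_def by (rule energy_szego) (rule W.verblunsky_step(2))
  then have es: "(\<lambda>l. real l * (cmod (A l))\<^sup>2) sums log_energy (exp_weight A) n"
    unfolding sz Z_def[symmetric] A_def[symmetric] .
  \<comment> \<open>The identity is exact at degree n; the terms from J to n - 1 are
    nonnegative.\<close>
  have "log_energy (exp_weight A) J \<le> log_energy (exp_weight A) n"
    unfolding log_energy_def
    by (rule sum_mono2) (use dn log_energy_nonneg_terms[OF W.circle_weight_axioms] in auto)
  also have "\<dots> \<le> (1 + e) * S + e\<^sup>2 + e"
  proof (rule LIMSEQ_le_const2)
    show "(\<lambda>K. \<Sum>l\<le>K. real l * (cmod (A l))\<^sup>2) \<longlonglongrightarrow> log_energy (exp_weight A) n"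
      using es by (simp add: sums_def_le)
  qed (use en in blast)
  finally have le: "log_energy (exp_weight A) J \<le> (1 + e) * S + e\<^sup>2 + e" .
  show ?thesis by (rule that[OF sA(1) A0 _ en le]) (rule unif)
qed

lemma integral_exp_weight:
  assumes "summable (\<lambda>l. cmod (a l))"
  shows "(\<integral>z. z ^ k \<partial>exp_weight a) = (\<integral>z. z ^ k * complex_of_real (exp (2 * Re (pser a z))) \<partial>circle_measure)"
  unfolding exp_weight_def
  by (subst integral_density_circle)
     (auto intro!: continuous_intros continuous_on_pser_circle assms simp: scaleR_conv_of_real mult.commute)

text \<open>J is fixed, so only finitely many Verblunsky coefficients enter, and these follow the
  moments, which converge by the energy bound S. The separate bounds T may be sharper than S and
  yield the limiting estimate.\<close>

lemma log_energy_limit: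
  fixes A :: "nat \<Rightarrow> nat \<Rightarrow> complex"
  assumes A: "\<And>i. summable (\<lambda>l. cmod (A i l))" "\<And>i. A i 0 = 0"
    and S: "\<And>i K. (\<Sum>l\<le>K. real l * (cmod (A i l))\<^sup>2) \<le> S"
    and v: "v \<in> borel_measurable circle_measure"
      "AE z in circle_measure. (\<lambda>i. complex_of_real (exp (2 * Re (pser (A i) z)))) \<longlonglongrightarrow> v z"
    and M: "circle_weight M" "c \<noteq> 0" "\<And>k. (\<integral>z. z ^ k \<partial>M) = c * (\<integral>z. z ^ k * v z \<partial>circle_measure)"
    and T: "\<And>i. log_energy (exp_weight (A i)) J \<le> T i" "T \<longlonglongrightarrow> T'"
  shows "log_energy M J \<le> T'"
proof -
  interpret M: circle_weight M by fact
  have mom: "(\<lambda>i. c * (\<integral>z. z ^ k \<partial>exp_weight (A i))) \<longlonglongrightarrow> (\<integral>z. z ^ k \<partial>M)" for k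
    unfolding M(3) integral_exp_weight[OF A(1)]
    by (intro tendsto_mult tendsto_const exp_convergence_of_energy[OF A S v])
  have lim: "(\<lambda>i. verblunsky (exp_weight (A i)) j) \<longlonglongrightarrow> verblunsky M j" for j
    by (rule verblunsky_tendsto[OF circle_weight_exp_weight[OF A(1)] M(1) mom M(2)])
  have "(\<lambda>i. log_energy (exp_weight (A i)) J) \<longlonglongrightarrow> log_energy M J"
    unfolding log_energy_def
  proof (intro tendsto_sum tendsto_mult tendsto_const tendsto_ln tendsto_diff tendsto_power tendsto_norm lim)
    fix j
    have "(cmod (verblunsky M j))\<^sup>2 < 1" using M.verblunsky_step(2)[of j] by (simp add: power_less_one_iff)
    then show "1 - (cmod (verblunsky M j))\<^sup>2 \<noteq> 0" by simp
  qed
  then show ?thesis using T(2) by (rule LIMSEQ_le) (use T(1) in blast)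
qed

text \<open>The logarithms of the approximating Bernstein-Szego weights converge uniformly, and the
  bounds on their log energies tend to S.\<close>

lemma log_energy_exp_poly:
  fixes p :: "complex poly"
  assumes p0: "coeff p 0 = 0" and S: "\<And>K. (\<Sum>l\<le>K. real l * (cmod (coeff p l))\<^sup>2) \<le> S"
  shows "log_energy (exp_weight (coeff p)) J \<le> S"
proof -
  have bdd: "\<exists>B. \<forall>z\<in>cball 0 1. cmod (poly r z) \<le> B" for r :: "complex poly"
  proof -
    have "compact (poly r ` cball 0 1)" by (intro compact_continuous_image continuous_intros) auto
    from compact_imp_bounded[OF this] obtain B where "\<forall>x\<in>poly r ` cball 0 1. norm x \<le> B"
      unfolding bounded_iff by blast
    then show ?thesis by (intro exI[of _ B]) auto
  qed
  obtain B1 where B1: "\<forall>z\<in>cball 0 1. cmod (poly p z) \<le> B1" using bdd[of p] ..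
  obtain B2 where B2: "\<forall>z\<in>cball 0 1. cmod (poly (pderiv p) z) \<le> B2" using bdd[of "pderiv p"] ..
  define G where "G = max B1 B2"
  have G: "cmod (poly p z) \<le> G" "cmod (poly (pderiv p) z) \<le> G" if "cmod z \<le> 1" for z
    using bspec[OF B1, of z] bspec[OF B2, of z] that unfolding G_def by auto
  have "G \<ge> 0" by (rule order_trans[OF norm_ge_zero G(1)[of 0]]) simp
  have "S \<ge> 0" using S[of 0] by simp
  \<comment> \<open>With the index shifted by N, every m = i + N is large enough for the
    approximation.\<close>
  obtain N :: nat where N: "2 * G + 1 \<le> real N" using real_arch_simple by blast
  define e where "e i = (2 * G\<^sup>2 + 1) / real (i + N)" for i
  define C where "C = (\<Sum>l. inverse ((real l)\<^sup>2)) + 1"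
  define P where "P i A \<longleftrightarrow> summable (\<lambda>l. cmod (A l)) \<and> A 0 = 0 \<and>
      (\<forall>z. cmod z \<le> 1 \<longrightarrow> cmod (pser A z - poly p z) \<le> e i * C) \<and>
      (\<forall>K. (\<Sum>l\<le>K. real l * (cmod (A l))\<^sup>2) \<le> (1 + e i) * S + (e i)\<^sup>2 + e i) \<and>
      log_energy (exp_weight A) J \<le> (1 + e i) * S + (e i)\<^sup>2 + e i" for i A
  have ex: "\<forall>i. \<exists>A. P i A"
  proof
    fix i
    have iN: "real (i + N) \<ge> 2 * G + 1" using N by simp
    note approx = bernstein_szego_approximation[OF p0 S _ _ iN, of J, folded e_def C_def]
    obtain A where A: "summable (\<lambda>l. cmod (A l))" "A 0 = 0"
      "\<And>z. cmod z \<le> 1 \<Longrightarrow> cmod (pser A z - poly p z) \<le> e i * C"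
      "\<And>K. (\<Sum>l\<le>K. real l * (cmod (A l))\<^sup>2) \<le> (1 + e i) * S + (e i)\<^sup>2 + e i"
      "log_energy (exp_weight A) J \<le> (1 + e i) * S + (e i)\<^sup>2 + e i"
      by (rule approx) (rule G(1), assumption, rule G(2), assumption, rule that)
    show "\<exists>A. P i A" unfolding P_def by (intro exI[of _ A] conjI allI impI A)
  qed
  from choice[OF ex] obtain A where PA: "\<And>i. P i (A i)" by blast
  have A: "summable (\<lambda>l. cmod (A i l))" "A i 0 = 0"
    "\<And>z. cmod z \<le> 1 \<Longrightarrow> cmod (pser (A i) z - poly p z) \<le> e i * C"
    "\<And>K. (\<Sum>l\<le>K. real l * (cmod (A i l))\<^sup>2) \<le> (1 + e i) * S + (e i)\<^sup>2 + e i"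
    "log_energy (exp_weight (A i)) J \<le> (1 + e i) * S + (e i)\<^sup>2 + e i" for i
    using PA[of i] unfolding P_def by blast+
  have e0: "e \<longlonglongrightarrow> 0"
  proof -
    have "(\<lambda>i. (2 * G\<^sup>2 + 1) / real i) \<longlonglongrightarrow> 0" by (rule lim_const_over_n)
    from LIMSEQ_ignore_initial_segment[OF this, of N] show ?thesis unfolding e_def .
  qed
  have e_nonneg: "0 \<le> e i" for i unfolding e_def by simp
  have e_le: "e i \<le> e 0" for i
    unfolding e_def using N \<open>G \<ge> 0\<close> by (intro divide_left_mono) auto
  have TT: "(\<lambda>i. (1 + e i) * S + (e i)\<^sup>2 + e i) \<longlonglongrightarrow> (1 + 0) * S + 0\<^sup>2 + 0"
    by (intro tendsto_intros e0)
  \<comment> \<open>Convergence of the moments needs one energy bound for all i; e is largest at i =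
    0.\<close>
  have AS: "(\<Sum>l\<le>K. real l * (cmod (A i l))\<^sup>2) \<le> (1 + e 0) * S + (e 0)\<^sup>2 + e 0" for i K
  proof -
    have "(1 + e i) * S + (e i)\<^sup>2 + e i \<le> (1 + e 0) * S + (e 0)\<^sup>2 + e 0"
      using e_le[of i] e_nonneg[of i] \<open>S \<ge> 0\<close> by (intro add_mono mult_right_mono power_mono) auto
    then show ?thesis by (rule order_trans[OF A(4)])
  qed
  define v where "v z = complex_of_real (exp (2 * Re (pser (coeff p) z)))" for z
  have "log_energy (exp_weight (coeff p)) J \<le> (1 + 0) * S + 0\<^sup>2 + 0"
  proof (rule log_energy_limit[OF A(1,2) AS _ _ _ _ _ A(5) TT])
    show "v \<in> borel_measurable circle_measure"
      unfolding v_def by (intro borel_measurable_circle continuous_intros continuous_on_pser_circle summable_coeff)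
    show "AE z in circle_measure. (\<lambda>i. complex_of_real (exp (2 * Re (pser (A i) z)))) \<longlonglongrightarrow> v z"
    proof (rule AE_I2)
      fix z assume "z \<in> space circle_measure"
      then have z: "cmod z \<le> 1" by simp
      have "(\<lambda>i. pser (A i) z - poly p z) \<longlonglongrightarrow> 0"
      proof (rule Lim_null_comparison)
        show "eventually (\<lambda>i. cmod (pser (A i) z - poly p z) \<le> e i * C) sequentially"
          using A(3)[OF z] by (intro always_eventually allI)
        show "(\<lambda>i. e i * C) \<longlonglongrightarrow> 0" using tendsto_mult_right[OF e0, of C] by simp
      qed
      then have "(\<lambda>i. pser (A i) z) \<longlonglongrightarrow> pser (coeff p) z"
        unfolding poly_eq_pser by (simp only: LIM_zero_iff)
      then show "(\<lambda>i. complex_of_real (exp (2 * Re (pser (A i) z)))) \<longlonglongrightarrow> v z"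
        unfolding v_def by (intro tendsto_intros)
    qed
    show "circle_weight (exp_weight (coeff p))" by (rule circle_weight_exp_weight[OF summable_coeff])
    show "(\<integral>z. z ^ k \<partial>exp_weight (coeff p)) = 1 * (\<integral>z. z ^ k * v z \<partial>circle_measure)" for k
      unfolding v_def integral_exp_weight[OF summable_coeff] by simp
  qed simp
  then show ?thesis by simp
qed

text \<open>The coefficients of L at positive frequencies define h, and L = x + 2 Re h almost
  everywhere by uniqueness. The truncations are polynomials of energy at most S, and the bound on
  their log energies passes to M.\<close>

theorem summable_verblunsky_of_density:
  fixes M :: "complex measure"
  assumes cw: "circle_weight M" and L: "integrable circle_measure L"
    and M: "M = density circle_measure (\<lambda>z. ennreal (exp (L z)))"
    and sm: "summable (\<lambda>k. real (Suc k) * (cmod (circle_fourier_coeff L (int (Suc k))))\<^sup>2)"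
  shows "summable (\<lambda>n. real n * (cmod (verblunsky M n))\<^sup>2)"
proof -
  interpret M: circle_weight M by fact
  have Lm [measurable]: "L \<in> borel_measurable circle_measure" using L by (rule borel_measurable_integrable)
  \<comment> \<open>The mean of L is split off and kept as x; it only scales the weight.\<close>
  define a where "a k = (if k = 0 then 0 else circle_fourier_coeff L (int k))" for k
  have a0: "a 0 = 0" unfolding a_def by simp
  have se: "summable (\<lambda>l. real l * (cmod (a l))\<^sup>2)"
    using sm by (subst summable_Suc_iff[symmetric]) (simp add: a_def)
  define S where "S = (\<Sum>l. real l * (cmod (a l))\<^sup>2)"
  have aS: "(\<Sum>l\<le>K. real l * (cmod (a l))\<^sup>2) \<le> S" for K
    unfolding S_def by (rule sum_le_suminf[OF se]) auto
  obtain h r where h: "h \<in> borel_measurable circle_measure" "integrable circle_measure h" "strict_mono r"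
    "AE z in circle_measure. (\<lambda>n. poly (trunc_poly a (r n)) z) \<longlonglongrightarrow> h z"
    "(\<lambda>n. \<integral>z. cmod (poly (trunc_poly a (r n)) z - h z) \<partial>circle_measure) \<longlonglongrightarrow> 0"
    "\<And>k. (\<integral>z. cnj z ^ k * h z \<partial>circle_measure) = a k"
    "\<And>k. (\<integral>z. z ^ Suc k * h z \<partial>circle_measure) = 0"
    by (rule L2_limit_of_truncations[OF summable_square_of_energy[OF se]]) (rule that)
  note [measurable] = h(1)
  define x where "x = (\<integral>z. L z \<partial>circle_measure)"
  have iF: "integrable circle_measure (\<lambda>z. x + 2 * Re (h z))"
    using h(2) by (intro Bochner_Integration.integrable_add) auto
  have bm: "integrable circle_measure (\<lambda>z. cnj z ^ k * complex_of_real (f z))"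
    if "integrable circle_measure f" for f k
  proof (rule Bochner_Integration.integrable_bound[OF that])
    have [measurable]: "(\<lambda>z. cnj z ^ k) \<in> borel_measurable circle_measure"
      by (intro borel_measurable_circle continuous_intros)
    have [measurable]: "f \<in> borel_measurable circle_measure" using that by (rule borel_measurable_integrable)
    show "(\<lambda>z. cnj z ^ k * complex_of_real (f z)) \<in> borel_measurable circle_measure" by measurable
  qed (auto simp: norm_mult norm_power)
  \<comment> \<open>Nonnegative frequencies suffice because both functions are real.\<close>
  have LF: "(\<integral>z. cnj z ^ k * of_real (L z) \<partial>circle_measure) = (\<integral>z. cnj z ^ k * of_real (x + 2 * Re (h z)) \<partial>circle_measure)" for k
  proof (cases "k = 0")
    case True
    have "(\<integral>z. complex_of_real (L z) \<partial>circle_measure) = of_real x" unfolding x_def by (rule integral_complex_of_real)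
    then show ?thesis unfolding fourier_coeff_2Re[OF h(2,6,7)] using True a0 by simp
  next
    case False
    then show ?thesis
      unfolding fourier_coeff_2Re[OF h(2,6,7)] circle_fourier_coeff_eq[OF Lm, symmetric] by (simp add: a_def)
  qed
  have "AE z in circle_measure. L z - (x + 2 * Re (h z)) = 0"
  proof (rule fourier_unique_zero)
    show "integrable circle_measure (\<lambda>z. L z - (x + 2 * Re (h z)))"
      by (intro Bochner_Integration.integrable_diff L iF)
    show "(\<integral>z. z ^ k * of_real (L z - (x + 2 * Re (h z))) \<partial>circle_measure) = 0" for k
    proof -
      have "(\<integral>z. z ^ k * of_real (L z - (x + 2 * Re (h z))) \<partial>circle_measure) =
          (\<integral>z. cnj (cnj z ^ k * of_real (L z) - cnj z ^ k * of_real (x + 2 * Re (h z))) \<partial>circle_measure)"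
        by (simp add: algebra_simps)
      also have "\<dots> = cnj (\<integral>z. cnj z ^ k * of_real (L z) - cnj z ^ k * of_real (x + 2 * Re (h z)) \<partial>circle_measure)"
        by (rule Bochner_Integration.integral_cnj)
      also have "(\<integral>z. cnj z ^ k * of_real (L z) - cnj z ^ k * of_real (x + 2 * Re (h z)) \<partial>circle_measure) =
          (\<integral>z. cnj z ^ k * of_real (L z) \<partial>circle_measure) - (\<integral>z. cnj z ^ k * of_real (x + 2 * Re (h z)) \<partial>circle_measure)"
        by (intro Bochner_Integration.integral_diff bm L iF)
      finally show ?thesis unfolding LF by simp
    qed
  qed
  then have LAE: "AE z in circle_measure. L z = x + 2 * Re (h z)" by eventually_elim simp
  define v where "v z = complex_of_real (exp (2 * Re (h z)))" for z
  have vm: "v \<in> borel_measurable circle_measure" unfolding v_def by measurable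
  have mom: "(\<integral>z. z ^ k \<partial>M) = of_real (exp x) * (\<integral>z. z ^ k * v z \<partial>circle_measure)" for k
  proof -
    have "(\<integral>z. z ^ k \<partial>M) = (\<integral>z. exp (L z) *\<^sub>R z ^ k \<partial>circle_measure)"
      unfolding M by (intro integral_density) auto
    also have "\<dots> = (\<integral>z. of_real (exp x) * (z ^ k * v z) \<partial>circle_measure)"
    proof (rule integral_cong_AE)
      show "AE z in circle_measure. exp (L z) *\<^sub>R z ^ k = of_real (exp x) * (z ^ k * v z)"
        using LAE by eventually_elim (simp add: v_def exp_add scaleR_conv_of_real mult_ac)
    qed (use vm in measurable)
    also have "\<dots> = of_real (exp x) * (\<integral>z. z ^ k * v z \<partial>circle_measure)"
      by (rule integral_mult_right_zero)
    finally show ?thesis .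
  qed
  have bound: "log_energy M J \<le> S" for J
  proof (rule log_energy_limit[where A = "\<lambda>i. coeff (trunc_poly a (r i))" and T = "\<lambda>i. S" and c = "of_real (exp x)"])
    show "summable (\<lambda>l. cmod (coeff (trunc_poly a (r i)) l))" for i by (rule summable_coeff)
    show t0: "coeff (trunc_poly a (r i)) 0 = 0" for i using a0 by simp
    show tS: "(\<Sum>l\<le>K. real l * (cmod (coeff (trunc_poly a (r i)) l))\<^sup>2) \<le> S" for i K
      by (rule order_trans[OF sum_mono aS[of K]]) auto
    show "AE z in circle_measure. (\<lambda>i. complex_of_real (exp (2 * Re (pser (coeff (trunc_poly a (r i))) z)))) \<longlonglongrightarrow> v z"
      unfolding poly_eq_pser[symmetric] v_def using h(4) by eventually_elim (intro tendsto_intros)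
    show "log_energy (exp_weight (coeff (trunc_poly a (r i)))) J \<le> S" for i
      by (rule log_energy_exp_poly[OF t0 tS])
    show "complex_of_real (exp x) \<noteq> 0" by simp
  qed (rule vm cw mom tendsto_const)+
  have "summable (\<lambda>n. - real (Suc n) * ln (1 - (cmod (verblunsky M n))\<^sup>2))"
  proof (rule summableI_nonneg_bounded)
    show "0 \<le> - real (Suc n) * ln (1 - (cmod (verblunsky M n))\<^sup>2)" for n
      by (rule log_energy_nonneg_terms[OF cw])
    show "(\<Sum>n<J. - real (Suc n) * ln (1 - (cmod (verblunsky M n))\<^sup>2)) \<le> S" for J
      using bound[of J] unfolding log_energy_def .
  qed
  moreover have "(cmod (verblunsky M n))\<^sup>2 < 1" for n
    using M.verblunsky_step(2)[of n] by (simp add: power_less_one_iff)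
  ultimately show ?thesis
    using summable_weighted_log_iff[of "\<lambda>n. (cmod (verblunsky M n))\<^sup>2"] by simp
qed

text \<open>Uniqueness: the complement of A is a null set for N, hence for the density, hence for
  its summand S; on A itself S vanishes by singularity.\<close>

lemma singular_part_density:
  assumes f: "f \<in> borel_measurable N"
  shows "singular_part N (density N f) = null_measure N"
  unfolding singular_part_def
proof (rule the_equality)
  show "sets (null_measure N) = sets N \<and> mutually_singular (null_measure N) N \<and>
      (\<exists>w\<in>borel_measurable N. \<forall>A\<in>sets N. emeasure (density N f) A = emeasure (density N w) A + emeasure (null_measure N) A)"
  proof (intro conjI bexI[OF _ f] ballI)
    show "mutually_singular (null_measure N) N"
      unfolding mutually_singular_def by (intro bexI[of _ "space N"]) auto
  qed auto
  fix S assume S: "sets S = sets N \<and> mutually_singular S N \<and>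
      (\<exists>w\<in>borel_measurable N. \<forall>A\<in>sets N. emeasure (density N f) A = emeasure (density N w) A + emeasure S A)"
  then obtain w A where w: "\<forall>A\<in>sets N. emeasure (density N f) A = emeasure (density N w) A + emeasure S A"
    and A: "A \<in> sets N" "emeasure S A = 0" "emeasure N (space N - A) = 0"
    unfolding mutually_singular_def by auto
  show "S = null_measure N"
  proof (rule measure_eqI)
    fix B assume "B \<in> sets S"
    then have B: "B \<in> sets N" using S by simp
    have "emeasure N (B - A) = 0"
      using A(3) emeasure_mono[of "B - A" "space N - A" N] sets.sets_into_space[OF B] A(1) by auto
    then have "B - A \<in> null_sets N" using A(1) B by auto
    then have "B - A \<in> null_sets (density N f)"
      using absolutely_continuousI_density[OF f] unfolding absolutely_continuous_def by blast
    then have "emeasure S (B - A) = 0"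
      using w A(1) B by (metis add_eq_0_iff_both_eq_0 null_setsD1 sets.Diff)
    moreover have "emeasure S (B \<inter> A) = 0"
      using A(2) emeasure_mono[of "B \<inter> A" A S] A(1) S by auto
    moreover have "emeasure S B \<le> emeasure S (B - A) + emeasure S (B \<inter> A)"
    proof -
      have "B = (B - A) \<union> (B \<inter> A)" by auto
      then show ?thesis using emeasure_subadditive[of "B - A" S "B \<inter> A"] A(1) B S by (metis sets.Diff sets.Int)
    qed
    ultimately show "emeasure S B = emeasure (null_measure N) B" by simp
  qed (use S in simp)
qed

theorem theorem1p3:
  fixes \<mu> :: "complex measure"
  assumes "prob_space \<mu>"
    and "sets \<mu> = sets (restrict_space borel (sphere 0 1))"
    and "nontrivial_measure \<mu>"
  shows "summable (\<lambda>n. real n * (cmod (verblunsky \<mu> n))\<^sup>2) \<longleftrightarrow>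
    singular_part circle_measure \<mu> = null_measure circle_measure \<and>
    (\<exists>L :: complex \<Rightarrow> real.
       integrable circle_measure L \<and>
       \<mu> = density circle_measure (\<lambda>z. ennreal (exp (L z))) \<and>
       summable (\<lambda>k. real (Suc k) * (cmod (circle_fourier_coeff L (int (Suc k))))\<^sup>2))"
proof -
  have cw: "circle_weight \<mu>" by (rule circle_weight_of_nontrivial[OF assms])
  show ?thesis
  proof
    assume s: "summable (\<lambda>n. real n * (cmod (verblunsky \<mu> n))\<^sup>2)"
    obtain L where L: "integrable circle_measure L" "\<mu> = density circle_measure (\<lambda>z. ennreal (exp (L z)))"
      "summable (\<lambda>k. real (Suc k) * (cmod (circle_fourier_coeff L (int (Suc k))))\<^sup>2)"
      by (rule density_of_summable_verblunsky[OF cw assms(1) s]) (rule that)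
    have [measurable]: "L \<in> borel_measurable circle_measure" using L(1) by (rule borel_measurable_integrable)
    have "singular_part circle_measure \<mu> = null_measure circle_measure"
      unfolding L(2) by (rule singular_part_density) measurable
    then show "singular_part circle_measure \<mu> = null_measure circle_measure \<and>
      (\<exists>L :: complex \<Rightarrow> real. integrable circle_measure L \<and>
       \<mu> = density circle_measure (\<lambda>z. ennreal (exp (L z))) \<and>
       summable (\<lambda>k. real (Suc k) * (cmod (circle_fourier_coeff L (int (Suc k))))\<^sup>2))"
      using L by (intro conjI exI[of _ L])
  qed (use summable_verblunsky_of_density[OF cw] in blast)
qed

end
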